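(* Let $T:X\to X$ be an invertible map preserving an ergodic probability measure $\mu$, and let $M$ be a log-integrable linear cocycle above $T$ on $X\times\mathbb R^d$, with Lyapunov exponents $\lambda_1\geq\dotsb\geq\lambda_d$. Assume that $\|M(x)\|$ and $\|M(x)^{-1}\|$ are bounded uniformly in $x$. Let $I=\{i:\lambda_i<\lambda_{i-1}\}$ (with $\lambda_0=+\infty$). Consider $\epsilon\in(0,\min_{i\neq j\in I}|\lambda_i-\lambda_j|/(20d))$, $\rho>0$ and $C>0$. Then there exist $m_0\in\mathbb N$ and $D>0$ with the following properties. Consider a point $x$ satisfying $B_\epsilon(x)\leq C$. Then, for all $i\in I$, its subspaces $F^{(n)}_{\geq i}(x)$ and $F^{(-n)}_{\leq i}(x)$ are well defined for all $n\geq m_0$, and converge as $n\to\infty$ to subspaces $F^{(\infty)}_{\geq i}(x)$ and $F^{(-\infty)}_{\leq i}(x)$. Assume additionally that, for all $i\in I$, there exists $m\geq m_0$ such that the angle between $F^{(m)}_{\geq i}(x)$ and $F^{(-m)}_{<i}(x)$ is at least $\rho$. Then $E_i(x)=F^{(\infty)}_{\geq i}(x)\cap F^{(-\infty)}_{\leq i}(x)$ is a well-defined $d_i$-dimensional space for all $i\in I$. Moreover, the function $A_{20d\epsilon}(x)$, defined in terms of these subspaces $E_i(x)$, satisfies $A_{20d\epsilon}(x)\leq D$.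
   Context: Cocycle. $M(x)$ is an invertible $d\times d$ matrix depending measurably on $x$; $M^n(x)=M(T^{n-1}x)\dotsm M(x)$ and $M^{-n}(x)=M(T^{-n}x)^{-1}\dotsm M(T^{-1}x)^{-1}$ for $n\geq0$. Log-integrable: $\int\log\max(\|M(x)\|,\|M(x)^{-1}\|)\,d\mu<\infty$. The Lyapunov exponents are defined by $\frac1n\log\|\Lambda^iM^n(x)\|\to\lambda_1+\dotsb+\lambda_i$ for $\mu$-a.e. $x$ ($\Lambda^i$ = $i$-th exterior power). For $i\in I$, $d_i=\mathrm{Card}\{j:\lambda_j=\lambda_i\}$. $\mathbb R^d$ has its Euclidean norm. If $I$ is a singleton the minimum is $+\infty$. Functions $B_\epsilon$ (defined pointwise): $$B^+_\epsilon(x)=\sup_{1\leq i\leq d}\sup_{n\geq0}\Bigl(\bigl|\log\|\Lambda^iM^n(x)\|-n(\lambda_1+\dotsb+\lambda_i)\bigr|-n\epsilon\Bigr),$$ $$B^-_\epsilon(x)=\sup_{1\leq i\leq d}\sup_{n\leq0}\Bigl(\bigl|\log\|\Lambda^iM^n(x)\|-n(\lambda_d+\dotsb+\lambda_{d-i+1})\bigr|-|n|\epsilon\Bigr),$$ $B_\epsilon(x)=\max(B^+_\epsilon(x),B^-_\epsilon(x))$. Subspaces. For $i\in I$ and $n>0$, $F^{(n)}_{\geq i}(x)$ is the maximally contracted subspace of $M^n(x)$ of dimension $d-i+1$, i.e. the span of the eigenspaces of $\sqrt{M^n(x)^tM^n(x)}$ for its $d-i+1$ smallest eigenvalues (with multiplicity).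 Likewise $F^{(-n)}_{<i}(x)$ (resp. $F^{(-n)}_{\leq i}(x)$) is the maximally contracted subspace of $M^{-n}(x)$ of dimension $i-1$ (resp. $i+d_i-1$). Such a space is well defined if it is uniquely determined, i.e. there is a strict gap between the corresponding consecutive singular values. Convergence of subspaces is in the Grassmannian. The angle between two subspaces is the minimal angle between nonzero vectors of each (the condition being void when one of them is $\{0\}$). Pesin function. For $\eta>0$, $$A_\eta(x)=\sup_{i\in I}\ \sup_{v\in E_i(x)\setminus\{0\}}\ \sup_{m,n\in\mathbb Z}\frac{\|M^n(x)v\|}{\|M^m(x)v\|}e^{-(n-m)\lambda_i}e^{-(|n|+|m|)\eta/2}.$$ *)

theory Defs
  imports "HOL-Analysis.Analysis" "HOL-Probability.Probability_Measure" "HOL-Library.Multiset"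
begin

section \<open>Invertible ergodic maps and linear cocycles\<close>

definition ergodic_automorphism :: "'a measure \<Rightarrow> ('a \<Rightarrow> 'a) \<Rightarrow> bool" where
  "ergodic_automorphism \<mu> T \<longleftrightarrow>
     prob_space \<mu> \<and>
     bij_betw T (space \<mu>) (space \<mu>) \<and>
     T \<in> measurable \<mu> \<mu> \<and> inv_into (space \<mu>) T \<in> measurable \<mu> \<mu> \<and>
     distr \<mu> \<mu> T = \<mu> \<and>
     (\<forall>A\<in>sets \<mu>. T -` A \<inter> space \<mu> = A \<longrightarrow> measure \<mu> A = 0 \<or> measure \<mu> A = 1)"

text \<open>Operator norm for the Euclidean norm; the type class norm on \<open>real^'n^'n\<close> is the
  Hilbert--Schmidt norm.\<close>

definition mnorm :: "real^'n^'n \<Rightarrow> real" where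
  "mnorm A = onorm (\<lambda>v. A *v v)"

definition log_integrable_cocycle :: "'a measure \<Rightarrow> ('a \<Rightarrow> real^'n^'n) \<Rightarrow> bool" where
  "log_integrable_cocycle \<mu> M \<longleftrightarrow>
     M \<in> borel_measurable \<mu> \<and> (\<forall>x\<in>space \<mu>. invertible (M x)) \<and>
     integrable \<mu> (\<lambda>x. ln (max (mnorm (M x)) (mnorm (matrix_inv (M x)))))"

primrec cocycle_fwd :: "('a \<Rightarrow> 'a) \<Rightarrow> ('a \<Rightarrow> real^'n^'n) \<Rightarrow> nat \<Rightarrow> 'a \<Rightarrow> real^'n^'n" where
  "cocycle_fwd T M 0 x = mat 1"
| "cocycle_fwd T M (Suc n) x = M ((T ^^ n) x) ** cocycle_fwd T M n x"

primrec cocycle_bwd ::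
  "'a set \<Rightarrow> ('a \<Rightarrow> 'a) \<Rightarrow> ('a \<Rightarrow> real^'n^'n) \<Rightarrow> nat \<Rightarrow> 'a \<Rightarrow> real^'n^'n" where
  "cocycle_bwd X T M 0 x = mat 1"
| "cocycle_bwd X T M (Suc n) x =
     matrix_inv (M ((inv_into X T ^^ Suc n) x)) ** cocycle_bwd X T M n x"

definition cocycle ::
  "'a set \<Rightarrow> ('a \<Rightarrow> 'a) \<Rightarrow> ('a \<Rightarrow> real^'n^'n) \<Rightarrow> int \<Rightarrow> 'a \<Rightarrow> real^'n^'n" where
  "cocycle X T M n x =
     (if n \<ge> 0 then cocycle_fwd T M (nat n) x else cocycle_bwd X T M (nat (- n)) x)"

section \<open>Exterior powers\<close>

text \<open>The \<open>k\<close>-th exterior power of \<open>real^'n\<close> is realized as the space of antisymmetric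
  tensors of degree \<open>k\<close>, a tensor being given by its coordinates over the multi-indices
  \<open>s : {0..<k} \<rightarrow> 'n\<close> (only the values at such indices matter). On this space the \<open>k\<close>-th exterior
  power of \<open>A\<close> is the restriction of the \<open>k\<close>-th tensor power of \<open>A\<close>. The Euclidean tensor norm
  restricts to the usual Euclidean norm on the exterior power (the one for which the wedge products
  of distinct basis vectors are orthonormal) up to a constant factor depending only on \<open>k\<close>, which
  does not affect operator norms.\<close>

definition multi_index :: "nat \<Rightarrow> (nat \<Rightarrow> 'n) set" where
  "multi_index k = {..<k} \<rightarrow>\<^sub>E UNIV"

definition antisymmetric_tensor :: "nat \<Rightarrow> ((nat \<Rightarrow> 'n) \<Rightarrow> real) \<Rightarrow> bool" where
  "antisymmetric_tensor k w \<longleftrightarrow>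
     (\<forall>p s. p permutes {..<k} \<longrightarrow> s \<in> multi_index k \<longrightarrow> w (s \<circ> p) = of_int (sign p) * w s)"

definition tensor_norm :: "nat \<Rightarrow> ((nat \<Rightarrow> 'n::finite) \<Rightarrow> real) \<Rightarrow> real" where
  "tensor_norm k w = sqrt (\<Sum>s\<in>multi_index k. (w s)\<^sup>2)"

definition tensor_power ::
  "nat \<Rightarrow> real^'n^'n \<Rightarrow> ((nat \<Rightarrow> 'n::finite) \<Rightarrow> real) \<Rightarrow> ((nat \<Rightarrow> 'n) \<Rightarrow> real)" where
  "tensor_power k A w = (\<lambda>s. \<Sum>t\<in>multi_index k. (\<Prod>j<k. A $ s j $ t j) * w t)"

definition ext_power_norm :: "nat \<Rightarrow> real^'n^'n \<Rightarrow> real" where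
  "ext_power_norm k A =
     Sup {tensor_norm k (tensor_power k A w) | w. antisymmetric_tensor k w \<and> tensor_norm k w \<le> 1}"

section \<open>Lyapunov exponents\<close>

text \<open>Exponents are indexed by \<open>1, \<dots>, CARD('n)\<close>; other values of \<open>lam\<close> are irrelevant.\<close>

definition lyapunov_exponents ::
  "'a measure \<Rightarrow> ('a \<Rightarrow> 'a) \<Rightarrow> ('a \<Rightarrow> real^'n^'n) \<Rightarrow> (nat \<Rightarrow> real) \<Rightarrow> bool" where
  "lyapunov_exponents \<mu> T M lam \<longleftrightarrow>
     (\<forall>i j. 1 \<le> i \<longrightarrow> i \<le> j \<longrightarrow> j \<le> CARD('n) \<longrightarrow> lam j \<le> lam i) \<and>
     (AE x in \<mu>. \<forall>i\<in>{1..CARD('n)}.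
        (\<lambda>n::nat. 1 / real n * ln (ext_power_norm i (cocycle (space \<mu>) T M (int n) x)))
          \<longlonglongrightarrow> (\<Sum>j=1..i. lam j))"

definition exp_indices :: "nat \<Rightarrow> (nat \<Rightarrow> real) \<Rightarrow> nat set" where
  "exp_indices d lam = {i\<in>{1..d}. i = 1 \<or> lam i < lam (i - 1)}"

definition exp_mult :: "nat \<Rightarrow> (nat \<Rightarrow> real) \<Rightarrow> nat \<Rightarrow> nat" where
  "exp_mult d lam i = card {j\<in>{1..d}. lam j = lam i}"

text \<open>The functions \<open>B\<^sub>\<epsilon>\<^sup>+\<close>, \<open>B\<^sub>\<epsilon>\<^sup>-\<close>, \<open>B\<^sub>\<epsilon>\<close> may take the value \<open>\<infinity>\<close>.\<close>

definition B_plus ::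
  "'a set \<Rightarrow> ('a \<Rightarrow> 'a) \<Rightarrow> ('a \<Rightarrow> real^'n^'n) \<Rightarrow> (nat \<Rightarrow> real) \<Rightarrow> real \<Rightarrow> 'a \<Rightarrow> ereal" where
  "B_plus X T M lam \<epsilon> x =
     (SUP i\<in>{1..CARD('n)}. SUP n\<in>{0::int..}.
        ereal (\<bar>ln (ext_power_norm i (cocycle X T M n x)) - of_int n * (\<Sum>j=1..i. lam j)\<bar>
               - of_int n * \<epsilon>))"

definition B_minus ::
  "'a set \<Rightarrow> ('a \<Rightarrow> 'a) \<Rightarrow> ('a \<Rightarrow> real^'n^'n) \<Rightarrow> (nat \<Rightarrow> real) \<Rightarrow> real \<Rightarrow> 'a \<Rightarrow> ereal" where
  "B_minus X T M lam \<epsilon> x =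
     (SUP i\<in>{1..CARD('n)}. SUP n\<in>{..0::int}.
        ereal (\<bar>ln (ext_power_norm i (cocycle X T M n x))
                 - of_int n * (\<Sum>j=CARD('n) - i + 1..CARD('n). lam j)\<bar>
               - of_int \<bar>n\<bar> * \<epsilon>))"

definition B_fun ::
  "'a set \<Rightarrow> ('a \<Rightarrow> 'a) \<Rightarrow> ('a \<Rightarrow> real^'n^'n) \<Rightarrow> (nat \<Rightarrow> real) \<Rightarrow> real \<Rightarrow> 'a \<Rightarrow> ereal" where
  "B_fun X T M lam \<epsilon> x = max (B_plus X T M lam \<epsilon> x) (B_minus X T M lam \<epsilon> x)"

section \<open>Maximally contracted subspaces\<close>

definition pos_semidef :: "real^'n^'n \<Rightarrow> bool" where
  "pos_semidef A \<longleftrightarrow> transpose A = A \<and> (\<forall>v. 0 \<le> v \<bullet> (A *v v))"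

definition mat_sqrt :: "real^'n^'n \<Rightarrow> real^'n^'n" where
  "mat_sqrt A = (THE S. pos_semidef S \<and> S ** S = A)"

definition eigenspace :: "real^'n^'n \<Rightarrow> real \<Rightarrow> (real^'n) set" where
  "eigenspace A s = {v. A *v v = s *\<^sub>R v}"

definition sorted_eigenvalues :: "real^'n^'n \<Rightarrow> real list" where
  "sorted_eigenvalues A =
     sorted_list_of_multiset
       (\<Sum>s\<in>{s. eigenspace A s \<noteq> {0}}. replicate_mset (dim (eigenspace A s)) s)"

text \<open>Since \<open>sorted_eigenvalues\<close> is in increasing order, its first \<open>k\<close> entries are the \<open>k\<close>
  smallest singular values of \<open>A\<close>, counted with multiplicity.\<close>

definition contracted_subspace :: "real^'n^'n \<Rightarrow> nat \<Rightarrow> (real^'n) set" where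
  "contracted_subspace A k =
     (let S = mat_sqrt (transpose A ** A)
      in span (\<Union>j<k. eigenspace S (sorted_eigenvalues S ! j)))"

definition contracted_well_defined :: "real^'n^'n \<Rightarrow> nat \<Rightarrow> bool" where
  "contracted_well_defined A k \<longleftrightarrow>
     (let S = mat_sqrt (transpose A ** A)
      in 0 < k \<longrightarrow> k < CARD('n) \<longrightarrow> sorted_eigenvalues S ! (k - 1) < sorted_eigenvalues S ! k)"

definition F_ge ::
  "'a set \<Rightarrow> ('a \<Rightarrow> 'a) \<Rightarrow> ('a \<Rightarrow> real^'n^'n) \<Rightarrow> int \<Rightarrow> nat \<Rightarrow> 'a \<Rightarrow> (real^'n) set" where
  "F_ge X T M n i x = contracted_subspace (cocycle X T M n x) (CARD('n) - i + 1)"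

definition F_lt ::
  "'a set \<Rightarrow> ('a \<Rightarrow> 'a) \<Rightarrow> ('a \<Rightarrow> real^'n^'n) \<Rightarrow> int \<Rightarrow> nat \<Rightarrow> 'a \<Rightarrow> (real^'n) set" where
  "F_lt X T M n i x = contracted_subspace (cocycle X T M n x) (i - 1)"

definition F_le ::
  "'a set \<Rightarrow> ('a \<Rightarrow> 'a) \<Rightarrow> ('a \<Rightarrow> real^'n^'n) \<Rightarrow> (nat \<Rightarrow> real) \<Rightarrow> int \<Rightarrow> nat \<Rightarrow> 'a
     \<Rightarrow> (real^'n) set" where
  "F_le X T M lam n i x =
     contracted_subspace (cocycle X T M n x) (i + exp_mult CARD('n) lam i - 1)"

section \<open>Convergence of subspaces, and angles\<close>

definition grassmannian :: "nat \<Rightarrow> (real^'n) set set" where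
  "grassmannian k = {V. subspace V \<and> dim V = k}"

text \<open>The topology of the Grassmannian is given by the operator norm distance between orthogonal
  projections; for a subspace, \<open>closest_point\<close> is the orthogonal projection.\<close>

definition subspace_dist :: "(real^'n) set \<Rightarrow> (real^'n) set \<Rightarrow> real" where
  "subspace_dist V W = onorm (\<lambda>v. closest_point V v - closest_point W v)"

definition grassmannian_tendsto ::
  "nat \<Rightarrow> (nat \<Rightarrow> (real^'n) set) \<Rightarrow> (real^'n) set \<Rightarrow> bool" where
  "grassmannian_tendsto k V L \<longleftrightarrow>
     L \<in> grassmannian k \<and> (\<forall>\<^sub>F n in sequentially. V n \<in> grassmannian k) \<and>
     (\<lambda>n. subspace_dist (V n) L) \<longlonglongrightarrow> 0"

text \<open>The angle is \<open>\<infinity>\<close> if one of the subspaces is \<open>{0}\<close>, so that lower bounds on it are then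
  void.\<close>

definition subspace_angle :: "(real^'n) set \<Rightarrow> (real^'n) set \<Rightarrow> ereal" where
  "subspace_angle V W =
     (INF u\<in>V - {0}. INF w\<in>W - {0}. ereal (arccos (u \<bullet> w / (norm u * norm w))))"

section \<open>The Pesin function\<close>

definition pesin_fun ::
  "'a set \<Rightarrow> ('a \<Rightarrow> 'a) \<Rightarrow> ('a \<Rightarrow> real^'n^'n) \<Rightarrow> (nat \<Rightarrow> real) \<Rightarrow> (nat \<Rightarrow> (real^'n) set)
     \<Rightarrow> real \<Rightarrow> 'a \<Rightarrow> ereal" where
  "pesin_fun X T M lam E \<eta> x =
     (SUP i\<in>exp_indices CARD('n) lam. SUP v\<in>E i - {0}. SUP m::int. SUP n::int.
        ereal (norm (cocycle X T M n x *v v) / norm (cocycle X T M m x *v v)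
               * exp (- of_int (n - m) * lam i) * exp (- of_int (\<bar>n\<bar> + \<bar>m\<bar>) * \<eta> / 2)))"

end

theory Submission
  imports Defs
begin

text \<open>
  Along an orbit, let \<open>e\<^sub>1, \<dots>, e\<^sub>d\<close> be a frame of right singular vectors of \<open>A n = M\<^sup>n(x)\<close>, with singular values
  \<open>s\<^sub>1 \<ge> \<dots> \<ge> s\<^sub>d\<close>. The bound on \<open>B\<^sub>\<epsilon>\<close> says that \<open>ln s\<^sub>i = n \<lambda>\<^sub>i + O(C + n \<epsilon>)\<close>. As \<open>A n\<close> and \<open>A (n + 1)\<close> differ by a
  bounded factor, a unit vector of the tail \<open>span {e\<^sub>p, \<dots>, e\<^sub>d}\<close> at one time has at the next time a component of
  size \<open>O(exp (- n (\<lambda>\<^sub>j - \<lambda>\<^sub>p - 4 \<epsilon>)))\<close> along \<open>e\<^sub>j\<close>, for \<open>j < p\<close>. Hence the tails at a gap converge exponentially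
  fast, and summing these components over all later times shows, by induction on \<open>p\<close>, that \<open>A n\<close> grows on the limit
  at most like \<open>exp (n (\<lambda>\<^sub>p + 4 d \<epsilon>))\<close>. Conversely, a vector that makes a definite angle with the limit space at \<open>p\<close>
  grows at least like \<open>exp (n (\<lambda>\<^sub>p\<^sub>-\<^sub>1 - 2 \<epsilon>))\<close>, because its component in \<open>span {e\<^sub>1, \<dots>, e\<^sub>p\<^sub>-\<^sub>1}\<close> is not small.
  The backward cocycle satisfies the same hypotheses for the exponents \<open>- \<lambda>\<^sub>d\<^sub>+\<^sub>1\<^sub>-\<^sub>k\<close>. The angle condition passes
  to the limits and makes \<open>F\<^sub>\<ge>\<^sub>i\<close> and \<open>F\<^sub><\<^sub>i\<close> uniformly transverse for every \<open>i\<close>, so that on \<open>E\<^sub>i\<close> the upper and lower bounds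
  hold in both directions of time.
\<close>

section \<open>Singular frames\<close>

text \<open>The obstacle to the upper bound is that a tail approaches its limit only at the rate of
  the gap just above \<open>p\<close>, while \<open>A n\<close> may stretch the error by its largest
  singular value, of order exp(n lam 1). One estimate per coordinate is therefore kept: the
  component along \<open>e j\<close> is small at the rate lam j - lam p, which offsets the growth of
  \<open>A n\<close> on \<open>e j\<close> up to multiples of \<epsilon>, and that growth is known
  by induction because \<open>e j\<close> lies in the tail at \<open>j\<close>. The constants record
  losses. A singular value is a quotient of two exterior norms, so its logarithm is known up to 2 C
  + 2 n \<epsilon>. Comparing two of them costs 4 \<epsilon> per unit of time, so a gap above 20
  \<epsilon> still contracts by exp(- 16 \<epsilon>) per step. Each level of the induction costs
  another 4 \<epsilon>, at most 4 d \<epsilon> in all. The quotients in the Pesin function then stay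
  within 10 d \<epsilon>, half of 20 d \<epsilon>. The point enters only through \<open>C\<close>
  and the bounds on \<open>M\<close>, so one \<open>m0\<close> and one \<open>D\<close> serve all
  points.\<close>

definition orthonormal_family :: "nat \<Rightarrow> (nat \<Rightarrow> 'a::real_inner) \<Rightarrow> bool" where
  "orthonormal_family k e \<longleftrightarrow>
     (\<forall>i\<in>{1..k}. \<forall>j\<in>{1..k}. e i \<bullet> e j = (if i = j then 1 else 0))"

text \<open>A singular value decomposition without left singular vectors: orthogonality of the
  images of the frame takes their place. Strict positivity of \<open>s\<close> makes
  \<open>A\<close> invertible.\<close>

definition singular_frame :: "real^'n^'n \<Rightarrow> (nat \<Rightarrow> real^'n) \<Rightarrow> (nat \<Rightarrow> real) \<Rightarrow> bool" where
  "singular_frame A e s \<longleftrightarrow>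
     orthonormal_family CARD('n) e \<and>
     (\<forall>i\<in>{1..CARD('n)}. \<forall>j\<in>{1..CARD('n)}.
        (A *v e i) \<bullet> (A *v e j) = (if i = j then (s i)\<^sup>2 else 0)) \<and>
     (\<forall>i\<in>{1..CARD('n)}. 0 < s i) \<and>
     (\<forall>i\<in>{1..CARD('n)}. \<forall>j\<in>{1..CARD('n)}. i \<le> j \<longrightarrow> s j \<le> s i)"

lemma orthonormal_family_inner:
  assumes "orthonormal_family k e" "i \<in> {1..k}" "j \<in> {1..k}"
  shows "e i \<bullet> e j = (if i = j then 1 else 0)"
  using assms by (auto simp: orthonormal_family_def)

lemma orthonormal_family_norm:
  assumes "orthonormal_family k e" "i \<in> {1..k}"
  shows "norm (e i) = 1"
  using orthonormal_family_inner[OF assms(1,2,2)] by (simp add: norm_eq_1)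

lemma orthonormal_family_inj:
  assumes "orthonormal_family k e"
  shows "inj_on e {1..k}"
proof (rule inj_onI)
  fix i j assume ij: "i \<in> {1..k}" "j \<in> {1..k}" "e i = e j"
  then have "e i \<bullet> e j = 1"
    using orthonormal_family_inner[OF assms ij(1,1)] by simp
  then show "i = j"
    using orthonormal_family_inner[OF assms ij(1,2)] by (simp split: if_splits)
qed

lemma orthonormal_family_independent:
  fixes e :: "nat \<Rightarrow> 'a::euclidean_space"
  assumes "orthonormal_family k e"
  shows "pairwise orthogonal (e ` {1..k})" "independent (e ` {1..k})" "card (e ` {1..k}) = k"
proof -
  show p: "pairwise orthogonal (e ` {1..k})"
    using assms by (auto simp: pairwise_def orthogonal_def orthonormal_family_def)
  have "0 \<notin> e ` {1..k}"
    using orthonormal_family_norm[OF assms] by force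
  with p show "independent (e ` {1..k})"
    by (rule pairwise_orthogonal_independent)
  show "card (e ` {1..k}) = k"
    using card_image[OF orthonormal_family_inj[OF assms]] by simp
qed

lemma orthonormal_family_expand:
  fixes v :: "real^'n"
  assumes "orthonormal_family CARD('n) e"
  shows "v = (\<Sum>j\<in>{1..CARD('n)}. (v \<bullet> e j) *\<^sub>R e j)"
proof -
  note ind = orthonormal_family_independent[OF assms]
  have "span (e ` {1..CARD('n)}) = (UNIV :: (real^'n) set)"
    using ind by (intro dim_eq_full[THEN iffD1]) (simp add: dim_eq_card_independent)
  then have "(\<Sum>w\<in>e ` {1..CARD('n)}. (v \<bullet> w) *\<^sub>R w) = v"
    using ind orthonormal_family_norm[OF assms]
    by (intro orthonormal_basis_expand) auto
  then show ?thesis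
    using sum.reindex[OF orthonormal_family_inj[OF assms], of "\<lambda>w. (v \<bullet> w) *\<^sub>R w"] by simp
qed

lemma orthonormal_family_norm_sum:
  assumes "orthonormal_family k e" "J \<subseteq> {1..k}"
  shows "(norm (\<Sum>j\<in>J. c j *\<^sub>R e j))\<^sup>2 = (\<Sum>j\<in>J. (c j)\<^sup>2)"
proof -
  have fin: "finite J"
    using assms(2) finite_subset by blast
  have "(norm (\<Sum>j\<in>J. c j *\<^sub>R e j))\<^sup>2 = (\<Sum>i\<in>J. \<Sum>j\<in>J. c i * c j * (e i \<bullet> e j))"
    by (simp add: power2_norm_eq_inner inner_sum_left inner_sum_right sum_distrib_left mult_ac)
       (subst sum.swap, simp add: inner_commute mult_ac)
  also have "\<dots> = (\<Sum>i\<in>J. \<Sum>j\<in>J. if i = j then c i * c j else 0)"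
    using assms by (intro sum.cong refl) (auto simp: orthonormal_family_def subset_iff)
  also have "\<dots> = (\<Sum>j\<in>J. (c j)\<^sup>2)"
    using fin by (simp add: power2_eq_square)
  finally show ?thesis .
qed

lemma orthonormal_family_norm_expand:
  fixes v :: "real^'n"
  assumes "orthonormal_family CARD('n) e"
  shows "(norm v)\<^sup>2 = (\<Sum>j\<in>{1..CARD('n)}. (v \<bullet> e j)\<^sup>2)"
  using orthonormal_family_norm_sum[OF assms order_refl, of "\<lambda>j. v \<bullet> e j"]
    orthonormal_family_expand[OF assms, of v] by simp

lemma matrix_vector_mult_sum:
  fixes A :: "real^'n^'m"
  shows "A *v (\<Sum>j\<in>J. c j *\<^sub>R e j) = (\<Sum>j\<in>J. c j *\<^sub>R (A *v e j))"
proof (induction J rule: infinite_finite_induct)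
  case (insert x F)
  then show ?case
    by (simp add: matrix_vector_right_distrib matrix_vector_mult_scaleR)
qed simp_all

text \<open>The images of the frame are pairwise orthogonal, so the double sum collapses to its
  diagonal. The coordinate and tail estimates for \<open>A\<close> below all start from this
  formula.\<close>

lemma singular_frame_norm_mult:
  fixes A :: "real^'n^'n"
  assumes "singular_frame A e s"
  shows "(norm (A *v v))\<^sup>2 = (\<Sum>j\<in>{1..CARD('n)}. (s j)\<^sup>2 * (v \<bullet> e j)\<^sup>2)"
proof -
  let ?J = "{1..CARD('n)}"
  have o: "orthonormal_family CARD('n) e"
    using assms by (simp add: singular_frame_def)
  have "A *v v = (\<Sum>j\<in>?J. (v \<bullet> e j) *\<^sub>R (A *v e j))"
    using orthonormal_family_expand[OF o, of v] matrix_vector_mult_sum by metis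
  then have "(norm (A *v v))\<^sup>2
      = (\<Sum>i\<in>?J. \<Sum>j\<in>?J. (v \<bullet> e i) * (v \<bullet> e j) * ((A *v e i) \<bullet> (A *v e j)))"
    by (simp add: power2_norm_eq_inner inner_sum_left inner_sum_right sum_distrib_left mult_ac)
       (subst sum.swap, simp add: inner_commute mult_ac)
  also have "\<dots> = (\<Sum>i\<in>?J. \<Sum>j\<in>?J. if i = j then (v \<bullet> e i) * (v \<bullet> e j) * (s i)\<^sup>2 else 0)"
    using assms by (intro sum.cong refl) (auto simp: singular_frame_def)
  also have "\<dots> = (\<Sum>j\<in>?J. (s j)\<^sup>2 * (v \<bullet> e j)\<^sup>2)"
    by (simp add: power2_eq_square mult_ac)
  finally show ?thesis .
qed

lemma singular_frame_orthonormal: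
  "singular_frame (A :: real^'n^'n) e s \<Longrightarrow> orthonormal_family CARD('n) e"
  by (simp add: singular_frame_def)

lemma singular_frame_pos:
  "singular_frame (A :: real^'n^'n) e s \<Longrightarrow> i \<in> {1..CARD('n)} \<Longrightarrow> 0 < s i"
  by (simp add: singular_frame_def)

lemma singular_frame_antimono:
  "singular_frame (A :: real^'n^'n) e s \<Longrightarrow> 1 \<le> i \<Longrightarrow> i \<le> j \<Longrightarrow> j \<le> CARD('n) \<Longrightarrow> s j \<le> s i"
  by (auto simp: singular_frame_def)

lemma singular_frame_coordinate_le:
  fixes A :: "real^'n^'n"
  assumes "singular_frame A e s" "j \<in> {1..CARD('n)}"
  shows "s j * \<bar>v \<bullet> e j\<bar> \<le> norm (A *v v)"
proof (rule power2_le_imp_le)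
  have "(s j)\<^sup>2 * (v \<bullet> e j)\<^sup>2 \<le> (\<Sum>j\<in>{1..CARD('n)}. (s j)\<^sup>2 * (v \<bullet> e j)\<^sup>2)"
    using assms(2) by (intro member_le_sum) auto
  then show "(s j * \<bar>v \<bullet> e j\<bar>)\<^sup>2 \<le> (norm (A *v v))\<^sup>2"
    by (simp add: singular_frame_norm_mult[OF assms(1)] power_mult_distrib)
qed simp

text \<open>The frame is obtained greedily: \<open>e i\<close> maximizes \<open>norm (A *v v)\<close> among the unit vectors
  orthogonal to its predecessors.\<close>

lemma greedy_frame_exists:
  fixes A :: "real^'n^'n"
  assumes "k \<le> CARD('n)"
  shows "\<exists>e. orthonormal_family k e \<and>
    (\<forall>i\<in>{1..k}. \<forall>v. (\<forall>j\<in>{1..<i}. v \<bullet> e j = 0) \<longrightarrow> norm (A *v v) \<le> norm (A *v e i) * norm v)"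
  using assms
proof (induction k)
  case 0
  then show ?case by (simp add: orthonormal_family_def)
next
  case (Suc k)
  then obtain e where o: "orthonormal_family k e"
    and g: "\<And>i v. i \<in> {1..k} \<Longrightarrow> \<forall>j\<in>{1..<i}. v \<bullet> e j = 0 \<Longrightarrow> norm (A *v v) \<le> norm (A *v e i) * norm v"
    by auto
  define W where "W = {v. \<forall>j\<in>{1..k}. v \<bullet> e j = 0}"
  have "dim (span (e ` {1..k})) = k"
    using orthonormal_family_independent[OF o] by (simp add: dim_eq_card_independent)
  then have "dim (span (e ` {1..k})) < DIM(real^'n)"
    using Suc.prems by simp
  \<comment> \<open>Only a nonzero vector of \<open>W\<close> is wanted here, so that the unit
    sphere of \<open>W\<close> is not empty; it exists because k < d.\<close>
  then obtain u where u: "u \<noteq> 0" "\<And>y. y \<in> span (span (e ` {1..k})) \<Longrightarrow> orthogonal u y"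
    using orthogonal_to_subspace_exists[of "span (e ` {1..k})"] by (metis dim_span span_span)
  have uW: "u \<in> W"
    using u(2) by (auto simp: W_def orthogonal_def span_base)
  have sW: "subspace W"
    by (auto simp: W_def subspace_def inner_left_distrib)
  have "compact (W \<inter> sphere 0 1)"
    using closed_subspace[OF sW] by (simp add: closed_Int_compact)
  moreover have "(1 / norm u) *\<^sub>R u \<in> W \<inter> sphere 0 1"
    using u(1) uW sW by (simp add: subspace_scale)
  moreover have "continuous_on (W \<inter> sphere 0 1) (\<lambda>v. norm (A *v v))"
    by (intro continuous_intros)
  ultimately obtain w where w: "w \<in> W \<inter> sphere 0 1"
    and wmax: "\<And>v. v \<in> W \<inter> sphere 0 1 \<Longrightarrow> norm (A *v v) \<le> norm (A *v w)"
    using continuous_attains_sup[of "W \<inter> sphere 0 1" "\<lambda>v. norm (A *v v)"] by blast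
  have wW: "norm (A *v v) \<le> norm (A *v w) * norm v" if "v \<in> W" for v
  proof (cases "v = 0")
    case False
    have "norm (A *v ((1 / norm v) *\<^sub>R v)) \<le> norm (A *v w)"
      using that False sW by (intro wmax) (simp add: subspace_scale)
    then show ?thesis
      using False by (simp add: matrix_vector_mult_scaleR field_simps)
  qed simp
  define e' where "e' = e(Suc k := w)"
  have "orthonormal_family (Suc k) e'"
    using o w by (auto simp: orthonormal_family_def e'_def W_def le_Suc_eq inner_commute norm_eq_1)
  moreover have "norm (A *v v) \<le> norm (A *v e' i) * norm v"
    if "i \<in> {1..Suc k}" "\<forall>j\<in>{1..<i}. v \<bullet> e' j = 0" for i v
  proof (cases "i = Suc k")
    case True
    then have "v \<in> W"
      using that(2) by (auto simp: W_def e'_def)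
    then show ?thesis
      using wW True by (simp add: e'_def)
  next
    case False
    then show ?thesis
      using that g[of i v] by (auto simp: e'_def)
  qed
  ultimately show ?case
    by blast
qed

text \<open>A first variation argument: if the images of \<open>e i\<close> and \<open>e j\<close>
  were not orthogonal, tilting \<open>e i\<close> slightly towards \<open>e j\<close> would raise
  the stretching to first order, against the maximality of \<open>e i\<close>.\<close>

lemma singular_frame_exists:
  fixes A :: "real^'n^'n"
  assumes "invertible A"
  obtains e s where "singular_frame A e s"
proof -
  let ?d = "CARD('n)"
  obtain e where o: "orthonormal_family ?d e"
    and g: "\<And>i v. i \<in> {1..?d} \<Longrightarrow> \<forall>j\<in>{1..<i}. v \<bullet> e j = 0
      \<Longrightarrow> norm (A *v v) \<le> norm (A *v e i) * norm v"
    using greedy_frame_exists[of ?d A] by auto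
  define s where "s = (\<lambda>i. norm (A *v e i))"
  have orth: "(A *v e i) \<bullet> (A *v e j) = 0" if ij: "i \<in> {1..?d}" "j \<in> {1..?d}" "i < j" for i j
  proof (rule ccontr)
    define b where "b = (A *v e i) \<bullet> (A *v e j)"
    assume "(A *v e i) \<bullet> (A *v e j) \<noteq> 0"
    then have b: "b \<noteq> 0"
      by (simp add: b_def)
    have ne: "norm (e i) = 1" "norm (e j) = 1" "e i \<bullet> e j = 0"
      using orthonormal_family_norm[OF o] orthonormal_family_inner[OF o] ij by auto
    have le: "2 * t * b \<le> (s i)\<^sup>2 * t\<^sup>2" for t
    proof -
      have "norm (A *v (e i + t *\<^sub>R e j)) \<le> s i * norm (e i + t *\<^sub>R e j)"
        unfolding s_def using ij orthonormal_family_inner[OF o]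
        by (intro g) (auto simp: inner_left_distrib)
      then have "(norm (A *v (e i + t *\<^sub>R e j)))\<^sup>2 \<le> (s i)\<^sup>2 * (norm (e i + t *\<^sub>R e j))\<^sup>2"
        by (metis norm_ge_zero power_mono power_mult_distrib)
      moreover have "(norm (A *v (e i + t *\<^sub>R e j)))\<^sup>2 = (s i)\<^sup>2 + 2 * t * b + t\<^sup>2 * (s j)\<^sup>2"
        unfolding power2_norm_eq_inner s_def b_def
        by (simp add: matrix_vector_right_distrib matrix_vector_mult_scaleR inner_left_distrib
            inner_right_distrib inner_commute power2_eq_square algebra_simps)
      moreover have "(norm (e i + t *\<^sub>R e j))\<^sup>2 = 1 + t\<^sup>2"
        using ne unfolding power2_norm_eq_inner
        by (simp add: inner_left_distrib inner_right_distrib inner_commute power2_eq_square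
            norm_eq_1)
      moreover have "0 \<le> t\<^sup>2 * (s j)\<^sup>2"
        by simp
      ultimately have "(s i)\<^sup>2 + 2 * t * b + t\<^sup>2 * (s j)\<^sup>2 \<le> (s i)\<^sup>2 * (1 + t\<^sup>2)"
        by simp
      then show ?thesis
        using \<open>0 \<le> t\<^sup>2 * (s j)\<^sup>2\<close> unfolding distrib_left by linarith
    qed
    \<comment> \<open>This \<open>t\<close> makes t b equal to ((s i)^2 + 1) t^2, so
      \<open>le\<close> gives 2 t b \<le> t b although t b > 0. The summand 1 keeps the denominator
      positive.\<close>
    define t where "t = b / ((s i)\<^sup>2 + 1)"
    have den: "0 < (s i)\<^sup>2 + 1"
      by (simp add: add_nonneg_pos)
    have "t * b = b\<^sup>2 / ((s i)\<^sup>2 + 1)"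
      by (simp add: t_def power2_eq_square)
    then have tb: "0 < t * b"
      using b den by simp
    have "b = t * ((s i)\<^sup>2 + 1)"
      using den by (simp add: t_def)
    then have "t * b = (s i)\<^sup>2 * t\<^sup>2 + t\<^sup>2"
      by (simp add: power2_eq_square algebra_simps)
    then have "(s i)\<^sup>2 * t\<^sup>2 \<le> t * b"
      by simp
    then show False
      using le[of t] tb by (simp add: mult.assoc)
  qed
  have "singular_frame A e s"
    unfolding singular_frame_def
  proof (intro conjI ballI impI)
    show "orthonormal_family ?d e" by fact
    fix i assume i: "i \<in> {1..?d}"
    have "e i \<noteq> 0"
      using orthonormal_family_norm[OF o i] by auto
    then show "0 < s i"
      unfolding s_def using assms by (metis invertible_def matrix_vector_mul_assoc
          matrix_vector_mul_lid matrix_vector_mult_0_right zero_less_norm_iff)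
    fix j assume j: "j \<in> {1..?d}"
    show "(A *v e i) \<bullet> (A *v e j) = (if i = j then (s i)\<^sup>2 else 0)"
      using orth[OF i j] orth[OF j i] by (auto simp: s_def power2_norm_eq_inner inner_commute)
         (metis inner_commute linorder_neqE_nat)
    assume "i \<le> j"
    then have "norm (A *v e j) \<le> norm (A *v e i) * norm (e j)"
      using i j orthonormal_family_inner[OF o] by (intro g) auto
    then show "s j \<le> s i"
      using orthonormal_family_norm[OF o j] by (simp add: s_def)
  qed
  then show ?thesis
    by (rule that)
qed

section \<open>Norms of exterior powers\<close>

lemma finite_multi_index [simp]: "finite (multi_index k :: (nat \<Rightarrow> 'n::finite) set)"
  by (simp add: multi_index_def finite_PiE)

section \<open>Tensor powers and permutations of the slots\<close>

lemma multi_index_comp_permutes: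
  assumes "p permutes {..<k}" "s \<in> multi_index k"
  shows "s \<circ> p \<in> multi_index k"
  using assms unfolding multi_index_def
  by (auto simp: PiE_def extensional_def permutes_def)

lemma bij_betw_comp_permutes:
  assumes "p permutes {..<k}"
  shows "bij_betw (\<lambda>s. s \<circ> p) (multi_index k) (multi_index k)"
proof (rule bij_betwI[where g = "\<lambda>s. s \<circ> inv p"])
  show "(\<lambda>s. s \<circ> p) \<in> multi_index k \<rightarrow> multi_index k"
    using multi_index_comp_permutes[OF assms] by auto
  show "(\<lambda>s. s \<circ> inv p) \<in> multi_index k \<rightarrow> multi_index k"
    using multi_index_comp_permutes[OF permutes_inv[OF assms]] by auto
qed (simp_all add: comp_assoc permutes_inv_o[OF assms])

text \<open>A product over the slots of sums over \<open>'n\<close> expands into a sum over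
  intermediate multi-indices.\<close>

lemma tensor_power_mult:
  "tensor_power k (A ** B) w = tensor_power k A (tensor_power k B w)"
proof
  fix s
  have "(\<Prod>j<k. (A ** B) $ s j $ t j)
      = (\<Sum>u\<in>multi_index k. (\<Prod>j<k. A $ s j $ u j) * (\<Prod>j<k. B $ u j $ t j))" for t
    unfolding matrix_matrix_mult_def multi_index_def
    by (simp add: prod_sum_PiE[of "{..<k}" "\<lambda>_. UNIV"] flip: prod.distrib)
  then show "tensor_power k (A ** B) w s = tensor_power k A (tensor_power k B w) s"
    unfolding tensor_power_def
    by (simp add: sum_distrib_left sum_distrib_right mult.assoc) (rule sum.swap)
qed

lemma tensor_power_diagonal:
  assumes D: "\<And>i j. D $ i $ j = (if i = j then c i else 0)" and s: "s \<in> multi_index k"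
  shows "tensor_power k D w s = (\<Prod>j<k. c (s j)) * w s"
proof -
  have "(\<Prod>j<k. D $ s j $ t j) * w t = (if t = s then (\<Prod>j<k. c (s j)) * w s else 0)"
    if t: "t \<in> multi_index k" for t
  proof (cases "t = s")
    case False
    then obtain j where "j < k" "s j \<noteq> t j"
      using t s PiE_ext[of s "{..<k}" "\<lambda>_. UNIV" t]
      unfolding multi_index_def by auto
    then have "(\<Prod>j<k. D $ s j $ t j) = 0"
      by (intro prod_zero) (auto simp: D)
    with False show ?thesis by simp
  qed (simp add: D)
  then have "tensor_power k D w s
      = (\<Sum>t\<in>multi_index k. if t = s then (\<Prod>j<k. c (s j)) * w s else 0)"
    unfolding tensor_power_def by (intro sum.cong) auto
  then show ?thesis
    using s by simp
qed

lemma tensor_power_adjoint: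
  "(\<Sum>s\<in>multi_index k. tensor_power k A v s * w s)
     = (\<Sum>s\<in>multi_index k. v s * tensor_power k (transpose A) w s)"
proof -
  have "(\<Sum>s\<in>multi_index k. tensor_power k A v s * w s)
      = (\<Sum>s\<in>multi_index k. \<Sum>t\<in>multi_index k. (\<Prod>j<k. A $ s j $ t j) * v t * w s)"
    by (simp add: tensor_power_def sum_distrib_right)
  also have "\<dots> = (\<Sum>t\<in>multi_index k. \<Sum>s\<in>multi_index k. (\<Prod>j<k. A $ s j $ t j) * v t * w s)"
    by (rule sum.swap)
  also have "\<dots> = (\<Sum>s\<in>multi_index k. v s * tensor_power k (transpose A) w s)"
    by (simp add: tensor_power_def sum_distrib_left transpose_def mult_ac)
  finally show ?thesis .
qed

lemma tensor_norm_nonneg [simp]: "0 \<le> tensor_norm k w"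
  by (simp add: tensor_norm_def sum_nonneg)

lemma tensor_norm_orthogonal:
  assumes "transpose U ** U = mat 1"
  shows "tensor_norm k (tensor_power k U w) = tensor_norm k w"
proof -
  \<comment> \<open>The identity matrix reproduces \<open>w\<close> only at genuine multi-indices;
    the other values do not enter the norm.\<close>
  have "tensor_power k (transpose U) (tensor_power k U w) s = w s" if "s \<in> multi_index k" for s
    using that tensor_power_diagonal[of "mat 1" "\<lambda>_. 1" s k w] assms
    by (simp add: mat_def tensor_power_mult[symmetric])
  then have "(\<Sum>s\<in>multi_index k. tensor_power k U w s * tensor_power k U w s)
      = (\<Sum>s\<in>multi_index k. w s * w s)"
    unfolding tensor_power_adjoint by (intro sum.cong) auto
  then show ?thesis
    unfolding tensor_norm_def power2_eq_square by simp
qed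

text \<open>Permuting the slots commutes with the tensor power: the same matrix acts in every slot,
  so the permutation can be moved to the summation index.\<close>

lemma antisymmetric_tensor_power:
  assumes "antisymmetric_tensor k w"
  shows "antisymmetric_tensor k (tensor_power k A w)"
  unfolding antisymmetric_tensor_def
proof (intro allI impI)
  fix p and s :: "nat \<Rightarrow> 'a"
  assume p: "p permutes {..<k}" and s: "s \<in> multi_index k"
  have "tensor_power k A w (s \<circ> p)
      = (\<Sum>t\<in>multi_index k. (\<Prod>j<k. A $ s (p j) $ t (p j)) * w (t \<circ> p))"
    unfolding tensor_power_def
    using sum.reindex_bij_betw[OF bij_betw_comp_permutes[OF p],
        of "\<lambda>t. (\<Prod>j<k. A $ (s \<circ> p) j $ t j) * w t"]
    by simp
  also have "\<dots> = (\<Sum>t\<in>multi_index k. (\<Prod>j<k. A $ s j $ t j) * (of_int (sign p) * w t))"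
  proof (intro sum.cong refl)
    fix t :: "nat \<Rightarrow> 'a" assume t: "t \<in> multi_index k"
    have "(\<Prod>j<k. A $ s (p j) $ t (p j)) = (\<Prod>j<k. A $ s j $ t j)"
      using prod.permute[OF p, of "\<lambda>j. A $ s j $ t j"] by (simp add: o_def)
    then show "(\<Prod>j<k. A $ s (p j) $ t (p j)) * w (t \<circ> p)
        = (\<Prod>j<k. A $ s j $ t j) * (of_int (sign p) * w t)"
      using assms p t by (simp add: antisymmetric_tensor_def)
  qed
  also have "\<dots> = of_int (sign p) * tensor_power k A w s"
    by (simp add: tensor_power_def sum_distrib_left mult_ac)
  finally show "tensor_power k A w (s \<circ> p) = of_int (sign p) * tensor_power k A w s" .
qed

text \<open>Swapping two slots that carry equal indices fixes \<open>s\<close> but flips the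
  sign.\<close>

lemma antisymmetric_tensor_eq_0:
  assumes w: "antisymmetric_tensor k w" and s: "s \<in> multi_index k" and "\<not> inj_on s {..<k}"
  shows "w s = 0"
proof -
  obtain i j where ij: "i < k" "j < k" "i \<noteq> j" "s i = s j"
    using assms(3) by (auto simp: inj_on_def)
  define p where "p = Transposition.transpose i j"
  have p: "p permutes {..<k}"
    unfolding p_def using ij by (intro permutes_swap_id) auto
  have "s \<circ> p = s"
    using ij by (auto simp: p_def Transposition.transpose_def)
  then have "w s = of_int (sign p) * w s"
    using w p s unfolding antisymmetric_tensor_def by metis
  moreover have "sign p = -1"
    using ij by (simp add: p_def sign_swap_id)
  ultimately show ?thesis by simp
qed

text \<open>Up to a constant factor, the coordinates of the wedge product of the basis vectors with
  indices \<open>r 0\<close>, ..., \<open>r (k - 1)\<close>.\<close>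

definition elementary_alternating :: "nat \<Rightarrow> (nat \<Rightarrow> 'n) \<Rightarrow> (nat \<Rightarrow> 'n) \<Rightarrow> real" where
  "elementary_alternating k r s =
     (\<Sum>p | p permutes {..<k}. if s = r \<circ> p then of_int (sign p) else 0)"

text \<open>Right translation by \<open>q\<close> permutes the summation index and contributes the
  factor \<open>sign q\<close>.\<close>

lemma elementary_alternating_antisymmetric:
  "antisymmetric_tensor k (elementary_alternating k r)"
  unfolding antisymmetric_tensor_def
proof (intro allI impI)
  fix q and s :: "nat \<Rightarrow> 'a"
  assume q: "q permutes {..<k}"
  have fin: "permutation p" if "p permutes {..<k}" for p
    using that permutation_permutes by blast
  have "bij_betw (\<lambda>p. p \<circ> q) {p. p permutes {..<k}} {p. p permutes {..<k}}"
    by (rule bij_betwI[where g = "\<lambda>p. p \<circ> inv q"])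
       (auto simp: comp_assoc permutes_inv_o[OF q] permutes_compose permutes_inv q)
  then have "elementary_alternating k r (s \<circ> q)
      = (\<Sum>p | p permutes {..<k}. if s \<circ> q = r \<circ> (p \<circ> q) then of_int (sign (p \<circ> q)) else 0)"
    unfolding elementary_alternating_def by (rule sum.reindex_bij_betw[symmetric])
  also have "\<dots> = (\<Sum>p | p permutes {..<k}.
      if s = r \<circ> p then of_int (sign q) * of_int (sign p) else 0)"
  proof (intro sum.cong refl)
    fix p assume "p \<in> {p. p permutes {..<k}}"
    then have "sign (p \<circ> q) = sign p * sign q"
      using fin q by (simp add: sign_compose)
    moreover have "s \<circ> q = r \<circ> (p \<circ> q) \<longleftrightarrow> s = r \<circ> p"
    proof
      assume "s \<circ> q = r \<circ> (p \<circ> q)"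
      then have "(s \<circ> q) \<circ> inv q = (r \<circ> (p \<circ> q)) \<circ> inv q"
        by simp
      then show "s = r \<circ> p"
        by (simp add: comp_assoc permutes_inv_o[OF q])
    qed (simp add: comp_assoc)
    ultimately show "(if s \<circ> q = r \<circ> (p \<circ> q) then of_int (sign (p \<circ> q)) else 0)
        = (if s = r \<circ> p then of_int (sign q) * of_int (sign p) else (0::real))"
      by (simp add: mult.commute)
  qed
  also have "\<dots> = of_int (sign q) * elementary_alternating k r s"
    by (simp add: elementary_alternating_def sum_distrib_left if_distrib cong: if_cong)
  finally show "elementary_alternating k r (s \<circ> q)
      = of_int (sign q) * elementary_alternating k r s" .
qed

text \<open>Injectivity of \<open>r\<close> leaves only the identity permutation in the sum. This
  shows that the tensor is nonzero and can be normalized.\<close>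

lemma elementary_alternating_self:
  assumes "inj_on r {..<k}"
  shows "elementary_alternating k r r = 1"
proof -
  have "p = id" if p: "p permutes {..<k}" and e: "r = r \<circ> p" for p
  proof
    fix j
    show "p j = id j"
    proof (cases "j < k")
      case True
      have "p j < k"
        using permutes_in_image[OF p, of j] True by simp
      moreover have "r (p j) = r j"
        using e by (metis comp_apply)
      ultimately show ?thesis
        using assms True by (auto simp: inj_on_def)
    qed (use p in \<open>simp add: permutes_def\<close>)
  qed
  then have "elementary_alternating k r r
      = (\<Sum>p | p permutes {..<k}. if p = id then 1 else 0)"
    unfolding elementary_alternating_def by (intro sum.cong) (auto simp: sign_id)
  then show ?thesis
    by (simp add: finite_permutations permutes_id)
qed

lemma elementary_alternating_support:
  assumes "elementary_alternating k r s \<noteq> 0"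
  obtains p where "p permutes {..<k}" "s = r \<circ> p"
proof -
  have "\<exists>p. p permutes {..<k} \<and> s = r \<circ> p"
  proof (rule ccontr)
    assume "\<nexists>p. p permutes {..<k} \<and> s = r \<circ> p"
    then have "elementary_alternating k r s = 0"
      unfolding elementary_alternating_def by (intro sum.neutral) auto
    with assms show False by simp
  qed
  then show ?thesis
    using that by blast
qed

lemma tensor_norm_scale: "tensor_norm k (\<lambda>s. c * w s) = \<bar>c\<bar> * tensor_norm k w"
  by (simp add: tensor_norm_def power_mult_distrib real_sqrt_mult flip: sum_distrib_left)

lemma tensor_power_scale: "tensor_power k A (\<lambda>s. c * w s) = (\<lambda>s. c * tensor_power k A w s)"
  by (simp add: tensor_power_def sum_distrib_left mult_ac)

text \<open>The tensor powers of \<open>U\<close> and \<open>V\<close> are isometries that preserve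
  antisymmetry, so only \<open>D\<close> matters, and it multiplies the coordinate at
  \<open>s\<close> by a product of entries of \<open>c\<close>. Antisymmetric tensors vanish at
  non-injective multi-indices; hence the maximum is over injective ones.\<close>

lemma ext_power_norm_decomposition:
  fixes U D V :: "real^'n^'n"
  assumes U: "transpose U ** U = mat 1" and V: "transpose V ** V = mat 1"
    and D: "\<And>i j. D $ i $ j = (if i = j then c i else 0)"
    and r: "r \<in> multi_index k" "inj_on r {..<k}"
    and pos: "\<And>i. 0 \<le> c i"
    and max: "\<And>s. s \<in> multi_index k \<Longrightarrow> inj_on s {..<k} \<Longrightarrow> (\<Prod>j<k. c (s j)) \<le> (\<Prod>j<k. c (r j))"
  shows "ext_power_norm k (U ** D ** transpose V) = (\<Prod>j<k. c (r j))"
proof -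
  define P where "P = (\<Prod>j<k. c (r j))"
  have P: "0 \<le> P"
    by (simp add: P_def pos prod_nonneg)
  let ?A = "U ** D ** transpose V"
  have VV: "transpose (transpose V) ** transpose V = mat 1"
    using V by (simp add: matrix_left_right_inverse)
  have upper: "tensor_norm k (tensor_power k ?A w) \<le> P * tensor_norm k w"
    if w: "antisymmetric_tensor k w" for w
  proof -
    define y where "y = tensor_power k (transpose V) w"
    have y: "antisymmetric_tensor k y"
      by (simp add: y_def antisymmetric_tensor_power w)
    have ny: "tensor_norm k y = tensor_norm k w"
      unfolding y_def by (rule tensor_norm_orthogonal[OF VV])
    have "tensor_norm k (tensor_power k ?A w) = tensor_norm k (tensor_power k D y)"
      by (simp add: tensor_power_mult y_def tensor_norm_orthogonal[OF U])
    also have "\<dots> \<le> tensor_norm k (\<lambda>s. P * y s)"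
      unfolding tensor_norm_def
    proof (intro real_sqrt_le_mono sum_mono)
      fix s :: "nat \<Rightarrow> 'n" assume s: "s \<in> multi_index k"
      show "(tensor_power k D y s)\<^sup>2 \<le> (P * y s)\<^sup>2"
      proof (cases "inj_on s {..<k}")
        case True
        have "(\<Prod>j<k. c (s j))\<^sup>2 \<le> P\<^sup>2"
          using max[OF s True] by (intro power_mono) (auto simp: P_def pos prod_nonneg)
        then show ?thesis
          by (simp add: tensor_power_diagonal[OF D s] power_mult_distrib mult_right_mono)
      next
        case False
        then show ?thesis
          using antisymmetric_tensor_eq_0[OF y s] by (simp add: tensor_power_diagonal[OF D s])
      qed
    qed
    also have "\<dots> = P * tensor_norm k w"
      using P by (simp add: tensor_norm_scale ny)
    finally show ?thesis .
  qed
  \<comment> \<open>The supremum is attained at the image under \<open>V\<close> of this tensor: its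
    support consists of rearrangements of \<open>r\<close>, on all of which \<open>D\<close> acts by
    the same factor \<open>P\<close>.\<close>
  define y where "y = elementary_alternating k r"
  define w where "w = tensor_power k V y"
  have w: "antisymmetric_tensor k w"
    by (simp add: w_def y_def antisymmetric_tensor_power elementary_alternating_antisymmetric)
  have nw: "tensor_norm k w = tensor_norm k y"
    by (simp add: w_def tensor_norm_orthogonal[OF V])
  have "0 < tensor_norm k y"
  proof -
    have "(y r)\<^sup>2 \<le> (\<Sum>s\<in>multi_index k. (y s)\<^sup>2)"
      using r(1) by (intro member_le_sum) auto
    then show ?thesis
      using elementary_alternating_self[OF r(2)] by (simp add: tensor_norm_def y_def)
  qed
  have "tensor_norm k (tensor_power k ?A w) = tensor_norm k (tensor_power k (D ** (transpose V ** V)) y)"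
    by (simp add: w_def tensor_norm_orthogonal[OF U] tensor_power_mult)
  also have "\<dots> = tensor_norm k (\<lambda>s. P * y s)"
    unfolding tensor_norm_def
  proof (intro arg_cong[where f = sqrt] sum.cong refl arg_cong[where f = "\<lambda>x. x\<^sup>2"])
    fix s :: "nat \<Rightarrow> 'n" assume s: "s \<in> multi_index k"
    have "(\<Prod>j<k. c (s j)) = P" if ne: "y s \<noteq> 0"
    proof -
      obtain p where p: "p permutes {..<k}" "s = r \<circ> p"
        using ne elementary_alternating_support unfolding y_def by metis
      then show ?thesis
        using prod.permute[OF p(1), of "\<lambda>j. c (r j)"] by (simp add: P_def o_def)
    qed
    then show "tensor_power k (D ** (transpose V ** V)) y s = P * y s"
      using tensor_power_diagonal[OF D s] V by auto
  qed
  also have "\<dots> = P * tensor_norm k y"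
    using P by (simp add: tensor_norm_scale)
  finally have attained: "tensor_norm k (tensor_power k ?A w) = P * tensor_norm k y" .
  have "ext_power_norm k ?A = P"
    unfolding ext_power_norm_def
  proof (rule cSup_eq_maximum)
    define z where "z = (\<lambda>s. (1 / tensor_norm k y) * w s)"
    have "antisymmetric_tensor k z"
      using w by (simp add: z_def antisymmetric_tensor_def)
    moreover have "tensor_norm k z = 1"
      using \<open>0 < tensor_norm k y\<close> unfolding z_def tensor_norm_scale nw by simp
    moreover have "tensor_norm k (tensor_power k ?A z) = P"
      using \<open>0 < tensor_norm k y\<close>
      unfolding z_def tensor_power_scale tensor_norm_scale attained by simp
    ultimately show "P \<in> {tensor_norm k (tensor_power k ?A w) |w.
        antisymmetric_tensor k w \<and> tensor_norm k w \<le> 1}"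
      by force
    fix x assume "x \<in> {tensor_norm k (tensor_power k ?A w) |w.
        antisymmetric_tensor k w \<and> tensor_norm k w \<le> 1}"
    then obtain w where "x = tensor_norm k (tensor_power k ?A w)" "antisymmetric_tensor k w"
      "tensor_norm k w \<le> 1"
      by auto
    then have "x \<le> P * tensor_norm k w" "P * tensor_norm k w \<le> P * 1"
      using upper P mult_left_mono[of "tensor_norm k w" 1 P] by auto
    then show "x \<le> P" by simp
  qed
  then show ?thesis
    by (simp add: P_def)
qed

text \<open>By removing the largest element of \<open>S\<close>: it is at least
  \<open>card S\<close>, so its factor is at most \<open>s (card S)\<close>.\<close>

lemma prod_le_prod_initial:
  fixes s :: "nat \<Rightarrow> real"
  assumes "finite S" "S \<subseteq> {1..d}"
    and "\<And>i. i \<in> {1..d} \<Longrightarrow> 0 \<le> s i"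
    and "\<And>i j. 1 \<le> i \<Longrightarrow> i \<le> j \<Longrightarrow> j \<le> d \<Longrightarrow> s j \<le> s i"
  shows "(\<Prod>i\<in>S. s i) \<le> (\<Prod>i\<in>{1..card S}. s i)"
  using assms(1,2)
proof (induction "card S" arbitrary: S)
  case 0
  then show ?case by simp
next
  case (Suc k)
  define m where "m = Max S"
  have ne: "S \<noteq> {}" using Suc.hyps(2) by auto
  have m: "m \<in> S" "S \<subseteq> {1..m}"
    using Suc.prems ne by (auto simp: m_def)
  have km: "card S \<le> m"
    using card_mono[OF _ m(2)] by simp
  have "(\<Prod>i\<in>S. s i) = s m * (\<Prod>i\<in>S - {m}. s i)"
    using Suc.prems m(1) by (simp add: prod.remove)
  also have "\<dots> \<le> s (card S) * (\<Prod>i\<in>{1..k}. s i)"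
  proof (intro mult_mono)
    show "s m \<le> s (card S)"
      using km Suc.hyps(2) m(1) Suc.prems by (intro assms(4)) auto
    have "card (S - {m}) = k"
      using m(1) Suc.hyps(2) Suc.prems by simp
    then show "(\<Prod>i\<in>S - {m}. s i) \<le> (\<Prod>i\<in>{1..k}. s i)"
      using Suc.hyps(1)[of "S - {m}"] Suc.prems by auto
    show "0 \<le> s (card S)"
      using km Suc.hyps(2) m(1) Suc.prems by (intro assms(3)) auto
    show "0 \<le> (\<Prod>i\<in>S - {m}. s i)"
      using Suc.prems assms(3) by (intro prod_nonneg) auto
  qed
  also have "\<dots> = (\<Prod>i\<in>{1..card S}. s i)"
    using Suc.hyps(2)[symmetric] by (simp add: mult.commute)
  finally show ?case .
qed

text \<open>This turns the bounds on exterior norms into bounds on singular values. Among products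
  of \<open>k\<close> singular values with distinct indices, the one with indices 1, ..., k is the
  largest.\<close>

theorem ext_power_norm_singular_values:
  fixes A :: "real^'n^'n"
  assumes A: "singular_frame A e s" and k: "k \<le> CARD('n)"
  shows "ext_power_norm k A = (\<Prod>i\<in>{1..k}. s i)"
proof -
  let ?d = "CARD('n)"
  \<comment> \<open>The frame is numbered by 1, ..., d, but rows and columns of matrices are indexed
    by \<open>'n\<close>; \<open>b\<close> translates.\<close>
  obtain b :: "'n \<Rightarrow> nat" where b: "bij_betw b UNIV {1..?d}"
    using finite_same_card_bij[of "UNIV :: 'n set" "{1..?d}"] by auto
  have bI: "b i \<in> {1..?d}" for i
    using bij_betwE[OF b] by simp
  have binj: "b i = b j \<longleftrightarrow> i = j" for i j
    using bij_betw_imp_inj_on[OF b] by (auto simp: inj_on_def)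
  note o = singular_frame_orthonormal[OF A]
  \<comment> \<open>The columns of \<open>V\<close> are the right singular vectors, those of
    \<open>U\<close> the normalized images, that is, the left singular vectors.\<close>
  define V :: "real^'n^'n" where "V = (\<chi> i k. e (b k) $ i)"
  define U :: "real^'n^'n" where "U = (\<chi> i k. (A *v e (b k)) $ i / s (b k))"
  define D :: "real^'n^'n" where "D = (\<chi> i j. if i = j then s (b i) else 0)"
  have spos: "0 < s (b i)" for i
    using A bI by (intro singular_frame_pos)
  have V: "transpose V ** V = mat 1"
  proof -
    have "(\<Sum>l\<in>UNIV. e (b i) $ l * e (b j) $ l) = (if i = j then 1 else 0)" for i j
      using orthonormal_family_inner[OF o bI[of i] bI[of j]] by (simp add: inner_vec_def binj)
    then show ?thesis
      by (simp add: matrix_matrix_mult_def transpose_def V_def mat_def vec_eq_iff)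
  qed
  have U: "transpose U ** U = mat 1"
  proof -
    have "(\<Sum>l\<in>UNIV. (A *v e (b i)) $ l / s (b i) * ((A *v e (b j)) $ l / s (b j)))
        = (if i = j then 1 else 0)" for i j
    proof -
      have "(\<Sum>l\<in>UNIV. (A *v e (b i)) $ l / s (b i) * ((A *v e (b j)) $ l / s (b j)))
          = (A *v e (b i)) \<bullet> (A *v e (b j)) / (s (b i) * s (b j))"
        by (simp add: inner_vec_def sum_divide_distrib)
      also have "(A *v e (b i)) \<bullet> (A *v e (b j)) = (if i = j then (s (b i))\<^sup>2 else 0)"
        using A bI[of i] bI[of j] by (simp add: singular_frame_def binj)
      finally show ?thesis
        using spos[of i] by (cases "i = j") (simp_all add: power2_eq_square)
    qed
    then show ?thesis
      by (simp add: matrix_matrix_mult_def transpose_def U_def mat_def vec_eq_iff)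
  qed
  have "(A ** V) $ i $ j = (U ** D) $ i $ j" for i j
  proof -
    have "(U ** D) $ i $ j = (\<Sum>l\<in>UNIV. if l = j then (A *v e (b j)) $ i else 0)"
      unfolding matrix_matrix_mult_def vec_lambda_beta using spos[of j]
      by (intro sum.cong) (auto simp: U_def D_def)
    also have "\<dots> = (A *v e (b j)) $ i"
      by simp
    also have "\<dots> = (A ** V) $ i $ j"
      by (simp add: matrix_matrix_mult_def matrix_vector_mult_def V_def)
    finally show ?thesis ..
  qed
  then have "A ** V = U ** D"
    by (simp add: vec_eq_iff)
  moreover have "V ** transpose V = mat 1"
    using V by (simp add: matrix_left_right_inverse)
  ultimately have dec: "A = U ** D ** transpose V"
    by (metis matrix_mul_assoc matrix_mul_rid)
  \<comment> \<open>The coordinates that carry the \<open>k\<close> largest singular values; slots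
    start at 0 and the frame at 1, whence \<open>Suc j\<close>.\<close>
  define r where "r = (\<lambda>j\<in>{..<k}. inv b (Suc j))"
  have br: "b (r j) = Suc j" if "j < k" for j
    using that k bij_betw_inv_into_right[OF b, of "Suc j"] by (simp add: r_def)
  have prod_r: "(\<Prod>j<k. s (b (r j))) = (\<Prod>i\<in>{1..k}. s i)"
    using br by (simp add: prod.atLeast1_atMost_eq)
  have "ext_power_norm k (U ** D ** transpose V) = (\<Prod>j<k. s (b (r j)))"
  proof (rule ext_power_norm_decomposition[OF U V])
    show "D $ i $ j = (if i = j then s (b i) else 0)" for i j
      by (simp add: D_def)
    show "r \<in> multi_index k"
      by (simp add: r_def multi_index_def)
    show "inj_on r {..<k}"
      using br by (intro inj_onI) (metis lessThan_iff nat.inject)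
    show "0 \<le> s (b i)" for i
      using spos[of i] by simp
    fix t :: "nat \<Rightarrow> 'n" assume t: "t \<in> multi_index k" "inj_on t {..<k}"
    have inj: "inj_on (b \<circ> t) {..<k}"
      using t(2) by (auto simp: inj_on_def binj)
    have "(\<Prod>j<k. s (b (t j))) = (\<Prod>i\<in>(b \<circ> t) ` {..<k}. s i)"
      unfolding prod.reindex[OF inj] by simp
    also have "\<dots> \<le> (\<Prod>i\<in>{1..card ((b \<circ> t) ` {..<k})}. s i)"
      using bI singular_frame_antimono[OF A] less_imp_le[OF singular_frame_pos[OF A]]
      by (intro prod_le_prod_initial[where d = ?d]) auto
    also have "card ((b \<circ> t) ` {..<k}) = k"
      using card_image[OF inj] by simp
    finally show "(\<Prod>j<k. s (b (t j))) \<le> (\<Prod>j<k. s (b (r j)))"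
      by (simp add: prod_r)
  qed
  then show ?thesis
    by (simp add: dec[symmetric] prod_r)
qed

section \<open>Contracted subspaces\<close>

lemma orthonormal_family_eqI:
  fixes v w :: "real^'n"
  assumes "orthonormal_family CARD('n) e" "\<And>j. j \<in> {1..CARD('n)} \<Longrightarrow> v \<bullet> e j = w \<bullet> e j"
  shows "v = w"
  using orthonormal_family_expand[OF assms(1), of v] orthonormal_family_expand[OF assms(1), of w]
    assms(2) by simp

lemma orthonormal_family_matrix_eqI:
  fixes A B :: "real^'n^'n"
  assumes "orthonormal_family CARD('n) e" "\<And>j. j \<in> {1..CARD('n)} \<Longrightarrow> A *v e j = B *v e j"
  shows "A = B"
proof -
  have "A *v v = B *v v" for v
  proof -
    have "A *v v = (\<Sum>j\<in>{1..CARD('n)}. (v \<bullet> e j) *\<^sub>R (A *v e j))"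
      using orthonormal_family_expand[OF assms(1), of v] matrix_vector_mult_sum by metis
    also have "\<dots> = (\<Sum>j\<in>{1..CARD('n)}. (v \<bullet> e j) *\<^sub>R (B *v e j))"
      using assms(2) by simp
    also have "\<dots> = B *v v"
      using orthonormal_family_expand[OF assms(1), of v] matrix_vector_mult_sum by metis
    finally show ?thesis .
  qed
  then show ?thesis
    by (simp add: matrix_eq)
qed

lemma inner_transpose_matrix:
  fixes A :: "real^'n^'m"
  shows "x \<bullet> (transpose A *v y) = (A *v x) \<bullet> y"
  by (metis dot_lmul_matrix inner_commute transpose_matrix_vector)

lemma singular_frame_gram:
  fixes A :: "real^'n^'n"
  assumes A: "singular_frame A e s" and j: "j \<in> {1..CARD('n)}"
  shows "(transpose A ** A) *v e j = (s j)\<^sup>2 *\<^sub>R e j"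
proof (rule orthonormal_family_eqI[OF singular_frame_orthonormal[OF A]])
  fix i assume i: "i \<in> {1..CARD('n)}"
  have "((transpose A ** A) *v e j) \<bullet> e i = (A *v e j) \<bullet> (A *v e i)"
    by (metis inner_commute inner_transpose_matrix matrix_vector_mul_assoc)
  also have "\<dots> = (if j = i then (s j)\<^sup>2 else 0)"
    using A i j by (simp add: singular_frame_def)
  also have "\<dots> = ((s j)\<^sup>2 *\<^sub>R e j) \<bullet> e i"
    using orthonormal_family_inner[OF singular_frame_orthonormal[OF A] j i] by simp
  finally show "((transpose A ** A) *v e j) \<bullet> e i = ((s j)\<^sup>2 *\<^sub>R e j) \<bullet> e i" .
qed

text \<open>If \<open>S\<close> is a positive semidefinite square root of the Gram matrix, then
  \<open>(S + s j) (S - s j)\<close> annihilates \<open>e j\<close>, and \<open>S + s j\<close> is injective as \<open>s j > 0\<close>. Hence \<open>S\<close> is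
  determined on the frame.\<close>

lemma mat_sqrt_singular_frame:
  fixes A :: "real^'n^'n"
  assumes A: "singular_frame A e s" and j: "j \<in> {1..CARD('n)}"
  shows "mat_sqrt (transpose A ** A) *v e j = s j *\<^sub>R e j"
proof -
  let ?d = "CARD('n)" and ?G = "transpose A ** A"
  note o = singular_frame_orthonormal[OF A]
  have root: "S *v e i = s i *\<^sub>R e i" if S: "pos_semidef S" "S ** S = ?G" and i: "i \<in> {1..?d}" for S i
  proof -
    define u where "u = S *v e i - s i *\<^sub>R e i"
    have "S *v (S *v e i) = (s i)\<^sup>2 *\<^sub>R e i"
      using S(2) singular_frame_gram[OF A i] by (simp add: matrix_vector_mul_assoc)
    then have Su: "S *v u = - s i *\<^sub>R u"
      by (simp add: u_def matrix_vector_mult_diff_distrib matrix_vector_mult_scaleR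
          power2_eq_square algebra_simps)
    have "0 \<le> u \<bullet> (S *v u)"
      using S(1) by (simp add: pos_semidef_def)
    then have "s i * (u \<bullet> u) \<le> 0"
      by (simp add: Su)
    then have "u \<bullet> u \<le> 0"
      using singular_frame_pos[OF A i] by (simp add: mult_le_0_iff)
    then have "u = 0"
      by (metis inner_eq_zero_iff inner_ge_zero order_antisym)
    then show ?thesis
      by (simp add: u_def)
  qed
  \<comment> \<open>\<open>root\<close> gives uniqueness only. The operator that is diagonal in the
    frame supplies the existence that the definite description in \<open>mat_sqrt\<close>
    requires.\<close>
  define f where "f = (\<lambda>v. \<Sum>i\<in>{1..?d}. (s i * (v \<bullet> e i)) *\<^sub>R e i)"
  have "linear f"
    by (auto simp: f_def linear_iff inner_left_distrib algebra_simps sum.distrib scaleR_sum_right)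
  define S where "S = matrix f"
  have Sv: "S *v v = f v" for v
    using \<open>linear f\<close> by (simp add: S_def matrix_works)
  have fe: "f (e i) = s i *\<^sub>R e i" if i: "i \<in> {1..?d}" for i
  proof -
    have "f (e i) = (\<Sum>k\<in>{1..?d}. if k = i then s i *\<^sub>R e i else 0)"
      unfolding f_def using orthonormal_family_inner[OF o i] by (intro sum.cong) auto
    then show ?thesis
      using i by simp
  qed
  have fsym: "f v \<bullet> w = v \<bullet> f w" for v w
    by (simp add: f_def inner_sum_left inner_sum_right inner_commute mult_ac)
  have "transpose S *v v = S *v v" for v
  proof (rule vector_eq_ldot[THEN iffD1], rule allI)
    fix w show "w \<bullet> (transpose S *v v) = w \<bullet> (S *v v)"
      using fsym[of w v] inner_transpose_matrix[of w S v] by (simp only: Sv)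
  qed
  then have "transpose S = S"
    by (simp add: matrix_eq)
  moreover have "0 \<le> v \<bullet> (S *v v)" for v
  proof -
    have "v \<bullet> (S *v v) = (\<Sum>i\<in>{1..?d}. s i * (v \<bullet> e i)\<^sup>2)"
      by (simp add: Sv f_def inner_sum_right power2_eq_square mult.assoc)
    also have "0 \<le> \<dots>"
    proof (rule sum_nonneg)
      fix i assume "i \<in> {1..?d}"
      then show "0 \<le> s i * (v \<bullet> e i)\<^sup>2"
        using singular_frame_pos[OF A, of i] by simp
    qed
    finally show ?thesis .
  qed
  ultimately have "pos_semidef S"
    by (simp add: pos_semidef_def)
  moreover have "S ** S = ?G"
  proof (rule orthonormal_family_matrix_eqI[OF o])
    fix i assume i: "i \<in> {1..?d}"
    have "(S ** S) *v e i = S *v (S *v e i)"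
      by (simp add: matrix_vector_mul_assoc)
    also have "\<dots> = (s i)\<^sup>2 *\<^sub>R e i"
      using fe[OF i] by (simp add: Sv[of "e i"] matrix_vector_mult_scaleR power2_eq_square)
    finally show "(S ** S) *v e i = ?G *v e i"
      by (simp add: singular_frame_gram[OF A i])
  qed
  moreover have "S' = S" if "pos_semidef S' \<and> S' ** S' = ?G" for S'
  proof (rule orthonormal_family_matrix_eqI[OF o])
    fix i assume i: "i \<in> {1..?d}"
    show "S' *v e i = S *v e i"
      using root[OF conjunct1[OF that] conjunct2[OF that] i] Sv[of "e i"] fe[OF i] by metis
  qed
  ultimately have "mat_sqrt ?G = S"
    unfolding mat_sqrt_def by (intro the_equality) blast+
  then show ?thesis
    using fe[OF j] Sv by simp
qed

text \<open>For an orthonormal basis this is the span of \<open>e p\<close>, ...,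
  \<open>e d\<close>, encoded by equations so that the vanishing of coordinates is immediate. The
  values p = 1 and p = d + 1 give the whole space and \<open>{0}\<close>.\<close>

definition tail_space :: "(nat \<Rightarrow> 'a::real_inner) \<Rightarrow> nat \<Rightarrow> 'a set" where
  "tail_space e p = {v. \<forall>j\<in>{1..<p}. v \<bullet> e j = 0}"

lemma subspace_tail_space: "subspace (tail_space e p)"
  by (auto simp: tail_space_def subspace_def inner_left_distrib)

lemma tail_space_antimono: "p \<le> q \<Longrightarrow> tail_space e q \<subseteq> tail_space e p"
  by (auto simp: tail_space_def)

lemma tail_space_eq_span:
  assumes o: "orthonormal_family CARD('n) (e :: nat \<Rightarrow> real^'n)" and p: "1 \<le> p"
  shows "tail_space e p = span (e ` {p..CARD('n)})"
proof
  show "span (e ` {p..CARD('n)}) \<subseteq> tail_space e p"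
    using p orthonormal_family_inner[OF o]
    by (intro span_minimal subspace_tail_space) (auto simp: tail_space_def)
  show "tail_space e p \<subseteq> span (e ` {p..CARD('n)})"
  proof
    fix v assume v: "v \<in> tail_space e p"
    have "v = (\<Sum>j\<in>{1..CARD('n)}. (v \<bullet> e j) *\<^sub>R e j)"
      by (rule orthonormal_family_expand[OF o])
    also have "\<dots> = (\<Sum>j\<in>{p..CARD('n)}. (v \<bullet> e j) *\<^sub>R e j)"
      using v p by (intro sum.mono_neutral_right) (auto simp: tail_space_def)
    also have "\<dots> \<in> span (e ` {p..CARD('n)})"
      by (intro span_sum span_scale span_base) auto
    finally show "v \<in> span (e ` {p..CARD('n)})" .
  qed
qed

lemma dim_tail_space:
  assumes o: "orthonormal_family CARD('n) (e :: nat \<Rightarrow> real^'n)" and p: "1 \<le> p"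
  shows "dim (tail_space e p) = Suc CARD('n) - p"
proof -
  have sub: "{p..CARD('n)} \<subseteq> {1..CARD('n)}"
    using p by auto
  have "independent (e ` {p..CARD('n)})"
    using orthonormal_family_independent(2)[OF o] sub by (meson image_mono independent_mono)
  moreover have "card (e ` {p..CARD('n)}) = Suc CARD('n) - p"
    using card_image[OF inj_on_subset[OF orthonormal_family_inj[OF o] sub]] by simp
  ultimately show ?thesis
    by (simp add: tail_space_eq_span[OF o p] dim_eq_card_independent)
qed

text \<open>In the basis \<open>e\<close>, applying \<open>S\<close> multiplies the coordinate of
  index \<open>i\<close> by \<open>s i\<close>; the eigenvalue equation is then read off coordinate
  by coordinate.\<close>

lemma eigenspace_orthonormal:
  fixes S :: "real^'n^'n"
  assumes o: "orthonormal_family CARD('n) e"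
    and S: "\<And>j. j \<in> {1..CARD('n)} \<Longrightarrow> S *v e j = s j *\<^sub>R e j"
  shows "eigenspace S t = {v. \<forall>j\<in>{1..CARD('n)}. s j \<noteq> t \<longrightarrow> v \<bullet> e j = 0}"
proof -
  have coord: "(S *v v) \<bullet> e i = s i * (v \<bullet> e i)" if i: "i \<in> {1..CARD('n)}" for v i
  proof -
    have "S *v v = (\<Sum>j\<in>{1..CARD('n)}. (v \<bullet> e j) *\<^sub>R (S *v e j))"
      using orthonormal_family_expand[OF o, of v] matrix_vector_mult_sum by metis
    then have "(S *v v) \<bullet> e i = (\<Sum>j\<in>{1..CARD('n)}. (v \<bullet> e j) * (s j * (e j \<bullet> e i)))"
      using S by (simp add: inner_sum_left mult.assoc)
    also have "\<dots> = (\<Sum>j\<in>{1..CARD('n)}. if j = i then s i * (v \<bullet> e i) else 0)"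
    proof (intro sum.cong refl)
      fix j assume j: "j \<in> {1..CARD('n)}"
      show "v \<bullet> e j * (s j * (e j \<bullet> e i)) = (if j = i then s i * (v \<bullet> e i) else 0)"
        using orthonormal_family_inner[OF o j i] by auto
    qed
    finally show ?thesis
      using i by simp
  qed
  have "S *v v = t *\<^sub>R v \<longleftrightarrow> (\<forall>j\<in>{1..CARD('n)}. s j \<noteq> t \<longrightarrow> v \<bullet> e j = 0)" for v
  proof
    assume *: "S *v v = t *\<^sub>R v"
    show "\<forall>j\<in>{1..CARD('n)}. s j \<noteq> t \<longrightarrow> v \<bullet> e j = 0"
    proof (intro ballI impI)
      fix j assume "j \<in> {1..CARD('n)}" "s j \<noteq> t"
      then show "v \<bullet> e j = 0"
        using coord[of j v] unfolding * by simp
    qed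
  next
    assume *: "\<forall>j\<in>{1..CARD('n)}. s j \<noteq> t \<longrightarrow> v \<bullet> e j = 0"
    show "S *v v = t *\<^sub>R v"
    proof (rule orthonormal_family_eqI[OF o])
      fix j assume j: "j \<in> {1..CARD('n)}"
      show "(S *v v) \<bullet> e j = (t *\<^sub>R v) \<bullet> e j"
        using * j coord[OF j, of v] by (cases "s j = t") auto
    qed
  qed
  then show ?thesis
    by (simp add: eigenspace_def)
qed

lemma dim_eigenspace_orthonormal:
  fixes S :: "real^'n^'n"
  assumes o: "orthonormal_family CARD('n) e"
    and S: "\<And>j. j \<in> {1..CARD('n)} \<Longrightarrow> S *v e j = s j *\<^sub>R e j"
  shows "dim (eigenspace S t) = card {j\<in>{1..CARD('n)}. s j = t}"
proof -
  let ?K = "{j\<in>{1..CARD('n)}. s j = t}"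
  have eigenspace_S: "eigenspace S t = {v. \<forall>j\<in>{1..CARD('n)}. s j \<noteq> t \<longrightarrow> v \<bullet> e j = 0}"
    by (rule eigenspace_orthonormal[OF o S])
  have "eigenspace S t = span (e ` ?K)"
  proof
    show "span (e ` ?K) \<subseteq> eigenspace S t"
    proof (rule span_minimal)
      show "e ` ?K \<subseteq> eigenspace S t"
        using S by (auto simp: eigenspace_def)
      show "subspace (eigenspace S t)"
        by (auto simp: eigenspace_def subspace_def matrix_vector_right_distrib
            matrix_vector_mult_scaleR scaleR_right_distrib)
    qed
    show "eigenspace S t \<subseteq> span (e ` ?K)"
    proof
      fix v assume v: "v \<in> eigenspace S t"
      have "v = (\<Sum>j\<in>{1..CARD('n)}. (v \<bullet> e j) *\<^sub>R e j)"
        by (rule orthonormal_family_expand[OF o])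
      also have "\<dots> = (\<Sum>j\<in>?K. (v \<bullet> e j) *\<^sub>R e j)"
        using v unfolding eigenspace_S
        by (intro sum.mono_neutral_right) auto
      also have "\<dots> \<in> span (e ` ?K)"
        by (intro span_sum span_scale span_base) auto
      finally show "v \<in> span (e ` ?K)" .
    qed
  qed
  moreover have sub: "?K \<subseteq> {1..CARD('n)}"
    by auto
  moreover have "independent (e ` ?K)"
    using orthonormal_family_independent(2)[OF o] sub by (meson image_mono independent_mono)
  moreover have "card (e ` ?K) = card ?K"
    using card_image[OF inj_on_subset[OF orthonormal_family_inj[OF o] sub]] .
  ultimately show ?thesis
    by (simp add: dim_eq_card_independent)
qed

text \<open>The multiplicity of \<open>t\<close> is the number of \<open>j\<close> with
  \<open>s j = t\<close>, so both sides have the same multiset. The list is reversed because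
  \<open>s\<close> decreases while \<open>sorted_eigenvalues\<close> increases.\<close>

lemma sorted_eigenvalues_orthonormal:
  fixes S :: "real^'n^'n"
  assumes o: "orthonormal_family CARD('n) e"
    and S: "\<And>j. j \<in> {1..CARD('n)} \<Longrightarrow> S *v e j = s j *\<^sub>R e j"
    and mono: "\<And>i j. 1 \<le> i \<Longrightarrow> i \<le> j \<Longrightarrow> j \<le> CARD('n) \<Longrightarrow> s j \<le> s i"
  shows "sorted_eigenvalues S = map s (rev [1..<Suc CARD('n)])"
proof -
  let ?J = "{1..CARD('n)}"
  have dim_eigenspace: "dim (eigenspace S t) = card {j\<in>?J. s j = t}" for t
    by (rule dim_eigenspace_orthonormal[OF o S])
  have "eigenspace S t \<noteq> {0} \<longleftrightarrow> t \<in> s ` ?J" for t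
  proof -
    have "0 \<in> eigenspace S t"
      by (simp add: eigenspace_def)
    then have "eigenspace S t \<noteq> {0} \<longleftrightarrow> dim (eigenspace S t) \<noteq> 0"
      unfolding dim_eq_0 by blast
    also have "\<dots> \<longleftrightarrow> t \<in> s ` ?J"
      unfolding dim_eigenspace by (auto simp: card_eq_0_iff)
    finally show ?thesis .
  qed
  then have ev: "{t. eigenspace S t \<noteq> {0}} = s ` ?J"
    by blast
  have "(\<Sum>t\<in>{t. eigenspace S t \<noteq> {0}}. replicate_mset (dim (eigenspace S t)) t)
      = image_mset s (mset_set ?J)"
  proof (rule multiset_eqI)
    fix x
    have "count (\<Sum>t\<in>s ` ?J. replicate_mset (dim (eigenspace S t)) t) x
        = (\<Sum>t\<in>s ` ?J. if t = x then card {j\<in>?J. s j = x} else 0)"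
      unfolding count_sum dim_eigenspace by (intro sum.cong) auto
    also have "\<dots> = card {j\<in>?J. s j = x}"
    proof (cases "x \<in> s ` ?J")
      case False
      then have "{j\<in>?J. s j = x} = {}" by auto
      then have "card {j\<in>?J. s j = x} = 0" by simp
      then show ?thesis by simp
    qed simp
    also have "\<dots> = count (image_mset s (mset_set ?J)) x"
    proof -
      have "s -` {x} \<inter> ?J = {j\<in>?J. s j = x}" by auto
      then show ?thesis by (simp add: count_image_mset)
    qed
    finally show "count (\<Sum>t\<in>{t. eigenspace S t \<noteq> {0}}. replicate_mset (dim (eigenspace S t)) t) x
        = count (image_mset s (mset_set ?J)) x"
      by (simp add: ev)
  qed
  also have "\<dots> = mset (map s (rev [1..<Suc CARD('n)]))"
    by (simp add: atLeastLessThanSuc_atLeastAtMost del: upt_Suc)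
  finally have "sorted_eigenvalues S = sort (map s (rev [1..<Suc CARD('n)]))"
    by (simp only: sorted_eigenvalues_def sorted_list_of_multiset_mset)
  moreover have "sorted (map s (rev [1..<Suc CARD('n)]))"
    by (auto simp: sorted_iff_nth_mono rev_nth intro!: mono simp del: upt_Suc)
  ultimately show ?thesis
    by (simp add: sorted_sort_id del: upt_Suc)
qed

lemma sorted_singular_values_nth:
  fixes A :: "real^'n^'n"
  assumes "singular_frame A e s" "j < CARD('n)"
  shows "sorted_eigenvalues (mat_sqrt (transpose A ** A)) ! j = s (CARD('n) - j)"
  using sorted_eigenvalues_orthonormal[OF singular_frame_orthonormal[OF assms(1)]
      mat_sqrt_singular_frame[OF assms(1)] singular_frame_antimono[OF assms(1)]] assms(2)
  by (simp add: rev_nth Suc_diff_Suc del: upt_Suc)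

text \<open>Dimension d + 1 - p separates positions \<open>p - 1\<close> and \<open>p\<close> in the
  decreasing order. For p = 1 and p = d + 1 the dimension is d or 0, where the requirement is
  void.\<close>

lemma contracted_well_defined_gap:
  fixes A :: "real^'n^'n"
  assumes A: "singular_frame A e s" and p: "p = 1 \<or> p = Suc CARD('n) \<or> s p < s (p - 1)"
    "1 \<le> p" "p \<le> Suc CARD('n)"
  shows "contracted_well_defined A (Suc CARD('n) - p)"
  unfolding contracted_well_defined_def Let_def
proof (intro impI)
  assume k: "0 < Suc CARD('n) - p" "Suc CARD('n) - p < CARD('n)"
  then have "CARD('n) - (Suc CARD('n) - p - 1) = p" "CARD('n) - (Suc CARD('n) - p) = p - 1"
    by auto
  then show "sorted_eigenvalues (mat_sqrt (transpose A ** A)) ! (Suc CARD('n) - p - 1)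
      < sorted_eigenvalues (mat_sqrt (transpose A ** A)) ! (Suc CARD('n) - p)"
    using p k by (cases "p = 1") (auto simp: sorted_singular_values_nth[OF A])
qed

text \<open>The gap is what keeps the eigenspaces of \<open>s p\<close>, ..., \<open>s d\<close>
  inside the tail: an equality \<open>s j = s q\<close> with j < p \<le> q would bring in
  \<open>e j\<close>.\<close>

lemma contracted_subspace_gap:
  fixes A :: "real^'n^'n"
  assumes A: "singular_frame A e s" and gap: "p = 1 \<or> p = Suc CARD('n) \<or> s p < s (p - 1)"
    and p: "1 \<le> p" "p \<le> Suc CARD('n)"
  shows "contracted_subspace A (Suc CARD('n) - p) = tail_space e p"
proof -
  let ?d = "CARD('n)"
  define S where "S = mat_sqrt (transpose A ** A)"
  note o = singular_frame_orthonormal[OF A]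
  have S: "S *v e j = s j *\<^sub>R e j" if "j \<in> {1..?d}" for j
    unfolding S_def using mat_sqrt_singular_frame[OF A that] .
  have eigenspace_S: "eigenspace S t = {v. \<forall>j\<in>{1..?d}. s j \<noteq> t \<longrightarrow> v \<bullet> e j = 0}" for t
    by (rule eigenspace_orthonormal[OF o S])
  have "(\<Union>j<Suc ?d - p. eigenspace S (sorted_eigenvalues S ! j)) = (\<Union>q\<in>{p..?d}. eigenspace S (s q))"
  proof -
    have "(\<Union>j<Suc ?d - p. eigenspace S (sorted_eigenvalues S ! j))
        = (\<Union>j<Suc ?d - p. eigenspace S (s (?d - j)))"
      using p sorted_singular_values_nth[OF A] by (intro SUP_cong) (auto simp: S_def)
    also have "\<dots> = (\<Union>q\<in>(\<lambda>j. ?d - j) ` {..<Suc ?d - p}. eigenspace S (s q))"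
      by simp
    also have "(\<lambda>j. ?d - j) ` {..<Suc ?d - p} = {p..?d}"
    proof (intro equalityI subsetI)
      fix q assume "q \<in> {p..?d}"
      then show "q \<in> (\<lambda>j. ?d - j) ` {..<Suc ?d - p}"
        using p by (intro image_eqI[of _ _ "?d - q"]) auto
    qed (use p in auto)
    finally show ?thesis .
  qed
  then have "contracted_subspace A (Suc ?d - p) = span (\<Union>q\<in>{p..?d}. eigenspace S (s q))"
    by (simp add: contracted_subspace_def S_def Let_def)
  also have "\<dots> = tail_space e p"
  proof
    show "span (\<Union>q\<in>{p..?d}. eigenspace S (s q)) \<subseteq> tail_space e p"
    proof (intro span_minimal subspace_tail_space UN_least subsetI)
      fix q v assume q: "q \<in> {p..?d}" and v: "v \<in> eigenspace S (s q)"
      show "v \<in> tail_space e p"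
        unfolding tail_space_def
      proof (intro CollectI ballI)
        fix j assume j: "j \<in> {1..<p}"
        have "s q \<le> s p" "s (p - 1) \<le> s j" "s p < s (p - 1)"
          using q j p gap singular_frame_antimono[OF A] by auto
        then have "s j \<noteq> s q" by linarith
        then show "v \<bullet> e j = 0"
          using v q j p(2) unfolding eigenspace_S by auto
      qed
    qed
    show "tail_space e p \<subseteq> span (\<Union>q\<in>{p..?d}. eigenspace S (s q))"
      unfolding tail_space_eq_span[OF o p(1)]
    proof (intro span_mono subsetI)
      fix v assume "v \<in> e ` {p..?d}"
      then obtain q where "q \<in> {p..?d}" "v = e q" by auto
      then show "v \<in> (\<Union>q\<in>{p..?d}. eigenspace S (s q))"
        using S p(1) by (auto simp: eigenspace_def)
    qed
  qed
  finally show ?thesis .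
qed

section \<open>Projections and limits of subspaces\<close>

lemma closest_point_subspace_unique:
  fixes V :: "'a::euclidean_space set"
  assumes V: "subspace V" and p: "p \<in> V" "\<And>w. w \<in> V \<Longrightarrow> (v - p) \<bullet> w = 0"
  shows "closest_point V v = p"
proof (rule closest_point_unique[symmetric])
  show "convex V" "closed V" "p \<in> V"
    using V p by (auto simp: subspace_imp_convex closed_subspace)
  show "\<forall>z\<in>V. dist v p \<le> dist v z"
  proof
    fix z assume z: "z \<in> V"
    have "(v - p) \<bullet> (p - z) = 0"
      using p z V by (intro p(2)) (simp add: subspace_diff)
    then have "(norm ((v - p) + (p - z)))\<^sup>2 = (norm (v - p))\<^sup>2 + (norm (p - z))\<^sup>2"
      by (intro norm_add_Pythagorean) (simp add: orthogonal_def)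
    then have "(norm (v - p))\<^sup>2 \<le> (norm (v - z))\<^sup>2"
      by simp
    then show "dist v p \<le> dist v z"
      unfolding dist_norm by (rule power2_le_imp_le) simp
  qed
qed

lemma closest_point_subspace:
  fixes V :: "'a::euclidean_space set"
  assumes "subspace V"
  shows "closest_point V v \<in> V" "w \<in> V \<Longrightarrow> (v - closest_point V v) \<bullet> w = 0"
proof -
  obtain y z where y: "y \<in> span V" and z: "\<And>w. w \<in> span V \<Longrightarrow> orthogonal z w" and v: "v = y + z"
    using orthogonal_subspace_decomp_exists[of V v] by blast
  have "closest_point V v = y"
    using assms y z v by (intro closest_point_subspace_unique)
      (auto simp: span_eq_iff[THEN iffD2] orthogonal_def)
  then show "closest_point V v \<in> V" "w \<in> V \<Longrightarrow> (v - closest_point V v) \<bullet> w = 0"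
    using assms y z v by (auto simp: span_eq_iff[THEN iffD2] orthogonal_def)
qed

lemma linear_closest_point:
  fixes V :: "'a::euclidean_space set"
  assumes V: "subspace V"
  shows "linear (closest_point V)"
proof
  note cp = closest_point_subspace[OF V]
  fix a b and r :: real
  show "closest_point V (a + b) = closest_point V a + closest_point V b"
  proof (rule closest_point_subspace_unique[OF V])
    show "closest_point V a + closest_point V b \<in> V"
      using V cp(1) by (simp add: subspace_add)
    show "(a + b - (closest_point V a + closest_point V b)) \<bullet> w = 0" if "w \<in> V" for w
      using cp(2)[OF that, of a] cp(2)[OF that, of b] by (simp add: inner_left_distrib inner_diff_left)
  qed
  show "closest_point V (r *\<^sub>R a) = r *\<^sub>R closest_point V a"
  proof (rule closest_point_subspace_unique[OF V])
    show "r *\<^sub>R closest_point V a \<in> V"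
      using V cp(1) by (simp add: subspace_scale)
    show "(r *\<^sub>R a - r *\<^sub>R closest_point V a) \<bullet> w = 0" if "w \<in> V" for w
      using cp(2)[OF that, of a] by (simp flip: scaleR_diff_right)
  qed
qed

lemma closest_point_inner:
  fixes V :: "'a::euclidean_space set"
  assumes V: "subspace V"
  shows "closest_point V v \<bullet> w = v \<bullet> closest_point V w"
  using closest_point_subspace(2)[OF V closest_point_subspace(1)[OF V], of v w]
    closest_point_subspace(2)[OF V closest_point_subspace(1)[OF V], of w v]
  by (simp add: inner_diff_left inner_diff_right inner_commute)

lemma norm_closest_point_le:
  fixes V :: "'a::euclidean_space set"
  assumes V: "subspace V"
  shows "norm (closest_point V v) \<le> norm v" "norm (v - closest_point V v) \<le> norm v"
proof -
  have "(norm (closest_point V v + (v - closest_point V v)))\<^sup>2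
      = (norm (closest_point V v))\<^sup>2 + (norm (v - closest_point V v))\<^sup>2"
    using closest_point_subspace[OF V] by (intro norm_add_Pythagorean)
      (simp add: orthogonal_def inner_commute)
  then have "(norm (closest_point V v))\<^sup>2 \<le> (norm v)\<^sup>2"
    "(norm (v - closest_point V v))\<^sup>2 \<le> (norm v)\<^sup>2"
    by auto
  then show "norm (closest_point V v) \<le> norm v" "norm (v - closest_point V v) \<le> norm v"
    by (auto intro: power2_le_imp_le)
qed

text \<open>Split \<open>v\<close> into its part in \<open>V\<close> and its part \<open>u\<close>
  orthogonal to \<open>V\<close>. The first is handled by \<open>VW\<close>; the projection of
  \<open>u\<close> to \<open>W\<close> is small by duality from \<open>WV\<close>. Each part
  contributes \<open>a\<close>.\<close>

lemma closest_point_diff_le: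
  fixes V W :: "'a::euclidean_space set"
  assumes V: "subspace V" and W: "subspace W"
    and VW: "\<And>v. v \<in> V \<Longrightarrow> norm (v - closest_point W v) \<le> a * norm v"
    and WV: "\<And>w. w \<in> W \<Longrightarrow> norm (w - closest_point V w) \<le> a * norm w"
    and a: "0 \<le> a"
  shows "norm (closest_point V v - closest_point W v) \<le> 2 * a * norm v"
proof -
  define p where "p = closest_point V v"
  define u where "u = v - p"
  define q where "q = closest_point W u"
  have "norm q * norm q \<le> (a * norm u) * norm q"
  \<comment> \<open>As \<open>u\<close> is orthogonal to \<open>V\<close>, the product u . q only
    sees the part of \<open>q\<close> off \<open>V\<close>, and that part is small because
    \<open>q\<close> lies in \<open>W\<close>.\<close>
  proof -
    have "norm q * norm q = q \<bullet> q"
      by (simp add: norm_eq_sqrt_inner)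
    also have "\<dots> = u \<bullet> q"
      using closest_point_subspace(2)[OF W closest_point_subspace(1)[OF W], of u u]
      by (simp add: q_def inner_diff_left)
    also have "\<dots> = u \<bullet> (q - closest_point V q)"
      using closest_point_subspace(2)[OF V closest_point_subspace(1)[OF V], of v q]
      by (simp add: u_def p_def inner_diff_right)
    also have "\<dots> \<le> norm u * norm (q - closest_point V q)"
      by (rule norm_cauchy_schwarz)
    also have "\<dots> \<le> norm u * (a * norm q)"
      by (intro mult_left_mono WV) (simp_all add: q_def closest_point_subspace[OF W])
    finally show ?thesis
      by (simp add: mult_ac)
  qed
  then have "norm q \<le> a * norm u"
    using a by (cases "q = 0") auto
  also have "\<dots> \<le> a * norm v"
    unfolding u_def p_def using norm_closest_point_le(2)[OF V] a by (intro mult_left_mono)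
  finally have 1: "norm q \<le> a * norm v" .
  have "norm (p - closest_point W p) \<le> a * norm p"
    unfolding p_def by (intro VW closest_point_subspace[OF V])
  also have "\<dots> \<le> a * norm v"
    unfolding p_def using norm_closest_point_le(1)[OF V] a by (intro mult_left_mono)
  finally have 2: "norm (p - closest_point W p) \<le> a * norm v" .
  have "p - closest_point W v = (p - closest_point W p) - q"
    by (simp add: q_def u_def linear_diff[OF linear_closest_point[OF W]])
  then have "norm (p - closest_point W v) \<le> norm (p - closest_point W p) + norm q"
    by (metis norm_triangle_ineq4)
  with 1 2 show ?thesis
    by (simp add: p_def)
qed

text \<open>A nonzero vector of \<open>V\<close> killed by the projection to \<open>W\<close> would
  be moved by its full norm, so the projection to \<open>W\<close> is injective on
  \<open>V\<close>.\<close>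

lemma dim_le_if_closest_point_diff_less:
  fixes V W :: "'a::euclidean_space set"
  assumes V: "subspace V" and W: "subspace W"
    and less: "\<And>v. v \<noteq> 0 \<Longrightarrow> norm (closest_point V v - closest_point W v) < norm v"
  shows "dim V \<le> dim W"
proof -
  note lin = linear_closest_point[OF W]
  have "inj_on (closest_point W) V"
  proof (rule inj_onI, rule ccontr)
    fix x y assume xy: "x \<in> V" "y \<in> V" "closest_point W x = closest_point W y" "x \<noteq> y"
    then have "closest_point W (x - y) = 0"
      by (simp add: linear_diff[OF lin])
    moreover have "closest_point V (x - y) = x - y"
      using V xy by (simp add: closest_point_self subspace_diff)
    ultimately show False
      using less[of "x - y"] xy by simp
  qed
  then have "dim (closest_point W ` V) = dim V"
    using V by (intro dim_image_eq lin) (simp add: span_eq_iff[THEN iffD2])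
  moreover have "dim (closest_point W ` V) \<le> dim W"
    using closest_point_subspace(1)[OF W] by (intro dim_subset) auto
  ultimately show ?thesis
    by simp
qed

text \<open>The projections converge pointwise by comparison with a geometric series. The limit is
  linear, symmetric and idempotent, hence itself an orthogonal projection, namely onto its set of
  fixed vectors.\<close>

lemma limit_subspace_exists:
  fixes V :: "nat \<Rightarrow> 'a::euclidean_space set"
  assumes V: "\<And>n. subspace (V n)" and dimV: "\<And>n. dim (V n) = k"
    and q: "0 \<le> q" "q < 1" and c: "0 \<le> c"
    and step: "\<And>n v. norm (closest_point (V (Suc n)) v - closest_point (V n) v) \<le> c * q ^ n * norm v"
  obtains L where "subspace L" "dim L = k"
    "\<And>n v. norm (closest_point (V n) v - closest_point L v) \<le> c / (1 - q) * q ^ n * norm v"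
proof -
  define P where "P = (\<lambda>n. closest_point (V n))"
  define C where "C = c / (1 - q)"
  have C0: "0 \<le> C"
    using q c by (simp add: C_def)
  \<comment> \<open>The factor 1 - q^m makes the induction close exactly, since c = C (1 -
    q).\<close>
  have diff: "norm (P (n + m) v - P n v) \<le> C * (1 - q ^ m) * q ^ n * norm v" for n m v
  proof (induction m)
    case 0
    then show ?case by simp
  next
    case (Suc m)
    have "norm (P (n + Suc m) v - P n v)
        \<le> norm (P (Suc (n + m)) v - P (n + m) v) + norm (P (n + m) v - P n v)"
      by (metis add_Suc_right norm_triangle_ineq diff_add_cancel add_diff_eq)
    also have "\<dots> \<le> c * q ^ (n + m) * norm v + C * (1 - q ^ m) * q ^ n * norm v"
      using step[of "n + m" v] Suc by (simp add: P_def)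
    also have "c = C * (1 - q)"
      using q by (simp add: C_def)
    finally show ?case
      by (simp add: power_add algebra_simps)
  qed
  have diff': "norm (P m v - P n v) \<le> C * q ^ n * norm v" if "n \<le> m" for n m v
  proof -
    have "norm (P m v - P n v) \<le> C * (1 - q ^ (m - n)) * q ^ n * norm v"
      using diff[of n "m - n" v] that by simp
    also have "\<dots> \<le> C * 1 * q ^ n * norm v"
      using C0 q by (intro mult_right_mono mult_left_mono) auto
    finally show ?thesis by simp
  qed
  have geo: "(\<lambda>n. C * q ^ n * r) \<longlonglongrightarrow> 0" for r
    using q by (auto intro!: tendsto_eq_intros LIMSEQ_power_zero)
  have "Cauchy (\<lambda>n. P n v)" for v
  proof (rule CauchyI)
    fix r :: real assume "0 < r"
    then have "\<forall>\<^sub>F n in sequentially. C * q ^ n * norm v < r / 2"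
      using order_tendstoD(2)[OF geo, of "r / 2"] by simp
    then obtain N where N: "C * q ^ N * norm v < r / 2"
      unfolding eventually_sequentially by blast
    have "norm (P m v - P n v) < r" if "m \<ge> N" "n \<ge> N" for m n
    proof -
      have "norm (P m v - P n v) = norm ((P m v - P N v) - (P n v - P N v))"
        by simp
      also have "\<dots> \<le> norm (P m v - P N v) + norm (P n v - P N v)"
        by (rule norm_triangle_ineq4)
      finally have "norm (P m v - P n v) \<le> norm (P m v - P N v) + norm (P n v - P N v)" .
      then show ?thesis
        using diff'[OF that(1), of v] diff'[OF that(2), of v] N by linarith
    qed
    then show "\<exists>N. \<forall>m\<ge>N. \<forall>n\<ge>N. norm (P m v - P n v) < r"
      by blast
  qed
  then have "\<exists>w. (\<lambda>n. P n v) \<longlonglongrightarrow> w" for v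
    by (simp add: Cauchy_convergent_iff convergent_def)
  then obtain Q where Q: "\<And>v. (\<lambda>n. P n v) \<longlonglongrightarrow> Q v"
    by metis
  have PQ: "norm (P n v - Q v) \<le> C * q ^ n * norm v" for n v
  proof (rule LIMSEQ_le_const2)
    show "(\<lambda>m. norm (P n v - P m v)) \<longlonglongrightarrow> norm (P n v - Q v)"
      by (intro tendsto_intros Q)
    show "\<exists>N. \<forall>m\<ge>N. norm (P n v - P m v) \<le> C * q ^ n * norm v"
      using diff'[of n _ v] by (metis norm_minus_commute)
  qed
  have linP: "linear (P n)" for n
    unfolding P_def by (rule linear_closest_point[OF V])
  have Qadd: "Q (v + w) = Q v + Q w" for v w
    using LIMSEQ_unique[OF Q[of "v + w"]] tendsto_add[OF Q[of v] Q[of w]]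
    by (simp add: linear_add[OF linP])
  have Qscale: "Q (r *\<^sub>R v) = r *\<^sub>R Q v" for r v
    using LIMSEQ_unique[OF Q[of "r *\<^sub>R v"]] tendsto_scaleR[OF tendsto_const[of r] Q[of v]]
    by (simp add: linear_scale[OF linP])
  have Qinner: "Q v \<bullet> w = v \<bullet> Q w" for v w
  proof (rule LIMSEQ_unique)
    show "(\<lambda>n. P n v \<bullet> w) \<longlonglongrightarrow> Q v \<bullet> w"
      by (intro tendsto_intros Q)
    show "(\<lambda>n. P n v \<bullet> w) \<longlonglongrightarrow> v \<bullet> Q w"
      unfolding P_def closest_point_inner[OF V] using Q unfolding P_def by (intro tendsto_intros)
  qed
  have Qidem: "Q (Q v) = Q v" for v
  proof (rule LIMSEQ_unique[of "\<lambda>n. P n (Q v)"])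
    show "(\<lambda>n. P n (Q v)) \<longlonglongrightarrow> Q (Q v)"
      by (rule Q)
    have "norm (P n (Q v) - Q v) \<le> 2 * (C * q ^ n * norm v)" for n
    proof -
      have "P n (P n v) = P n v"
        unfolding P_def by (intro closest_point_self closest_point_subspace[OF V])
      then have "P n (Q v) - Q v = P n (Q v - P n v) + (P n v - Q v)"
        by (simp add: linear_diff[OF linP])
      then have "norm (P n (Q v) - Q v) \<le> norm (P n (Q v - P n v)) + norm (P n v - Q v)"
        by (metis norm_triangle_ineq)
      also have "\<dots> \<le> norm (P n v - Q v) + norm (P n v - Q v)"
        using norm_closest_point_le(1)[OF V, of n "Q v - P n v"]
        by (simp add: P_def norm_minus_commute)
      finally show ?thesis
        using PQ[of n v] by simp
    qed
    then have "(\<lambda>n. P n (Q v) - Q v) \<longlonglongrightarrow> 0"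
      by (intro Lim_null_comparison[OF always_eventually tendsto_mult_right_zero[OF geo]] allI)
    then show "(\<lambda>n. P n (Q v)) \<longlonglongrightarrow> Q v"
      by (simp add: LIM_zero_iff)
  qed
  define L where "L = {v. Q v = v}"
  have "Q 0 = 0"
    using Qscale[of 0 0] by simp
  then have L: "subspace L"
    by (auto simp: L_def subspace_def Qadd Qscale)
  have QL: "closest_point L v = Q v" for v
    by (rule closest_point_subspace_unique[OF L])
       (auto simp: L_def Qidem inner_diff_left Qinner)
  \<comment> \<open>One time at which the two projections differ by less than the identity is
    enough, as all \<open>V n\<close> have the same dimension.\<close>
  obtain N where N: "C * q ^ N < 1"
    using order_tendstoD(2)[OF geo[of 1], of 1] unfolding eventually_sequentially by auto
  have less: "norm (closest_point (V N) v - closest_point L v) < norm v" if "v \<noteq> 0" for v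
  proof -
    have "norm (closest_point (V N) v - closest_point L v) \<le> C * q ^ N * norm v"
      using PQ by (simp add: QL P_def)
    also have "\<dots> < 1 * norm v"
      using N that by (intro mult_strict_right_mono) auto
    finally show ?thesis by simp
  qed
  have "dim (V N) \<le> dim L"
    by (rule dim_le_if_closest_point_diff_less[OF V L less])
  moreover have "dim L \<le> dim (V N)"
    by (rule dim_le_if_closest_point_diff_less[OF L V]) (metis less norm_minus_commute)
  ultimately have "dim L = k"
    by (simp add: dimV)
  with L show ?thesis
    using PQ that[of L] by (simp add: QL P_def C_def)
qed

lemma subspace_dist_le:
  assumes "\<And>v. norm (closest_point V v - closest_point W v) \<le> b * norm v"
  shows "subspace_dist V W \<le> b"
  unfolding subspace_dist_def by (rule onorm_le) (rule assms)

lemma subspace_dist_nonneg: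
  assumes "subspace V" "subspace W"
  shows "0 \<le> subspace_dist V W"
  unfolding subspace_dist_def
  by (intro onorm_pos_le linear_conv_bounded_linear[THEN iffD1] linear_compose_sub
      linear_closest_point assms)

section \<open>Growth along a one-sided sequence\<close>

lemma closest_point_tail_space:
  fixes e :: "nat \<Rightarrow> real^'n"
  assumes o: "orthonormal_family CARD('n) e" and p: "p \<le> Suc CARD('n)"
  shows "closest_point (tail_space e p) v = v - (\<Sum>j\<in>{1..<p}. (v \<bullet> e j) *\<^sub>R e j)"
proof (rule closest_point_subspace_unique[OF subspace_tail_space])
  have inner: "(\<Sum>j\<in>{1..<p}. (v \<bullet> e j) *\<^sub>R e j) \<bullet> e i = v \<bullet> e i" if i: "i \<in> {1..<p}" for i
  proof -
    have "(\<Sum>j\<in>{1..<p}. (v \<bullet> e j) *\<^sub>R e j) \<bullet> e i = (\<Sum>j\<in>{1..<p}. if j = i then v \<bullet> e i else 0)"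
      unfolding inner_sum_left using p i orthonormal_family_inner[OF o]
      by (intro sum.cong) auto
    then show ?thesis
      using i by simp
  qed
  then show "v - (\<Sum>j\<in>{1..<p}. (v \<bullet> e j) *\<^sub>R e j) \<in> tail_space e p"
    by (simp add: tail_space_def inner_diff_left)
  fix w assume "w \<in> tail_space e p"
  then have "(\<Sum>j\<in>{1..<p}. (v \<bullet> e j) * (e j \<bullet> w)) = 0"
    by (intro sum.neutral) (auto simp: tail_space_def inner_commute)
  then show "(v - (v - (\<Sum>j\<in>{1..<p}. (v \<bullet> e j) *\<^sub>R e j))) \<bullet> w = 0"
    by (simp add: inner_sum_left)
qed

lemma singular_frame_tail_upper:
  fixes A :: "real^'n^'n"
  assumes A: "singular_frame A e s" and p: "1 \<le> p" "p \<le> CARD('n)" and w: "w \<in> tail_space e p"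
  shows "norm (A *v w) \<le> s p * norm w"
proof (rule power2_le_imp_le)
  have "(norm (A *v w))\<^sup>2 = (\<Sum>j\<in>{1..CARD('n)}. (s j)\<^sup>2 * (w \<bullet> e j)\<^sup>2)"
    by (rule singular_frame_norm_mult[OF A])
  also have "\<dots> \<le> (\<Sum>j\<in>{1..CARD('n)}. (s p)\<^sup>2 * (w \<bullet> e j)\<^sup>2)"
  proof (intro sum_mono)
    fix j assume j: "j \<in> {1..CARD('n)}"
    show "(s j)\<^sup>2 * (w \<bullet> e j)\<^sup>2 \<le> (s p)\<^sup>2 * (w \<bullet> e j)\<^sup>2"
    proof (cases "j < p")
      case True
      then have "w \<bullet> e j = 0"
        using w j by (simp add: tail_space_def)
      then show ?thesis by simp
    next
      case False
      then have "s j \<le> s p" "0 < s j"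
        using j p singular_frame_antimono[OF A, of p j] singular_frame_pos[OF A j] by auto
      then show ?thesis
        by (intro mult_right_mono power_mono) auto
    qed
  qed
  also have "\<dots> = (s p)\<^sup>2 * (norm w)\<^sup>2"
    unfolding orthonormal_family_norm_expand[OF singular_frame_orthonormal[OF A], of w]
    by (rule sum_distrib_left[symmetric])
  finally show "(norm (A *v w))\<^sup>2 \<le> (s p * norm w)\<^sup>2"
    by (simp add: power_mult_distrib)
  show "0 \<le> s p * norm w"
    using singular_frame_pos[OF A, of p] p by simp
qed

text \<open>Only the coordinates along \<open>e 1\<close>, ..., \<open>e (p - 1)\<close> are kept,
  each stretched by at least \<open>s (p - 1)\<close>. For p = d + 1 the tail is \<open>{0}\<close>,
  so the whole vector is stretched by at least \<open>s d\<close>.\<close>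

lemma singular_frame_tail_lower:
  fixes A :: "real^'n^'n"
  assumes A: "singular_frame A e s" and p: "2 \<le> p" "p \<le> Suc CARD('n)"
  shows "s (p - 1) * norm (v - closest_point (tail_space e p) v) \<le> norm (A *v v)"
proof (rule power2_le_imp_le)
  note o = singular_frame_orthonormal[OF A]
  have sub: "{1..<p} \<subseteq> {1..CARD('n)}"
    using p by auto
  have "v - closest_point (tail_space e p) v = (\<Sum>j\<in>{1..<p}. (v \<bullet> e j) *\<^sub>R e j)"
    by (simp add: closest_point_tail_space[OF o p(2)])
  then have "(s (p - 1) * norm (v - closest_point (tail_space e p) v))\<^sup>2
      = (\<Sum>j\<in>{1..<p}. (s (p - 1))\<^sup>2 * (v \<bullet> e j)\<^sup>2)"
    using orthonormal_family_norm_sum[OF o sub, of "\<lambda>j. v \<bullet> e j"]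
    by (simp add: power_mult_distrib sum_distrib_left)
  also have "\<dots> \<le> (\<Sum>j\<in>{1..<p}. (s j)\<^sup>2 * (v \<bullet> e j)\<^sup>2)"
  proof (intro sum_mono mult_right_mono power_mono)
    fix j assume j: "j \<in> {1..<p}"
    then show "s (p - 1) \<le> s j"
      using p by (intro singular_frame_antimono[OF A]) auto
    have "p - 1 \<in> {1..CARD('n)}"
      using p by auto
    then show "0 \<le> s (p - 1)"
      using singular_frame_pos[OF A] less_imp_le by blast
  qed simp
  also have "\<dots> \<le> (\<Sum>j\<in>{1..CARD('n)}. (s j)\<^sup>2 * (v \<bullet> e j)\<^sup>2)"
    using sub by (intro sum_mono2) auto
  also have "\<dots> = (norm (A *v v))\<^sup>2"
    by (rule singular_frame_norm_mult[OF A, symmetric])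
  finally show "(s (p - 1) * norm (v - closest_point (tail_space e p) v))\<^sup>2 \<le> (norm (A *v v))\<^sup>2" .
qed simp

text \<open>The numerator is the constant of the one-step coordinate estimate; the denominator sums
  the geometric series of ratio exp(- 16 \<epsilon>).\<close>

definition rate_const :: "real \<Rightarrow> real \<Rightarrow> real \<Rightarrow> real \<Rightarrow> real" where
  "rate_const K C \<epsilon> R = K * exp (4 * C + 2 * \<epsilon> + R) / (1 - exp (- 16 * \<epsilon>))"

text \<open>The solution of the recursion that multiplies the constant by 1 + d r at each level,
  starting from exp(2 C), the error in a single singular value at time 0.\<close>

definition growth_const :: "nat \<Rightarrow> real \<Rightarrow> real \<Rightarrow> nat \<Rightarrow> real" where
  "growth_const d C r i = exp (2 * C) * (1 + real d * r) ^ i"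

text \<open>The extreme indices \<open>1\<close> and \<open>d + 1\<close> stand for the whole space and for \<open>{0}\<close>.\<close>

definition regular_index :: "nat \<Rightarrow> (nat \<Rightarrow> real) \<Rightarrow> nat \<Rightarrow> bool" where
  "regular_index d lam p \<longleftrightarrow> p \<in> {1..Suc d} \<and> (p = 1 \<or> p = Suc d \<or> lam p < lam (p - 1))"

text \<open>The dynamics is forgotten: consecutive matrices are comparable and the exterior norms
  have the prescribed growth. Forward and backward products at one point are thus instances of the
  same locale. \<open>R\<close> absorbs a shift of time by one and the finitely many early
  times.\<close>

locale pesin_sequence =
  fixes A :: "nat \<Rightarrow> real^'n^'n" and lam :: "nat \<Rightarrow> real" and K C \<epsilon> R :: real
    and e :: "nat \<Rightarrow> nat \<Rightarrow> real^'n" and s :: "nat \<Rightarrow> nat \<Rightarrow> real"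
  assumes frame: "\<And>n. singular_frame (A n) (e n) (s n)"
    and K_pos: "0 \<le> K" and C_nonneg: "0 \<le> C" and eps_pos: "0 < \<epsilon>"
    and step_up: "\<And>n v. norm (A (Suc n) *v v) \<le> K * norm (A n *v v)"
    and step_down: "\<And>n v. norm (A n *v v) \<le> K * norm (A (Suc n) *v v)"
    and lam_antimono: "\<And>i j. 1 \<le> i \<Longrightarrow> i \<le> j \<Longrightarrow> j \<le> CARD('n) \<Longrightarrow> lam j \<le> lam i"
    and lam_bound: "\<And>i. i \<in> {1..CARD('n)} \<Longrightarrow> \<bar>lam i\<bar> \<le> R"
    and lam_gap: "\<And>p. p \<in> {2..CARD('n)} \<Longrightarrow> lam p < lam (p - 1) \<Longrightarrow> 20 * \<epsilon> < lam (p - 1) - lam p"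
    and ext_bound: "\<And>i n. i \<in> {1..CARD('n)} \<Longrightarrow>
      \<bar>ln (ext_power_norm i (A n)) - real n * (\<Sum>j=1..i. lam j)\<bar> \<le> C + real n * \<epsilon>"
begin

abbreviation F :: "nat \<Rightarrow> nat \<Rightarrow> (real^'n) set" where
  "F p n \<equiv> tail_space (e n) p"

abbreviation rate :: real where
  "rate \<equiv> rate_const K C \<epsilon> R"

section \<open>Singular values and coordinates after one step\<close>

lemma rate_nonneg: "0 \<le> rate"
  using K_pos eps_pos by (simp add: rate_const_def)

lemma orthonormal_e: "orthonormal_family CARD('n) (e n)"
  by (rule singular_frame_orthonormal[OF frame])

text \<open>\<open>s n i\<close> is the quotient of the exterior norms of degrees \<open>i\<close>
  and \<open>i - 1\<close>, so the two errors add up. Degree 0 is an empty product and is outside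
  \<open>ext_bound\<close>.\<close>

lemma singular_value_bound:
  assumes i: "i \<in> {1..CARD('n)}"
  shows "\<bar>ln (s n i) - real n * lam i\<bar> \<le> 2 * C + 2 * real n * \<epsilon>"
proof -
  have spos: "0 < s n j" if "j \<in> {1..CARD('n)}" for j
    using singular_frame_pos[OF frame that] .
  define P where "P = (\<lambda>k. \<Prod>j\<in>{1..k}. s n j)"
  have Ppos: "0 < P k" if "k \<le> CARD('n)" for k
    unfolding P_def using that spos by (intro prod_pos) auto
  have Pbound: "\<bar>ln (P k) - real n * (\<Sum>j=1..k. lam j)\<bar> \<le> C + real n * \<epsilon>" if "k \<le> CARD('n)" for k
  proof (cases "k = 0")
    case True
    then show ?thesis
      using C_nonneg eps_pos by (simp add: P_def)
  next
    case False
    then show ?thesis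
      using ext_bound[of k n] that by (simp add: P_def ext_power_norm_singular_values[OF frame that])
  qed
  obtain k where k: "i = Suc k"
    using i by (cases i) auto
  have "P i = P k * s n i"
    unfolding P_def k by simp
  then have "ln (P i) = ln (P k) + ln (s n i)"
    using Ppos[of k] spos[OF i] i k by (simp add: ln_mult)
  moreover have "(\<Sum>j=1..i. lam j) = (\<Sum>j=1..k. lam j) + lam i"
    unfolding k by simp
  ultimately show ?thesis
    using Pbound[of i] Pbound[of k] i k by (simp add: algebra_simps abs_le_iff)
qed

lemma singular_value_le:
  assumes "i \<in> {1..CARD('n)}"
  shows "s n i \<le> exp (real n * lam i + 2 * C + 2 * real n * \<epsilon>)"
  using singular_value_bound[OF assms, of n] singular_frame_pos[OF frame assms, of n]
  by (subst ln_le_cancel_iff[symmetric]) (auto simp: abs_le_iff)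

lemma singular_value_ge:
  assumes "i \<in> {1..CARD('n)}"
  shows "exp (real n * lam i - 2 * C - 2 * real n * \<epsilon>) \<le> s n i"
  using singular_value_bound[OF assms, of n] singular_frame_pos[OF frame assms, of n]
  by (subst ln_le_cancel_iff[symmetric]) (auto simp: abs_le_iff)

text \<open>Shared by the step forward and the step backward, with k and l equal to n and n + 1 in
  either order. Dividing by \<open>s k j\<close>, the errors of the two singular values give 4 C + 2
  (2 n + 1) \<epsilon>, and the exponent at the unmatched unit of time is at most
  \<open>R\<close>.\<close>

lemma coordinate_bound_aux:
  assumes j: "1 \<le> j" "j < p" and p: "p \<le> CARD('n)"
    and k: "k = n \<or> k = Suc n" and l: "l = n \<or> l = Suc n" "k \<noteq> l"
    and c: "s k j * c \<le> K * (s l p * r)" and r: "0 \<le> r"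
  shows "c \<le> K * exp (4 * C + 2 * \<epsilon> + R) * exp (- real n * (lam j - lam p - 4 * \<epsilon>)) * r"
proof -
  have jp: "j \<in> {1..CARD('n)}" "p \<in> {1..CARD('n)}"
    using j p by auto
  define a where "a = real k * lam j - 2 * C - 2 * real k * \<epsilon>"
  define b where "b = real l * lam p + 2 * C + 2 * real l * \<epsilon>"
  have "K * (s l p * r) \<le> K * (exp b * r)"
    unfolding b_def using singular_value_le[OF jp(2)] K_pos r by (intro mult_left_mono mult_right_mono)
  with c have le: "s k j * c \<le> K * (exp b * r)"
    by linarith
  have "c \<le> K * exp (b - a) * r"
  proof (cases "0 \<le> c")
    case True
    have "exp a * c \<le> s k j * c"
      unfolding a_def using singular_value_ge[OF jp(1)] True by (intro mult_right_mono)
    with le have "exp a * c \<le> K * (exp b * r)"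
      by linarith
    then show ?thesis
      by (simp add: exp_diff field_simps)
  next
    case False
    moreover have "0 \<le> K * exp (b - a) * r"
      using K_pos r by simp
    ultimately show ?thesis by linarith
  qed
  also have "\<dots> \<le> K * exp (4 * C + 2 * \<epsilon> + R + (- real n * (lam j - lam p - 4 * \<epsilon>))) * r"
  proof -
    have "lam p \<le> R" "- lam j \<le> R" "lam j \<le> R" "- lam p \<le> R"
      using lam_bound[OF jp(1)] lam_bound[OF jp(2)] by auto
    then have "b - a \<le> 4 * C + 2 * \<epsilon> + R + (- real n * (lam j - lam p - 4 * \<epsilon>))"
      unfolding a_def b_def using k l by (auto simp: algebra_simps)
    then show ?thesis
      using K_pos r by (intro mult_left_mono mult_right_mono) auto
  qed
  finally show ?thesis
    by (simp only: exp_add[of "4 * C + 2 * \<epsilon> + R"] mult.assoc)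
qed

text \<open>\<open>A n\<close> stretches the tail by at most \<open>s n p\<close>, so the next
  matrix stretches it by at most K times that; a component along the new \<open>e j\<close> would be
  stretched by the new \<open>s j\<close>, which is much larger.\<close>

lemma coordinate_bound_up:
  assumes j: "1 \<le> j" "j < p" and p: "p \<le> CARD('n)" and w: "w \<in> F p n"
  shows "\<bar>w \<bullet> e (Suc n) j\<bar>
    \<le> K * exp (4 * C + 2 * \<epsilon> + R) * exp (- real n * (lam j - lam p - 4 * \<epsilon>)) * norm w"
proof (rule coordinate_bound_aux[OF j p])
  have "s (Suc n) j * \<bar>w \<bullet> e (Suc n) j\<bar> \<le> norm (A (Suc n) *v w)"
    using j p by (intro singular_frame_coordinate_le[OF frame]) auto
  also have "\<dots> \<le> K * norm (A n *v w)"
    by (rule step_up)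
  also have "\<dots> \<le> K * (s n p * norm w)"
    using j p K_pos by (intro mult_left_mono singular_frame_tail_upper[OF frame _ _ w]) auto
  finally show "s (Suc n) j * \<bar>w \<bullet> e (Suc n) j\<bar> \<le> K * (s n p * norm w)" .
qed auto

lemma coordinate_bound_down:
  assumes j: "1 \<le> j" "j < p" and p: "p \<le> CARD('n)" and w: "w \<in> F p (Suc n)"
  shows "\<bar>w \<bullet> e n j\<bar>
    \<le> K * exp (4 * C + 2 * \<epsilon> + R) * exp (- real n * (lam j - lam p - 4 * \<epsilon>)) * norm w"
proof (rule coordinate_bound_aux[OF j p])
  have "s n j * \<bar>w \<bullet> e n j\<bar> \<le> norm (A n *v w)"
    using j p by (intro singular_frame_coordinate_le[OF frame]) auto
  also have "\<dots> \<le> K * norm (A (Suc n) *v w)"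
    by (rule step_down)
  also have "\<dots> \<le> K * (s (Suc n) p * norm w)"
    using j p K_pos by (intro mult_left_mono singular_frame_tail_upper[OF frame _ _ w]) auto
  finally show "s n j * \<bar>w \<bullet> e n j\<bar> \<le> K * (s (Suc n) p * norm w)" .
qed auto

section \<open>Convergence of the tails to the limit spaces\<close>

lemma regular_gap:
  assumes p: "regular_index CARD('n) lam p" "p \<le> CARD('n)" and j: "1 \<le> j" "j < p"
  shows "20 * \<epsilon> < lam j - lam p"
proof -
  have "lam p < lam (p - 1)"
    using p j by (auto simp: regular_index_def)
  then have "20 * \<epsilon> < lam (p - 1) - lam p"
    using p j by (intro lam_gap) auto
  moreover have "lam (p - 1) \<le> lam j"
    using p j by (intro lam_antimono) auto
  ultimately show ?thesis by linarith
qed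

text \<open>The distance to the other tail is the norm of at most d coordinates, each of which
  decays at least at the rate 20 \<epsilon> - 4 \<epsilon>.\<close>

lemma off_tail_bound:
  assumes p: "regular_index CARD('n) lam p" and nm: "k = n \<or> k = Suc n" "l = n \<or> l = Suc n" and w: "w \<in> F p k"
  shows "norm (w - closest_point (F p l) w)
    \<le> real CARD('n) * (K * exp (4 * C + 2 * \<epsilon> + R)) * exp (- 16 * \<epsilon>) ^ n * norm w"
\<comment> \<open>For p = d + 1 both tails are \<open>{0}\<close>, and \<open>lam p\<close> is not
  an exponent, so no gap may be invoked.\<close>
proof (cases "k = l \<or> p = Suc CARD('n)")
  case True
  have "w - closest_point (F p l) w = 0"
  proof (cases "k = l")
    case True
    then show ?thesis using w by (simp add: closest_point_self)
  next
    case False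
    with True have "dim (F p k) = 0"
      by (simp add: dim_tail_space[OF orthonormal_e])
    then have "w = 0"
      using w unfolding dim_eq_0 by auto
    then show ?thesis
      by (simp add: linear_0 linear_closest_point subspace_tail_space)
  qed
  then show ?thesis
    using K_pos by simp
next
  case False
  then have p': "p \<le> CARD('n)" "k \<noteq> l"
    using p by (auto simp: regular_index_def)
  have "w - closest_point (F p l) w = (\<Sum>j\<in>{1..<p}. (w \<bullet> e l j) *\<^sub>R e l j)"
    using p' by (simp add: closest_point_tail_space[OF orthonormal_e])
  then have "norm (w - closest_point (F p l) w) \<le> (\<Sum>j\<in>{1..<p}. norm ((w \<bullet> e l j) *\<^sub>R e l j))"
    by (simp only: norm_sum)
  also have "\<dots> \<le> (\<Sum>j\<in>{1..<p}. (K * exp (4 * C + 2 * \<epsilon> + R)) * exp (- 16 * \<epsilon>) ^ n * norm w)"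
  proof (intro sum_mono)
    fix j assume j: "j \<in> {1..<p}"
    then have j': "1 \<le> j" "j < p" by auto
    have "norm ((w \<bullet> e l j) *\<^sub>R e l j) = \<bar>w \<bullet> e l j\<bar>"
      using orthonormal_family_norm[OF orthonormal_e, of j l] j p' by simp
    also have "\<dots> \<le> K * exp (4 * C + 2 * \<epsilon> + R) * exp (- real n * (lam j - lam p - 4 * \<epsilon>)) * norm w"
      using nm p'(2) w coordinate_bound_up[OF j' p'(1)] coordinate_bound_down[OF j' p'(1)] by auto
    also have "\<dots> \<le> K * exp (4 * C + 2 * \<epsilon> + R) * exp (- 16 * \<epsilon>) ^ n * norm w"
    proof -
      have "real n * (16 * \<epsilon>) \<le> real n * (lam j - lam p - 4 * \<epsilon>)"
        using regular_gap[OF p p'(1) j'] by (intro mult_left_mono) auto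
      then have "exp (- real n * (lam j - lam p - 4 * \<epsilon>)) \<le> exp (- 16 * \<epsilon>) ^ n"
        by (simp flip: exp_of_nat_mult)
      then show ?thesis
        using K_pos by (intro mult_right_mono mult_left_mono) auto
    qed
    finally show "norm ((w \<bullet> e l j) *\<^sub>R e l j)
      \<le> (K * exp (4 * C + 2 * \<epsilon> + R)) * exp (- 16 * \<epsilon>) ^ n * norm w" .
  qed
  also have "\<dots> = real (p - 1) * (K * exp (4 * C + 2 * \<epsilon> + R) * exp (- 16 * \<epsilon>) ^ n * norm w)"
    by simp
  also have "\<dots> \<le> real CARD('n) * (K * exp (4 * C + 2 * \<epsilon> + R) * exp (- 16 * \<epsilon>) ^ n * norm w)"
    using p' K_pos by (intro mult_right_mono) auto
  finally show ?thesis
    by (simp add: mult.assoc)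
qed

text \<open>Chosen together with an explicit rate of convergence whose constant depends only on the
  parameters of the locale and d; this is what later makes \<open>m0\<close> independent of the
  point.\<close>

definition limit_space :: "nat \<Rightarrow> (real^'n) set" where
  "limit_space p = (SOME L. subspace L \<and> dim L = Suc CARD('n) - p \<and>
     (\<forall>n v. norm (closest_point (F p n) v - closest_point L v)
        \<le> 2 * real CARD('n) * rate * exp (- 16 * \<epsilon>) ^ n * norm v))"

lemma limit_space:
  assumes p: "regular_index CARD('n) lam p"
  shows "subspace (limit_space p)" "dim (limit_space p) = Suc CARD('n) - p"
    "norm (closest_point (F p n) v - closest_point (limit_space p) v)
        \<le> 2 * real CARD('n) * rate * exp (- 16 * \<epsilon>) ^ n * norm v"
proof -
  define c where "c = real CARD('n) * (K * exp (4 * C + 2 * \<epsilon> + R))"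
  have c: "0 \<le> c"
    using K_pos by (simp add: c_def)
  have "norm (closest_point (F p (Suc n)) v - closest_point (F p n) v)
      \<le> 2 * c * exp (- 16 * \<epsilon>) ^ n * norm v" for n v
  proof -
    have "norm (closest_point (F p (Suc n)) v - closest_point (F p n) v)
        \<le> 2 * (c * exp (- 16 * \<epsilon>) ^ n) * norm v"
      unfolding c_def
      by (intro closest_point_diff_le subspace_tail_space off_tail_bound[OF p, where n = n])
        (auto simp: K_pos)
    then show ?thesis
      by (simp add: mult.assoc)
  qed
  then obtain L where L: "subspace L" "dim L = Suc CARD('n) - p"
    "\<And>n v. norm (closest_point (F p n) v - closest_point L v)
      \<le> 2 * c / (1 - exp (- 16 * \<epsilon>)) * exp (- 16 * \<epsilon>) ^ n * norm v"
    using p c eps_pos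
    by (elim limit_subspace_exists[rotated -1, where k = "Suc CARD('n) - p"])
      (auto simp: subspace_tail_space regular_index_def intro!: dim_tail_space orthonormal_e)
  have rate: "2 * c / (1 - exp (- 16 * \<epsilon>)) = 2 * real CARD('n) * rate"
    by (simp add: c_def rate_const_def)
  have "\<exists>L. subspace L \<and> dim L = Suc CARD('n) - p \<and>
     (\<forall>n v. norm (closest_point (F p n) v - closest_point L v)
        \<le> 2 * real CARD('n) * rate * exp (- 16 * \<epsilon>) ^ n * norm v)"
    using L(1,2) L(3)[unfolded rate] by blast
  from someI_ex[OF this] show "subspace (limit_space p)" "dim (limit_space p) = Suc CARD('n) - p"
    "norm (closest_point (F p n) v - closest_point (limit_space p) v)
        \<le> 2 * real CARD('n) * rate * exp (- 16 * \<epsilon>) ^ n * norm v"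
    unfolding limit_space_def by blast+
qed

lemma closest_point_tendsto_limit_space:
  assumes "regular_index CARD('n) lam p"
  shows "(\<lambda>n. closest_point (F p n) v) \<longlonglongrightarrow> closest_point (limit_space p) v"
proof (rule LIM_zero_cancel, rule Lim_null_comparison)
  show "\<forall>\<^sub>F n in sequentially. norm (closest_point (F p n) v - closest_point (limit_space p) v)
      \<le> 2 * real CARD('n) * rate * exp (- 16 * \<epsilon>) ^ n * norm v"
    using limit_space(3)[OF assms] by simp
  show "(\<lambda>n. 2 * real CARD('n) * rate * exp (- 16 * \<epsilon>) ^ n * norm v) \<longlonglongrightarrow> 0"
    using eps_pos by (auto intro!: tendsto_eq_intros LIMSEQ_power_zero)
qed

text \<open>The tails are nested at each time. The projection of \<open>v\<close> to the smaller
  tail converges to \<open>v\<close> and lies in the larger tail, which is close to its own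
  limit.\<close>

lemma limit_space_antimono:
  assumes p: "regular_index CARD('n) lam p" and q: "regular_index CARD('n) lam q" and pq: "p \<le> q"
  shows "limit_space q \<subseteq> limit_space p"
proof
  fix v assume v: "v \<in> limit_space q"
  define u where "u = (\<lambda>n. closest_point (F q n) v)"
  have "u \<longlonglongrightarrow> v"
    using closest_point_tendsto_limit_space[OF q, of v] v by (simp add: u_def closest_point_self)
  have "norm (u n - closest_point (limit_space p) (u n))
      \<le> 2 * real CARD('n) * rate * exp (- 16 * \<epsilon>) ^ n * norm v" for n
  proof -
    have "u n \<in> F p n"
      using closest_point_subspace(1)[OF subspace_tail_space] tail_space_antimono[OF pq]
      unfolding u_def by blast
    then have eq: "u n - closest_point (limit_space p) (u n)
        = closest_point (F p n) (u n) - closest_point (limit_space p) (u n)"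
      by (simp add: closest_point_self)
    have "norm (u n - closest_point (limit_space p) (u n))
        \<le> 2 * real CARD('n) * rate * exp (- 16 * \<epsilon>) ^ n * norm (u n)"
      unfolding eq by (rule limit_space(3)[OF p])
    also have "\<dots> \<le> 2 * real CARD('n) * rate * exp (- 16 * \<epsilon>) ^ n * norm v"
      unfolding u_def using rate_nonneg
      by (intro mult_left_mono norm_closest_point_le subspace_tail_space) auto
    finally show ?thesis .
  qed
  moreover have "(\<lambda>n. 2 * real CARD('n) * rate * exp (- 16 * \<epsilon>) ^ n * norm v) \<longlonglongrightarrow> 0"
    using eps_pos by (auto intro!: tendsto_eq_intros LIMSEQ_power_zero)
  ultimately have lim0: "(\<lambda>n. u n - closest_point (limit_space p) (u n)) \<longlonglongrightarrow> 0"
    by (rule Lim_null_comparison[OF always_eventually[OF allI]])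
  have "(\<lambda>n. u n - closest_point (limit_space p) (u n))
      \<longlonglongrightarrow> v - closest_point (limit_space p) v"
    using linear_closest_point[OF limit_space(1)[OF p], unfolded linear_conv_bounded_linear]
    by (rule tendsto_diff[OF \<open>u \<longlonglongrightarrow> v\<close> bounded_linear.tendsto[OF _ \<open>u \<longlonglongrightarrow> v\<close>]])
  then have "v - closest_point (limit_space p) v = 0"
    by (rule LIMSEQ_unique[OF _ lim0])
  then show "v \<in> limit_space p"
    using closest_point_subspace(1)[OF limit_space(1)[OF p], of v] by simp
qed

section \<open>Upper and lower growth bounds\<close>

lemma growth_pos: "0 < growth_const CARD('n) C rate i"
  using rate_nonneg unfolding growth_const_def by (intro mult_pos_pos zero_less_power add_pos_nonneg) auto

lemma growth_mono: "i \<le> j \<Longrightarrow> growth_const CARD('n) C rate i \<le> growth_const CARD('n) C rate j"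
  using rate_nonneg unfolding growth_const_def by (intro mult_left_mono power_increasing) auto

lemma growth_ge: "exp (2 * C) \<le> growth_const CARD('n) C rate i"
proof -
  have "1 \<le> (1 + real CARD('n) * rate) ^ i"
    using rate_nonneg by (intro one_le_power) simp
  then show ?thesis
    by (simp add: growth_const_def)
qed

text \<open>The bound is uniform in \<open>m\<close>: passing from \<open>m\<close> to \<open>m + 1\<close> adds a component along each
  \<open>e m j\<close> with \<open>j < i\<close>, which is exponentially small, and on which \<open>A n\<close> grows at most at the
  rate already known for \<open>j\<close>.\<close>

lemma growth_bound_tail:
  assumes "i \<in> {1..CARD('n)}" "n \<le> m" "w \<in> F i m"
  shows "norm (A n *v w)
    \<le> growth_const CARD('n) C rate i * exp (real n * (lam i + (4 * real i - 2) * \<epsilon>)) * norm w"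
  using assms
proof (induction i arbitrary: m w rule: less_induct)
  case (less i)
  show ?case
  proof (cases "regular_index CARD('n) lam i")
    \<comment> \<open>Without a gap at \<open>i\<close> the exponents at \<open>i - 1\<close> and
      \<open>i\<close> agree, and the bound for the larger tail at \<open>i - 1\<close> is already
      sufficient.\<close>
    case False
    then have i: "2 \<le> i" "\<not> lam i < lam (i - 1)"
      using less.prems by (auto simp: regular_index_def)
    have le: "lam (i - 1) \<le> lam i"
      using i by simp
    have "norm (A n *v w)
        \<le> growth_const CARD('n) C rate (i - 1) * exp (real n * (lam (i - 1) + (4 * real (i - 1) - 2) * \<epsilon>)) * norm w"
    proof (rule less.IH)
      show "w \<in> F (i - 1) m"
        using less.prems(3) tail_space_antimono[of "i - 1" i] by auto
    qed (use i less.prems in auto)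
    also have "\<dots> \<le> growth_const CARD('n) C rate i * exp (real n * (lam i + (4 * real i - 2) * \<epsilon>)) * norm w"
    proof (intro mult_right_mono mult_mono growth_mono)
      have "(4 * real (i - 1) - 2) * \<epsilon> \<le> (4 * real i - 2) * \<epsilon>"
        using eps_pos by (intro mult_right_mono) auto
      then show "exp (real n * (lam (i - 1) + (4 * real (i - 1) - 2) * \<epsilon>))
          \<le> exp (real n * (lam i + (4 * real i - 2) * \<epsilon>))"
        using le by (simp add: mult_left_mono)
    qed (use less_imp_le[OF growth_pos] in auto)
    finally show ?thesis .
  next
    case True
    define q where "q = exp (- 16 * \<epsilon>)"
    define C0 where "C0 = K * exp (4 * C + 2 * \<epsilon> + R)"
    define G where "G = exp (real n * (lam i + (4 * real i - 2) * \<epsilon>))"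
    define D where "D = growth_const CARD('n) C rate (i - 1)"
    define d where "d = real CARD('n)"
    have q: "0 < q" "q < 1"
      using eps_pos by (auto simp: q_def)
    have pos: "0 \<le> C0" "0 < G" "0 < D" "0 \<le> d"
      using K_pos growth_pos by (auto simp: C0_def G_def D_def d_def)
    have i: "1 \<le> i" "i \<le> CARD('n)"
      using less.prems by auto
    have "norm (A n *v w) \<le> G * (exp (2 * C) + d * C0 * D * (\<Sum>l<k. q ^ l)) * norm w"
      if "w \<in> F i (n + k)" for k w
      using that
    proof (induction k arbitrary: w)
      case 0
      have "norm (A n *v w) \<le> s n i * norm w"
        using 0 i by (intro singular_frame_tail_upper[OF frame]) auto
      also have "\<dots> \<le> exp (real n * lam i + 2 * C + 2 * real n * \<epsilon>) * norm w"
        using i by (intro mult_right_mono singular_value_le) auto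
      also have "\<dots> \<le> G * exp (2 * C) * norm w"
      proof -
        \<comment> \<open>The singular value error of 2 \<epsilon> per unit of time fits because 4 i
          - 2 \<ge> 2; this fixes the start of the sequence 4 i - 2.\<close>
        have "real n * \<epsilon> * 2 \<le> real n * \<epsilon> * (4 * real i - 2)"
          using i eps_pos by (intro mult_left_mono) auto
        then show ?thesis
          unfolding G_def exp_add[symmetric]
          by (intro mult_right_mono) (auto simp: algebra_simps)
      qed
      finally show ?case by simp
    next
      case (Suc k)
      define m where "m = n + k"
      define P where "P = closest_point (F i m) w"
      define S where "S = (\<Sum>l<k. q ^ l)"
      have P: "P \<in> F i m"
        unfolding P_def by (rule closest_point_subspace[OF subspace_tail_space])
      have "w = P + (\<Sum>j\<in>{1..<i}. (w \<bullet> e m j) *\<^sub>R e m j)"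
        unfolding P_def using i by (simp add: closest_point_tail_space[OF orthonormal_e])
      then have "A n *v w = A n *v (P + (\<Sum>j\<in>{1..<i}. (w \<bullet> e m j) *\<^sub>R e m j))"
        by (rule arg_cong)
      also have "\<dots> = A n *v P + (\<Sum>j\<in>{1..<i}. (w \<bullet> e m j) *\<^sub>R (A n *v e m j))"
        by (simp only: matrix_vector_right_distrib matrix_vector_mult_sum)
      finally have eq: "A n *v w = \<dots>" .
      have "norm (A n *v w)
          \<le> norm (A n *v P) + (\<Sum>j\<in>{1..<i}. norm ((w \<bullet> e m j) *\<^sub>R (A n *v e m j)))"
        unfolding eq by (rule norm_triangle_mono[OF order_refl norm_sum])
      also have "\<dots> \<le> G * (exp (2 * C) + d * C0 * D * S) * norm w
          + (\<Sum>j\<in>{1..<i}. C0 * D * q ^ k * G * norm w)"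
      proof (intro add_mono sum_mono)
        have "norm (A n *v P) \<le> G * (exp (2 * C) + d * C0 * D * S) * norm P"
          using Suc.IH[of P] P by (simp add: m_def S_def)
        also have "\<dots> \<le> G * (exp (2 * C) + d * C0 * D * S) * norm w"
          unfolding P_def S_def using pos q
          by (intro mult_left_mono norm_closest_point_le subspace_tail_space mult_nonneg_nonneg
              add_nonneg_nonneg sum_nonneg) auto
        finally show "norm (A n *v P) \<le> G * (exp (2 * C) + d * C0 * D * S) * norm w" .
        fix j assume "j \<in> {1..<i}"
        then have j: "1 \<le> j" "j < i" by auto
        define g where "g = lam j - lam i"
        have g: "20 * \<epsilon> < g"
          unfolding g_def using True i j by (intro regular_gap) auto
        have "\<bar>w \<bullet> e m j\<bar> \<le> C0 * exp (- real m * (g - 4 * \<epsilon>)) * norm w"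
          unfolding C0_def g_def using Suc.prems j i by (intro coordinate_bound_down) (auto simp: m_def)
        moreover have "norm (A n *v e m j) \<le> D * exp (real n * (lam j + (4 * real j - 2) * \<epsilon>))"
        proof -
          have "norm (A n *v e m j)
              \<le> growth_const CARD('n) C rate j * exp (real n * (lam j + (4 * real j - 2) * \<epsilon>)) * norm (e m j)"
          proof (rule less.IH)
            show "e m j \<in> F j m"
              unfolding tail_space_def
            proof (intro CollectI ballI)
              fix l assume "l \<in> {1..<j}"
              then have "l \<in> {1..CARD('n)}" "j \<in> {1..CARD('n)}" "l \<noteq> j"
                using j i by auto
              then show "e m j \<bullet> e m l = 0"
                using orthonormal_family_inner[OF orthonormal_e, of j l m] by simp
            qed
          qed (use j i in \<open>auto simp: m_def\<close>)
          also have "norm (e m j) = 1"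
            using j i by (intro orthonormal_family_norm[OF orthonormal_e]) auto
          also have "growth_const CARD('n) C rate j * exp (real n * (lam j + (4 * real j - 2) * \<epsilon>)) * 1
              \<le> D * exp (real n * (lam j + (4 * real j - 2) * \<epsilon>))"
            unfolding D_def using j by (simp add: growth_mono)
          finally show ?thesis .
        qed
        ultimately have "norm ((w \<bullet> e m j) *\<^sub>R (A n *v e m j))
            \<le> (C0 * exp (- real m * (g - 4 * \<epsilon>)) * norm w)
              * (D * exp (real n * (lam j + (4 * real j - 2) * \<epsilon>)))"
          unfolding norm_scaleR using pos by (intro mult_mono) auto
        also have "\<dots> = C0 * D * exp (- real m * (g - 4 * \<epsilon>)
              + real n * (lam j + (4 * real j - 2) * \<epsilon>)) * norm w"
          unfolding exp_add by simp
        also have "\<dots> \<le> C0 * D * exp (real k * (- 16 * \<epsilon>)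
              + real n * (lam i + (4 * real i - 2) * \<epsilon>)) * norm w"
        proof -
          have "real k * (16 * \<epsilon>) \<le> real k * (g - 4 * \<epsilon>)"
            using g by (intro mult_left_mono) auto
          \<comment> \<open>The loss of 4 \<epsilon> in the coordinate estimate turns 4 j - 2 into 4
            j + 2, which is at most 4 i - 2 as j < i. The remaining k units of time provide the
            factor q^k.\<close>
          moreover have "real n * \<epsilon> * (4 * real j + 2) \<le> real n * \<epsilon> * (4 * real i - 2)"
            using j eps_pos by (intro mult_left_mono) auto
          moreover have "lam j = g + lam i"
            by (simp add: g_def)
          ultimately have "- real m * (g - 4 * \<epsilon>) + real n * (lam j + (4 * real j - 2) * \<epsilon>)
              \<le> real k * (- 16 * \<epsilon>) + real n * (lam i + (4 * real i - 2) * \<epsilon>)"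
            by (simp add: m_def algebra_simps)
          then show ?thesis
            using pos by (intro mult_right_mono mult_left_mono) auto
        qed
        also have "\<dots> = C0 * D * q ^ k * G * norm w"
          unfolding q_def G_def exp_add exp_of_nat_mult by simp
        finally show "norm ((w \<bullet> e m j) *\<^sub>R (A n *v e m j)) \<le> C0 * D * q ^ k * G * norm w" .
      qed
      also have "(\<Sum>j\<in>{1..<i}. C0 * D * q ^ k * G * norm w)
          \<le> d * (C0 * D * q ^ k * G * norm w)"
      proof -
        have "real (i - 1) * (C0 * D * q ^ k * G * norm w) \<le> d * (C0 * D * q ^ k * G * norm w)"
          unfolding d_def using i pos q by (intro mult_right_mono) auto
        then show ?thesis by simp
      qed
      finally show ?case
        by (simp add: S_def algebra_simps)
    qed
    from this[of w "m - n"] have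
      "norm (A n *v w) \<le> G * (exp (2 * C) + d * C0 * D * (\<Sum>l<m - n. q ^ l)) * norm w"
      using less.prems by simp
    also have "\<dots> \<le> G * growth_const CARD('n) C rate i * norm w"
    proof -
      \<comment> \<open>Since exp(2 C) \<le> D, the initial term is absorbed and the constant grows
        from one level to the next by the factor 1 + d \<open>rate\<close>.\<close>
      have "(\<Sum>l<m - n. q ^ l) \<le> 1 / (1 - q)"
        using q by (simp add: sum_gp_strict divide_right_mono)
      then have "d * C0 * D * (\<Sum>l<m - n. q ^ l) \<le> d * C0 * D * (1 / (1 - q))"
        using pos by (intro mult_left_mono) auto
      also have "\<dots> = d * rate * D"
        by (simp add: rate_const_def C0_def q_def)
      finally have "exp (2 * C) + d * C0 * D * (\<Sum>l<m - n. q ^ l) \<le> D + d * rate * D"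
        using growth_ge[of "i - 1"] by (simp add: D_def)
      also have "\<dots> = growth_const CARD('n) C rate (Suc (i - 1))"
        by (simp add: D_def d_def growth_const_def algebra_simps)
      finally show ?thesis
        using pos i by (intro mult_right_mono mult_left_mono) auto
    qed
    finally show ?thesis
      by (simp add: G_def mult_ac)
  qed
qed

text \<open>The bound on tails does not depend on the later time \<open>m\<close>, so it survives
  the limit in \<open>m\<close> with \<open>n\<close> fixed.\<close>

lemma growth_bound:
  assumes p: "regular_index CARD('n) lam p" "p \<le> CARD('n)" and v: "v \<in> limit_space p"
  shows "norm (A n *v v)
    \<le> growth_const CARD('n) C rate CARD('n) * exp (real n * lam p + 4 * real CARD('n) * \<epsilon> * real n) * norm v"
proof (rule LIMSEQ_le_const2)
  define u where "u = (\<lambda>m. closest_point (F p m) v)"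
  have "u \<longlonglongrightarrow> v"
    using closest_point_tendsto_limit_space[OF p(1), of v] v by (simp add: u_def closest_point_self)
  then show "(\<lambda>m. norm (A n *v u m)) \<longlonglongrightarrow> norm (A n *v v)"
    by (intro tendsto_norm bounded_linear.tendsto[OF matrix_vector_mul_bounded_linear])
  have "norm (A n *v u m) \<le> growth_const CARD('n) C rate CARD('n) * exp (real n * lam p + 4 * real CARD('n) * \<epsilon> * real n) * norm v"
    if "n \<le> m" for m
  proof -
    have "norm (A n *v u m)
        \<le> growth_const CARD('n) C rate p * exp (real n * (lam p + (4 * real p - 2) * \<epsilon>)) * norm (u m)"
      using p that unfolding u_def
      by (intro growth_bound_tail[of p n m] closest_point_subspace(1) subspace_tail_space)
        (auto simp: regular_index_def)
    also have "\<dots> \<le> growth_const CARD('n) C rate CARD('n) * exp (real n * lam p + 4 * real CARD('n) * \<epsilon> * real n) * norm v"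
    proof (intro mult_mono growth_mono p)
      have "real n * \<epsilon> * (4 * real p - 2) \<le> real n * \<epsilon> * (4 * real CARD('n))"
        using p eps_pos by (intro mult_left_mono) auto
      then show "exp (real n * (lam p + (4 * real p - 2) * \<epsilon>))
          \<le> exp (real n * lam p + 4 * real CARD('n) * \<epsilon> * real n)"
        by (simp add: algebra_simps)
      show "norm (u m) \<le> norm v"
        unfolding u_def by (rule norm_closest_point_le[OF subspace_tail_space])
    qed (use less_imp_le[OF growth_pos] in auto)
    finally show ?thesis .
  qed
  then show "\<exists>N. \<forall>m\<ge>N. norm (A n *v u m)
      \<le> growth_const CARD('n) C rate CARD('n) * exp (real n * lam p + 4 * real CARD('n) * \<epsilon> * real n) * norm v"
    by blast
qed

text \<open>From time \<open>m0\<close> on the tail is within \<open>\<kappa>\<close> of its limit,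
  so \<open>v\<close> keeps an off-tail part of size at least \<open>\<kappa>\<close> norm v,
  stretched by \<open>s (p - 1)\<close>. At earlier times the smallest singular value is used, and
  the difference of exponents, at most 2 R, costs the factor exp(- 2 m0 R).\<close>

lemma lower_bound_transversal:
  assumes p: "regular_index CARD('n) lam p" "2 \<le> p" and \<kappa>: "0 < \<kappa>" "\<kappa> \<le> 1"
    and close: "\<And>n. m0 \<le> n \<Longrightarrow> 2 * real CARD('n) * rate * exp (- 16 * \<epsilon>) ^ n \<le> \<kappa>"
    and far: "2 * \<kappa> * norm v \<le> norm (v - closest_point (limit_space p) v)"
  shows "\<kappa> * exp (- 2 * C - 2 * real m0 * R) * exp (real n * lam (p - 1) - 2 * real n * \<epsilon>) * norm v
    \<le> norm (A n *v v)"
proof -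
  let ?i = "p - 1"
  have pd: "p \<le> Suc CARD('n)"
    using p by (auto simp: regular_index_def)
  then have i: "?i \<in> {1..CARD('n)}"
    using p by auto
  then have R: "0 \<le> R"
    using lam_bound[OF i] by linarith
  show ?thesis
  proof (cases "m0 \<le> n")
    case True
    have "norm (v - closest_point (limit_space p) v)
        \<le> norm (v - closest_point (F p n) v)
          + norm (closest_point (F p n) v - closest_point (limit_space p) v)"
      by (metis add_diff_eq diff_add_cancel norm_triangle_ineq)
    also have "\<dots> \<le> norm (v - closest_point (F p n) v) + \<kappa> * norm v"
      using limit_space(3)[OF p(1), of n v] mult_right_mono[OF close[OF True] norm_ge_zero[of v]]
      by linarith
    finally have \<kappa>v: "\<kappa> * norm v \<le> norm (v - closest_point (F p n) v)"
      using far by linarith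
    have "\<kappa> * exp (- 2 * C - 2 * real m0 * R) * exp (real n * lam ?i - 2 * real n * \<epsilon>) * norm v
        = exp (- 2 * C - 2 * real m0 * R) * exp (real n * lam ?i - 2 * real n * \<epsilon>) * (\<kappa> * norm v)"
      by simp
    also have "\<dots> \<le> exp (real n * lam ?i - 2 * C - 2 * real n * \<epsilon>) * (\<kappa> * norm v)"
      unfolding exp_add[symmetric] using R \<kappa> by (intro mult_right_mono) auto
    also have "\<dots> \<le> s n ?i * norm (v - closest_point (F p n) v)"
      using singular_value_ge[OF i] \<kappa>v \<kappa> singular_frame_pos[OF frame i, of n] by (intro mult_mono) auto
    also have "\<dots> \<le> norm (A n *v v)"
      using p pd by (intro singular_frame_tail_lower[OF frame])
    finally show ?thesis .
  next
    case False
    let ?d = "CARD('n)"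
    have d: "?d \<in> {1..?d}"
      using i by simp
    \<comment> \<open>The tail at d + 1 is \<open>{0}\<close>, so the lower tail estimate bounds the
      stretching of the whole vector by \<open>s d\<close>.\<close>
    have "closest_point (F (Suc ?d) n) v = 0"
      using orthonormal_family_expand[OF orthonormal_e, of v n]
      by (simp add: closest_point_tail_space[OF orthonormal_e] atLeastLessThanSuc_atLeastAtMost)
    then have "s n ?d * norm v \<le> norm (A n *v v)"
      using singular_frame_tail_lower[OF frame, of "Suc ?d" n v] i by simp
    moreover have "\<kappa> * exp (- 2 * C - 2 * real m0 * R) * exp (real n * lam ?i - 2 * real n * \<epsilon>) * norm v
        \<le> 1 * exp (real n * lam ?d - 2 * C - 2 * real n * \<epsilon>) * norm v"
    proof (rule mult_right_mono)
      have "lam ?i - lam ?d \<le> 2 * R"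
        using lam_bound[OF i] lam_bound[OF d] by linarith
      then have "real n * (lam ?i - lam ?d) \<le> real n * (2 * R)"
        by (intro mult_left_mono) auto
      also have "\<dots> \<le> real m0 * (2 * R)"
        using False R by (intro mult_right_mono) auto
      finally have "exp (- 2 * C - 2 * real m0 * R + (real n * lam ?i - 2 * real n * \<epsilon>))
          \<le> exp (real n * lam ?d - 2 * C - 2 * real n * \<epsilon>)"
        by (simp add: algebra_simps)
      with \<kappa> have "\<kappa> * exp (- 2 * C - 2 * real m0 * R + (real n * lam ?i - 2 * real n * \<epsilon>))
          \<le> 1 * exp (real n * lam ?d - 2 * C - 2 * real n * \<epsilon>)"
        by (intro mult_mono) auto
      then show "\<kappa> * exp (- 2 * C - 2 * real m0 * R) * exp (real n * lam ?i - 2 * real n * \<epsilon>)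
          \<le> 1 * exp (real n * lam ?d - 2 * C - 2 * real n * \<epsilon>)"
        unfolding exp_add by (simp only: mult.assoc)
    qed simp
    moreover have "1 * exp (real n * lam ?d - 2 * C - 2 * real n * \<epsilon>) * norm v \<le> s n ?d * norm v"
      using singular_value_ge[OF d] by (simp add: mult_right_mono)
    ultimately show ?thesis
      by linarith
  qed
qed

text \<open>The errors of the two singular values total 4 C + 4 n \<epsilon>, while the exponents
  are 20 n \<epsilon> apart; the rest, 16 n \<epsilon>, must exceed 4 C.\<close>

lemma singular_gap:
  assumes p: "regular_index CARD('n) lam p" and n: "C < 4 * \<epsilon> * real n"
  shows "p = 1 \<or> p = Suc CARD('n) \<or> s n p < s n (p - 1)"
proof (cases "p = 1 \<or> p = Suc CARD('n)")
  case False
  then have p': "2 \<le> p" "p \<le> CARD('n)"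
    using p by (auto simp: regular_index_def)
  then have ix: "p \<in> {1..CARD('n)}" "p - 1 \<in> {1..CARD('n)}"
    by auto
  have "20 * \<epsilon> < lam (p - 1) - lam p"
    using p' by (intro regular_gap p) auto
  then have "real n * (20 * \<epsilon>) \<le> real n * (lam (p - 1) - lam p)"
    by (intro mult_left_mono) auto
  then have "real n * lam p + 2 * C + 2 * real n * \<epsilon> < real n * lam (p - 1) - 2 * C - 2 * real n * \<epsilon>"
    using n by (simp add: algebra_simps)
  then have "exp (real n * lam p + 2 * C + 2 * real n * \<epsilon>) < exp (real n * lam (p - 1) - 2 * C - 2 * real n * \<epsilon>)"
    by simp
  then show ?thesis
    using singular_value_le[OF ix(1), of n] singular_value_ge[OF ix(2), of n] by linarith
qed auto

lemma contracted:
  assumes p: "regular_index CARD('n) lam p" and n: "C < 4 * \<epsilon> * real n"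
  shows "contracted_well_defined (A n) (Suc CARD('n) - p)"
    "contracted_subspace (A n) (Suc CARD('n) - p) = F p n"
  using contracted_well_defined_gap[OF frame singular_gap[OF assms]]
    contracted_subspace_gap[OF frame singular_gap[OF assms]] p
  by (auto simp: regular_index_def)

end

section \<open>Transversality of forward and backward limits\<close>

text \<open>Backward in time the exponents are negated and reversed. The tail at d + 2 - p has
  dimension p - 1, so it is the backward space with index < p, and it sits at the same gap.\<close>

lemma regular_index_reflect:
  assumes "p \<in> {1..Suc d}"
  shows "regular_index d (\<lambda>k. - lam (Suc d - k)) (Suc (Suc d) - p) \<longleftrightarrow> regular_index d lam p"
proof -
  have "Suc d - (Suc (Suc d) - p) = p - 1" "Suc d - (Suc (Suc d) - p - 1) = p"
    using assms by auto
  then show ?thesis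
    using assms by (auto simp: regular_index_def)
qed

text \<open>By monotonicity the indices with exponent \<open>lam i\<close> form an interval that
  starts at \<open>i\<close>. Just after it comes the next gap, or d + 1.\<close>

lemma exp_mult_next_index:
  assumes mono: "\<And>i j. 1 \<le> i \<Longrightarrow> i \<le> j \<Longrightarrow> j \<le> d \<Longrightarrow> lam j \<le> lam i"
    and i: "i \<in> exp_indices d lam"
  shows "1 \<le> exp_mult d lam i" "i + exp_mult d lam i \<le> Suc d"
    "lam (i + exp_mult d lam i - 1) = lam i" "regular_index d lam (i + exp_mult d lam i)"
proof -
  define S where "S = {j\<in>{1..d}. lam j = lam i}"
  define m where "m = Max S"
  have i': "1 \<le> i" "i \<le> d" "i = 1 \<or> lam i < lam (i - 1)"
    using i by (auto simp: exp_indices_def)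
  have S: "finite S" "i \<in> S"
    using i' by (auto simp: S_def)
  then have m: "m \<in> S" "\<And>j. j \<in> S \<Longrightarrow> j \<le> m"
    unfolding m_def by (auto intro: Max_in)
  have "S = {i..m}"
  proof (intro equalityI subsetI)
    fix j assume j: "j \<in> S"
    have "i \<le> j"
    proof (rule ccontr)
      assume "\<not> i \<le> j"
      then have "1 \<le> j" "j \<le> i - 1" "i - 1 \<le> d" "i \<noteq> 1"
        using j i' by (auto simp: S_def)
      then have "lam (i - 1) \<le> lam j" "lam i < lam (i - 1)"
        using i' mono by auto
      then show False
        using j by (simp add: S_def)
    qed
    then show "j \<in> {i..m}"
      using m(2)[OF j] by simp
  next
    fix j assume j: "j \<in> {i..m}"
    then have "j \<le> d"
      using m(1) by (auto simp: S_def)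
    then have "lam j \<le> lam i"
      using j i' by (intro mono) auto
    moreover have "lam m \<le> lam j"
      using j i' m(1) by (intro mono) (auto simp: S_def)
    ultimately show "j \<in> S"
      using j i' \<open>j \<le> d\<close> m(1) by (auto simp: S_def)
  qed
  then have card: "exp_mult d lam i = Suc m - i"
    by (simp add: exp_mult_def S_def)
  have im: "i \<le> m" "m \<le> d" "lam m = lam i"
    using m S by (auto simp: S_def)
  show "1 \<le> exp_mult d lam i" "i + exp_mult d lam i \<le> Suc d"
    "lam (i + exp_mult d lam i - 1) = lam i"
    using im card by auto
  have "m = d \<or> lam (Suc m) < lam m"
  proof (rule ccontr)
    assume *: "\<not> (m = d \<or> lam (Suc m) < lam m)"
    then have "Suc m \<le> d" "lam (Suc m) \<le> lam m"
      using im i' by (auto intro!: mono)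
    then have "Suc m \<in> S"
      using * im by (auto simp: S_def)
    then show False
      using m(2)[of "Suc m"] by simp
  qed
  then show "regular_index d lam (i + exp_mult d lam i)"
    using im card i' by (auto simp: regular_index_def)
qed

text \<open>The angle bounds the inner product from above only; replacing \<open>u\<close> by
  \<open>- u\<close> gives the absolute value. The minimum with pi / 2 keeps the cosine in its
  monotone, nonnegative range however large \<rho> is.\<close>

lemma subspace_angle_inner_le:
  fixes V W :: "(real^'n) set"
  assumes angle: "ereal \<rho> \<le> subspace_angle V W" and \<rho>: "0 < \<rho>"
    and V: "subspace V" and u: "u \<in> V" and w: "w \<in> W"
  shows "\<bar>u \<bullet> w\<bar> \<le> cos (min \<rho> (pi / 2)) * (norm u * norm w)"
proof -
  have le: "x \<bullet> w \<le> cos (min \<rho> (pi / 2)) * (norm x * norm w)" if x: "x \<in> V" for x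
  proof (cases "x = 0 \<or> w = 0")
    case False
    then have nz: "x \<noteq> 0" "w \<noteq> 0" by auto
    define t where "t = x \<bullet> w / (norm x * norm w)"
    have pos: "0 < norm x * norm w"
      using nz by simp
    have "\<bar>x \<bullet> w\<bar> \<le> norm x * norm w"
      by (rule Cauchy_Schwarz_ineq2)
    then have "x \<bullet> w \<le> norm x * norm w" "- (norm x * norm w) \<le> x \<bullet> w"
      by auto
    then have t: "- 1 \<le> t" "t \<le> 1"
      using pos by (auto simp: t_def pos_divide_le_eq pos_le_divide_eq)
    have "subspace_angle V W \<le> ereal (arccos t)"
      unfolding subspace_angle_def t_def using x w nz by (intro INF_lower2) auto
    then have "ereal \<rho> \<le> ereal (arccos t)"
      using angle by (rule order_trans[rotated])
    then have "cos (arccos t) \<le> cos (min \<rho> (pi / 2))"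
      using \<rho> t arccos_lbound[of t] arccos_ubound[of t] by (intro cos_monotone_0_pi_le) auto
    then have "t \<le> cos (min \<rho> (pi / 2))"
      using t by (simp add: cos_arccos)
    then show ?thesis
      using pos by (simp add: t_def pos_divide_le_eq)
  qed auto
  show ?thesis
    using le[OF u] le[of "- u"] V u by (auto simp: subspace_neg abs_le_iff)
qed

text \<open>Replacing each vector by its projection to the nearby subspace costs
  \<open>\<kappa>\<close> once for \<open>u\<close> and once for \<open>w\<close>.\<close>

lemma subspace_inner_perturb:
  fixes V W V' W' :: "'a::euclidean_space set"
  assumes sub: "subspace V" "subspace W"
    and \<gamma>: "\<And>u w. u \<in> V \<Longrightarrow> w \<in> W \<Longrightarrow> \<bar>u \<bullet> w\<bar> \<le> \<gamma> * (norm u * norm w)" "0 \<le> \<gamma>"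
    and V': "\<And>v. norm (closest_point V v - closest_point V' v) \<le> \<kappa> * norm v"
    and W': "\<And>v. norm (closest_point W v - closest_point W' v) \<le> \<kappa> * norm v"
    and \<kappa>: "0 \<le> \<kappa>" and u: "u \<in> V'" and w: "w \<in> W'"
  shows "\<bar>u \<bullet> w\<bar> \<le> (\<gamma> + 2 * \<kappa>) * (norm u * norm w)"
proof -
  define u' where "u' = closest_point V u"
  define w' where "w' = closest_point W w"
  have nu: "norm u' \<le> norm u" "norm (u - u') \<le> \<kappa> * norm u"
    using norm_closest_point_le(1)[OF sub(1), of u] V'[of u] u
    by (auto simp: u'_def closest_point_self norm_minus_commute)
  have nw: "norm w' \<le> norm w" "norm (w - w') \<le> \<kappa> * norm w"
    using norm_closest_point_le(1)[OF sub(2), of w] W'[of w] w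
    by (auto simp: w'_def closest_point_self norm_minus_commute)
  have "\<bar>u' \<bullet> w'\<bar> \<le> \<gamma> * (norm u' * norm w')"
    unfolding u'_def w'_def by (intro \<gamma> closest_point_subspace sub)
  also have "\<dots> \<le> \<gamma> * (norm u * norm w)"
    using nu nw \<gamma>(2) by (intro mult_left_mono mult_mono) auto
  finally have 1: "\<bar>u' \<bullet> w'\<bar> \<le> \<gamma> * (norm u * norm w)" .
  have "\<bar>(u - u') \<bullet> w\<bar> \<le> norm (u - u') * norm w"
    by (rule Cauchy_Schwarz_ineq2)
  also have "\<dots> \<le> \<kappa> * norm u * norm w"
    using nu by (intro mult_right_mono) auto
  finally have 2: "\<bar>(u - u') \<bullet> w\<bar> \<le> \<kappa> * (norm u * norm w)"
    by (simp add: mult.assoc)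
  have "\<bar>u' \<bullet> (w - w')\<bar> \<le> norm u' * norm (w - w')"
    by (rule Cauchy_Schwarz_ineq2)
  also have "\<dots> \<le> norm u * (\<kappa> * norm w)"
    using nu nw by (intro mult_mono) auto
  finally have 3: "\<bar>u' \<bullet> (w - w')\<bar> \<le> \<kappa> * (norm u * norm w)"
    by (simp add: mult_ac)
  have "u \<bullet> w = u' \<bullet> w' + (u - u') \<bullet> w + u' \<bullet> (w - w')"
    by (simp add: inner_diff_left inner_diff_right)
  then have "\<bar>u \<bullet> w\<bar> \<le> \<gamma> * (norm u * norm w) + \<kappa> * (norm u * norm w) + \<kappa> * (norm u * norm w)"
    using 1 2 3 by linarith
  also have "\<dots> = (\<gamma> + 2 * \<kappa>) * (norm u * norm w)"
    by (simp only: distrib_right mult_2)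
  finally show ?thesis .
qed

text \<open>Testing the hypothesis on the projection of \<open>v\<close> itself bounds that
  projection by \<gamma> norm v.\<close>

lemma norm_off_closest_point_ge:
  fixes V :: "'a::euclidean_space set"
  assumes V: "subspace V" and v: "\<And>u. u \<in> V \<Longrightarrow> \<bar>u \<bullet> v\<bar> \<le> \<gamma> * (norm u * norm v)" and \<gamma>: "0 \<le> \<gamma>"
  shows "(1 - \<gamma>) * norm v \<le> norm (v - closest_point V v)"
proof -
  define y where "y = closest_point V v"
  have y: "y \<in> V"
    unfolding y_def by (rule closest_point_subspace[OF V])
  have "norm y * norm y = y \<bullet> y"
    by (simp add: norm_eq_sqrt_inner)
  also have "\<dots> = y \<bullet> v"
    using closest_point_subspace(2)[OF V y, of v] by (simp add: y_def inner_diff_left inner_diff_right inner_commute)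
  also have "\<dots> \<le> (\<gamma> * norm v) * norm y"
    using v[OF y] by (simp add: mult_ac)
  finally have "norm y \<le> \<gamma> * norm v"
    using \<gamma> by (cases "y = 0") auto
  moreover have "norm v \<le> norm (v - y) + norm y"
    using norm_triangle_ineq[of "v - y" y] by simp
  ultimately show ?thesis
    by (simp add: y_def algebra_simps)
qed

text \<open>The budget for \<open>\<kappa>\<close>: a margin of 4 \<open>\<kappa>\<close> at one
  time \<open>m\<close>, of which 2 \<open>\<kappa>\<close> is spent in passing to the two limits;
  the remaining 2 \<open>\<kappa>\<close> is what \<open>lower_bound_transversal\<close> asks
  for.\<close>

locale pesin_pair =
  fwd: pesin_sequence A lam K C \<epsilon> R e s +
  bwd: pesin_sequence B "\<lambda>k. - lam (Suc CARD('n) - k)" K C \<epsilon> R e' s'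
  for A B :: "nat \<Rightarrow> real^'n^'n" and lam :: "nat \<Rightarrow> real" and K C \<epsilon> R :: real
    and e e' :: "nat \<Rightarrow> nat \<Rightarrow> real^'n" and s s' :: "nat \<Rightarrow> nat \<Rightarrow> real" +
  fixes \<kappa> :: real and m0 :: nat
  assumes \<kappa>_pos: "0 < \<kappa>" and \<kappa>_le: "4 * \<kappa> \<le> 1"
    and m0_close: "\<And>n. m0 \<le> n \<Longrightarrow>
      2 * real CARD('n) * rate_const K C \<epsilon> R * exp (- 16 * \<epsilon>) ^ n \<le> \<kappa>"
    and transversal: "\<And>i. i \<in> exp_indices CARD('n) lam \<Longrightarrow> \<exists>m\<ge>m0.
      \<forall>u\<in>tail_space (e m) i. \<forall>w\<in>tail_space (e' m) (Suc (Suc CARD('n)) - i).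
        \<bar>u \<bullet> w\<bar> \<le> (1 - 4 * \<kappa>) * (norm u * norm w)"
begin

abbreviation U :: "nat \<Rightarrow> (real^'n) set" where
  "U i \<equiv> fwd.limit_space i"

text \<open>The limit of the backward spaces with index < i, of dimension i - 1. The limit of those
  with index \<le> i is therefore \<open>W\<close> at i + \<open>exp_mult\<close> i, the start of
  the next block.\<close>

abbreviation W :: "nat \<Rightarrow> (real^'n) set" where
  "W i \<equiv> bwd.limit_space (Suc (Suc CARD('n)) - i)"

lemma regular_W:
  assumes "regular_index CARD('n) lam i"
  shows "regular_index CARD('n) (\<lambda>k. - lam (Suc CARD('n) - k)) (Suc (Suc CARD('n)) - i)"
  using assms regular_index_reflect[of i "CARD('n)" lam] by (auto simp: regular_index_def)

lemma subspace_U: "regular_index CARD('n) lam i \<Longrightarrow> subspace (U i)"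
  by (rule fwd.limit_space)

lemma subspace_W: "regular_index CARD('n) lam i \<Longrightarrow> subspace (W i)"
  by (rule bwd.limit_space[OF regular_W])

lemma dim_U: "regular_index CARD('n) lam i \<Longrightarrow> dim (U i) = Suc CARD('n) - i"
  by (rule fwd.limit_space)

lemma dim_W: "regular_index CARD('n) lam i \<Longrightarrow> dim (W i) = i - 1"
  using bwd.limit_space(2)[OF regular_W, of i] by (auto simp: regular_index_def)

lemma U_W_inner:
  assumes i: "regular_index CARD('n) lam i" and u: "u \<in> U i" and w: "w \<in> W i"
  shows "\<bar>u \<bullet> w\<bar> \<le> (1 - 2 * \<kappa>) * (norm u * norm w)"
\<comment> \<open>The index d + 1 does not belong to \<open>exp_indices\<close>, so
  \<open>transversal\<close> says nothing there, but then \<open>U i\<close> is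
  \<open>{0}\<close>.\<close>
proof (cases "i = Suc CARD('n)")
  case True
  then have "dim (U i) = 0"
    using dim_U[OF i] by simp
  then have "u = 0"
    using u unfolding dim_eq_0 by auto
  then show ?thesis by simp
next
  case False
  then have "i \<in> exp_indices CARD('n) lam"
    using i by (auto simp: exp_indices_def regular_index_def)
  then obtain m where m: "m0 \<le> m" and
    t: "\<And>u w. u \<in> fwd.F i m \<Longrightarrow> w \<in> bwd.F (Suc (Suc CARD('n)) - i) m
      \<Longrightarrow> \<bar>u \<bullet> w\<bar> \<le> (1 - 4 * \<kappa>) * (norm u * norm w)"
    using transversal by blast
  have "\<bar>u \<bullet> w\<bar> \<le> (1 - 4 * \<kappa> + 2 * \<kappa>) * (norm u * norm w)"
  proof (rule subspace_inner_perturb[OF subspace_tail_space subspace_tail_space t])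
    show "norm (closest_point (fwd.F i m) v - closest_point (U i) v) \<le> \<kappa> * norm v" for v
      using fwd.limit_space(3)[OF i, of m v] mult_right_mono[OF m0_close[OF m] norm_ge_zero[of v]]
      by linarith
    show "norm (closest_point (bwd.F (Suc (Suc CARD('n)) - i) m) v - closest_point (W i) v)
        \<le> \<kappa> * norm v" for v
      using bwd.limit_space(3)[OF regular_W[OF i], of m v]
        mult_right_mono[OF m0_close[OF m] norm_ge_zero[of v]]
      by linarith
  qed (use u w \<kappa>_pos \<kappa>_le in auto)
  then show ?thesis
    by simp
qed

lemma U_far_from_W:
  assumes i: "regular_index CARD('n) lam i" and u: "u \<in> U i"
  shows "2 * \<kappa> * norm u \<le> norm (u - closest_point (W i) u)"
  using norm_off_closest_point_ge[OF subspace_W[OF i], of u "1 - 2 * \<kappa>"] U_W_inner[OF i u] \<kappa>_le \<kappa>_pos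
  by (simp add: inner_commute mult_ac)

lemma W_far_from_U:
  assumes i: "regular_index CARD('n) lam i" and w: "w \<in> W i"
  shows "2 * \<kappa> * norm w \<le> norm (w - closest_point (U i) w)"
  using norm_off_closest_point_ge[OF subspace_U[OF i], of w "1 - 2 * \<kappa>"] U_W_inner[OF i _ w] \<kappa>_le \<kappa>_pos
  by simp

lemma U_Int_W:
  assumes "regular_index CARD('n) lam i"
  shows "U i \<inter> W i = {0}"
proof -
  have "v = 0" if "v \<in> U i" "v \<in> W i" for v
    using W_far_from_U[OF assms that(2)] that(1) \<kappa>_pos by (simp add: closest_point_self mult_le_0_iff)
  then show ?thesis
    using subspace_U[OF assms] subspace_W[OF assms] by (auto simp: subspace_0)
qed

context
  fixes i assumes i: "i \<in> exp_indices CARD('n) lam"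
begin

lemma i_regular: "regular_index CARD('n) lam i"
  using i by (auto simp: exp_indices_def regular_index_def)

lemma i_range: "1 \<le> i" "i \<le> CARD('n)"
  using i by (auto simp: exp_indices_def)

lemma i_next:
  "1 \<le> exp_mult CARD('n) lam i" "i + exp_mult CARD('n) lam i \<le> Suc CARD('n)"
  "lam (i + exp_mult CARD('n) lam i - 1) = lam i"
  "regular_index CARD('n) lam (i + exp_mult CARD('n) lam i)"
  by (rule exp_mult_next_index[OF fwd.lam_antimono i]; assumption)+

text \<open>At least the multiplicity by counting dimensions in the whole space. At most, because
  the intersection lies in \<open>U i\<close>, hence meets \<open>W i\<close> trivially, and both
  lie in the larger \<open>W\<close>, which exceeds \<open>W i\<close> in dimension by exactly the
  multiplicity.\<close>

lemma dim_E: "dim (U i \<inter> W (i + exp_mult CARD('n) lam i)) = exp_mult CARD('n) lam i"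
proof -
  let ?E = "U i \<inter> W (i + exp_mult CARD('n) lam i)"
  note sub = subspace_U[OF i_regular] subspace_W[OF i_regular] subspace_W[OF i_next(4)]
  have "dim {x + y |x y. x \<in> U i \<and> y \<in> W (i + exp_mult CARD('n) lam i)} + dim ?E = dim (U i) + dim (W (i + exp_mult CARD('n) lam i))"
    by (rule dim_sums_Int[OF sub(1,3)])
  moreover have "dim {x + y |x y. x \<in> U i \<and> y \<in> W (i + exp_mult CARD('n) lam i)} \<le> CARD('n)"
    using dim_subset_UNIV[of "{x + y |x y. x \<in> U i \<and> y \<in> W (i + exp_mult CARD('n) lam i)}"] by simp
  ultimately have ge: "exp_mult CARD('n) lam i \<le> dim ?E"
    using dim_U[OF i_regular] dim_W[OF i_next(4)] i_range i_next(1,2) by linarith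
  have le: "W i \<subseteq> W (i + exp_mult CARD('n) lam i)"
    using i_next by (intro bwd.limit_space_antimono regular_W i_regular) auto
  have "?E \<inter> W i \<subseteq> {0}"
    using U_Int_W[OF i_regular] by auto
  then have "dim (?E \<inter> W i) = 0"
    by (simp add: dim_eq_0)
  moreover have "dim {x + y |x y. x \<in> ?E \<and> y \<in> W i} + dim (?E \<inter> W i) = dim ?E + dim (W i)"
    by (intro dim_sums_Int subspace_inter sub)
  moreover have "dim {x + y |x y. x \<in> ?E \<and> y \<in> W i} \<le> dim (W (i + exp_mult CARD('n) lam i))"
    using le sub(3) by (intro dim_subset) (auto intro: subspace_add)
  ultimately have "dim ?E + (i - 1) \<le> (i + exp_mult CARD('n) lam i) - 1"
    using dim_W[OF i_regular] dim_W[OF i_next(4)] by linarith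
  then have "dim ?E \<le> exp_mult CARD('n) lam i"
    using i_range i_next(1) by linarith
  with ge show ?thesis by simp
qed

text \<open>Membership in \<open>U i\<close> gives the upper bound. Membership in the larger
  \<open>W\<close> keeps \<open>v\<close> far from \<open>U\<close> at the next block, and the
  exponent just before that block is again \<open>lam i\<close>.\<close>

lemma fwd_bounds:
  assumes v: "v \<in> U i \<inter> W (i + exp_mult CARD('n) lam i)"
  shows "norm (A n *v v) \<le> growth_const CARD('n) C fwd.rate CARD('n)
      * exp (real n * lam i + 4 * real CARD('n) * \<epsilon> * real n) * norm v"
    "\<kappa> * exp (- 2 * C - 2 * real m0 * R) * exp (real n * lam i - 2 * real n * \<epsilon>) * norm v
      \<le> norm (A n *v v)"
proof -
  show "norm (A n *v v) \<le> growth_const CARD('n) C fwd.rate CARD('n)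
      * exp (real n * lam i + 4 * real CARD('n) * \<epsilon> * real n) * norm v"
    using v i_range by (intro fwd.growth_bound i_regular) auto
  have "\<kappa> * exp (- 2 * C - 2 * real m0 * R) * exp (real n * lam ((i + exp_mult CARD('n) lam i) - 1) - 2 * real n * \<epsilon>) * norm v
      \<le> norm (A n *v v)"
    using i_range i_next \<kappa>_pos \<kappa>_le m0_close W_far_from_U[OF i_next(4), of v] v
    by (intro fwd.lower_bound_transversal) auto
  then show "\<kappa> * exp (- 2 * C - 2 * real m0 * R) * exp (real n * lam i - 2 * real n * \<epsilon>) * norm v
      \<le> norm (A n *v v)"
    using i_next(3) by simp
qed

text \<open>The roles are exchanged: the larger \<open>W\<close> gives the upper bound and
  membership in \<open>U i\<close> keeps \<open>v\<close> far from \<open>W i\<close>. The reflected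
  indices lead in both cases to the exponent \<open>- lam i\<close>.\<close>

lemma bwd_bounds:
  assumes v: "v \<in> U i \<inter> W (i + exp_mult CARD('n) lam i)"
  shows "norm (B n *v v) \<le> growth_const CARD('n) C fwd.rate CARD('n)
      * exp (- real n * lam i + 4 * real CARD('n) * \<epsilon> * real n) * norm v"
    "\<kappa> * exp (- 2 * C - 2 * real m0 * R) * exp (- real n * lam i - 2 * real n * \<epsilon>) * norm v
      \<le> norm (B n *v v)"
proof -
  have "Suc CARD('n) - (Suc (Suc CARD('n)) - (i + exp_mult CARD('n) lam i)) = (i + exp_mult CARD('n) lam i) - 1"
    using i_next i_range by simp
  then have lam1: "lam (Suc CARD('n) - (Suc (Suc CARD('n)) - (i + exp_mult CARD('n) lam i))) = lam i"
    using i_next(3) by simp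
  have "norm (B n *v v) \<le> growth_const CARD('n) C fwd.rate CARD('n)
      * exp (real n * - lam (Suc CARD('n) - (Suc (Suc CARD('n)) - (i + exp_mult CARD('n) lam i)))
        + 4 * real CARD('n) * \<epsilon> * real n) * norm v"
    using v i_range i_next(1) by (intro bwd.growth_bound regular_W i_next(4)) auto
  then show "norm (B n *v v) \<le> growth_const CARD('n) C fwd.rate CARD('n)
      * exp (- real n * lam i + 4 * real CARD('n) * \<epsilon> * real n) * norm v"
    unfolding lam1 by simp
  have lam2: "Suc CARD('n) - (Suc (Suc CARD('n)) - i - 1) = i"
    using i_range by simp
  have "\<kappa> * exp (- 2 * C - 2 * real m0 * R)
      * exp (real n * - lam (Suc CARD('n) - (Suc (Suc CARD('n)) - i - 1)) - 2 * real n * \<epsilon>) * norm v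
      \<le> norm (B n *v v)"
    using i_range \<kappa>_pos \<kappa>_le m0_close U_far_from_W[OF i_regular, of v] v
    by (intro bwd.lower_bound_transversal regular_W i_regular) auto
  then show "\<kappa> * exp (- 2 * C - 2 * real m0 * R) * exp (- real n * lam i - 2 * real n * \<epsilon>) * norm v
      \<le> norm (B n *v v)"
    unfolding lam2 by simp
qed

end

end

section \<open>Cocycles\<close>

text \<open>Contracted subspaces are identified with tails only once the singular values have
  separated, so dimension and distance are controlled from \<open>m0\<close> on, which suffices for
  a limit.\<close>

lemma (in pesin_sequence) grassmannian_tendsto_limit_space:
  assumes p: "regular_index CARD('n) lam p" and m0: "\<And>n. m0 \<le> n \<Longrightarrow> C < 4 * \<epsilon> * real n"
  shows "grassmannian_tendsto (Suc CARD('n) - p)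
    (\<lambda>n. contracted_subspace (A n) (Suc CARD('n) - p)) (limit_space p)"
  unfolding grassmannian_tendsto_def
proof (intro conjI)
  show "limit_space p \<in> grassmannian (Suc CARD('n) - p)"
    using limit_space[OF p] by (simp add: grassmannian_def)
  have contr: "contracted_subspace (A n) (Suc CARD('n) - p) = F p n" if "m0 \<le> n" for n
    using contracted(2)[OF p m0[OF that]] .
  have "contracted_subspace (A n) (Suc CARD('n) - p) \<in> grassmannian (Suc CARD('n) - p)"
    if "m0 \<le> n" for n
    unfolding contr[OF that] grassmannian_def using p
    by (auto simp: subspace_tail_space regular_index_def intro!: dim_tail_space[OF orthonormal_e])
  then show "\<forall>\<^sub>F n in sequentially.
      contracted_subspace (A n) (Suc CARD('n) - p) \<in> grassmannian (Suc CARD('n) - p)"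
    unfolding eventually_sequentially by blast
  have "norm (subspace_dist (contracted_subspace (A n) (Suc CARD('n) - p)) (limit_space p))
      \<le> 2 * real CARD('n) * rate * exp (- 16 * \<epsilon>) ^ n" if "m0 \<le> n" for n
    unfolding contr[OF that]
    using subspace_dist_nonneg[OF subspace_tail_space[of "e n" p] limit_space(1)[OF p]]
      subspace_dist_le[OF limit_space(3)[OF p, of n]] by simp
  then have "\<forall>\<^sub>F n in sequentially.
      norm (subspace_dist (contracted_subspace (A n) (Suc CARD('n) - p)) (limit_space p))
      \<le> 2 * real CARD('n) * rate * exp (- 16 * \<epsilon>) ^ n"
    unfolding eventually_sequentially by blast
  then show "(\<lambda>n. subspace_dist (contracted_subspace (A n) (Suc CARD('n) - p)) (limit_space p))
      \<longlonglongrightarrow> 0"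
  proof (rule Lim_null_comparison)
    show "(\<lambda>n. 2 * real CARD('n) * rate * exp (- 16 * \<epsilon>) ^ n) \<longlonglongrightarrow> 0"
      using eps_pos by (auto intro!: tendsto_eq_intros LIMSEQ_power_zero)
  qed
qed

section \<open>Matrix inverses and the cocycle along an orbit\<close>

lemma matrix_inv_inverse:
  fixes G :: "real^'n^'n"
  assumes "invertible G"
  shows "G ** matrix_inv G = mat 1" "matrix_inv G ** G = mat 1"
  using someI_ex[OF assms[unfolded invertible_def]] unfolding matrix_inv_def by auto

lemma norm_mult_le_mnorm: "norm (G *v v) \<le> mnorm G * norm v"
  unfolding mnorm_def by (rule onorm[OF matrix_vector_mul_bounded_linear])

lemma norm_mult_comparable:
  fixes G A :: "real^'n^'n"
  assumes G: "invertible G" and K: "mnorm G \<le> K" "mnorm (matrix_inv G) \<le> K"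
  shows "norm ((G ** A) *v v) \<le> K * norm (A *v v)" "norm (A *v v) \<le> K * norm ((G ** A) *v v)"
proof -
  have "norm ((G ** A) *v v) \<le> mnorm G * norm (A *v v)"
    unfolding matrix_vector_mul_assoc[symmetric] by (rule norm_mult_le_mnorm)
  also have "\<dots> \<le> K * norm (A *v v)"
    using K by (intro mult_right_mono) auto
  finally show "norm ((G ** A) *v v) \<le> K * norm (A *v v)" .
  have "A *v v = matrix_inv G *v ((G ** A) *v v)"
    by (simp add: matrix_vector_mul_assoc matrix_mul_assoc matrix_inv_inverse[OF G])
  then have "norm (A *v v) \<le> mnorm (matrix_inv G) * norm ((G ** A) *v v)"
    using norm_mult_le_mnorm by metis
  also have "\<dots> \<le> K * norm ((G ** A) *v v)"
    using K by (intro mult_right_mono) auto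
  finally show "norm (A *v v) \<le> K * norm ((G ** A) *v v)" .
qed

lemma invertible_matrix_inv:
  fixes G :: "real^'n^'n"
  shows "invertible G \<Longrightarrow> invertible (matrix_inv G)"
  using matrix_inv_inverse[of G] unfolding invertible_def by blast

lemma matrix_inv_matrix_inv:
  fixes G :: "real^'n^'n"
  assumes "invertible G"
  shows "matrix_inv (matrix_inv G) = G"
  using matrix_inv_inverse[OF assms] matrix_inv_inverse[OF invertible_matrix_inv[OF assms]]
  by (metis matrix_mul_assoc matrix_mul_lid matrix_mul_rid)

lemma invertible_mat_1: "invertible (mat 1 :: real^'n^'n)"
  unfolding invertible_def by (metis matrix_mul_lid)

lemma cocycle_of_nat: "cocycle X T M (int n) x = cocycle_fwd T M n x"
  by (simp add: cocycle_def)

lemma cocycle_minus_of_nat: "cocycle X T M (- int n) x = cocycle_bwd X T M n x"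
  by (cases n) (simp_all add: cocycle_def del: of_nat_Suc)

lemma funpow_mem: "f ` S \<subseteq> S \<Longrightarrow> x \<in> S \<Longrightarrow> (f ^^ n) x \<in> S"
  by (induction n) auto

lemma cocycle_fwd_step:
  fixes M :: "'a \<Rightarrow> real^'n^'n"
  assumes M: "\<And>x. x \<in> X \<Longrightarrow> invertible (M x)"
    and K: "\<And>x. x \<in> X \<Longrightarrow> mnorm (M x) \<le> K \<and> mnorm (matrix_inv (M x)) \<le> K"
    and T: "T ` X \<subseteq> X" and x: "x \<in> X"
  shows "invertible (cocycle X T M (int n) x)"
    "norm (cocycle X T M (int (Suc n)) x *v v) \<le> K * norm (cocycle X T M (int n) x *v v)"
    "norm (cocycle X T M (int n) x *v v) \<le> K * norm (cocycle X T M (int (Suc n)) x *v v)"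
proof -
  have orbit: "(T ^^ n) x \<in> X" for n
    by (rule funpow_mem[OF T x])
  show "invertible (cocycle X T M (int n) x)"
    unfolding cocycle_of_nat
    by (induction n) (simp_all add: invertible_mat_1 invertible_mult M[OF orbit])
  show "norm (cocycle X T M (int (Suc n)) x *v v) \<le> K * norm (cocycle X T M (int n) x *v v)"
    "norm (cocycle X T M (int n) x *v v) \<le> K * norm (cocycle X T M (int (Suc n)) x *v v)"
    unfolding cocycle_of_nat cocycle_fwd.simps
    using norm_mult_comparable[OF M[OF orbit]] K[OF orbit] by blast+
qed

lemma cocycle_bwd_step:
  fixes M :: "'a \<Rightarrow> real^'n^'n"
  assumes M: "\<And>x. x \<in> X \<Longrightarrow> invertible (M x)"
    and K: "\<And>x. x \<in> X \<Longrightarrow> mnorm (M x) \<le> K \<and> mnorm (matrix_inv (M x)) \<le> K"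
    and T: "inv_into X T ` X \<subseteq> X" and x: "x \<in> X"
  shows "invertible (cocycle X T M (- int n) x)"
    "norm (cocycle X T M (- int (Suc n)) x *v v) \<le> K * norm (cocycle X T M (- int n) x *v v)"
    "norm (cocycle X T M (- int n) x *v v) \<le> K * norm (cocycle X T M (- int (Suc n)) x *v v)"
proof -
  have orbit: "(inv_into X T ^^ n) x \<in> X" for n
    by (rule funpow_mem[OF T x])
  note inv = invertible_matrix_inv[OF M[OF orbit]]
  have K': "mnorm (matrix_inv (M ((inv_into X T ^^ n) x))) \<le> K"
    "mnorm (matrix_inv (matrix_inv (M ((inv_into X T ^^ n) x)))) \<le> K" for n
    using K[OF orbit] by (simp_all add: matrix_inv_matrix_inv[OF M[OF orbit]])
  show "invertible (cocycle X T M (- int n) x)"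
    unfolding cocycle_minus_of_nat
  proof (induction n)
    case (Suc n)
    then show ?case
      unfolding cocycle_bwd.simps by (intro invertible_mult inv)
  qed (simp add: invertible_mat_1)
  show "norm (cocycle X T M (- int (Suc n)) x *v v) \<le> K * norm (cocycle X T M (- int n) x *v v)"
    "norm (cocycle X T M (- int n) x *v v) \<le> K * norm (cocycle X T M (- int (Suc n)) x *v v)"
    unfolding cocycle_minus_of_nat cocycle_bwd.simps
    using norm_mult_comparable[OF inv K'] by blast+
qed

section \<open>Hypotheses of both sequences from the bound on \<open>B_fun\<close>\<close>

lemma B_fun_fwd:
  fixes M :: "'a \<Rightarrow> real^'n^'n"
  assumes "B_fun X T M lam \<epsilon> x \<le> ereal C" "i \<in> {1..CARD('n)}"
  shows "\<bar>ln (ext_power_norm i (cocycle X T M (int n) x)) - real n * (\<Sum>j=1..i. lam j)\<bar>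
    \<le> C + real n * \<epsilon>"
proof -
  have "B_plus X T M lam \<epsilon> x \<le> ereal C"
    using assms(1) by (simp add: B_fun_def)
  then have "\<forall>i\<in>{1..CARD('n)}. \<forall>n\<in>{0::int..}.
      ereal (\<bar>ln (ext_power_norm i (cocycle X T M n x)) - of_int n * (\<Sum>j=1..i. lam j)\<bar>
        - of_int n * \<epsilon>) \<le> ereal C"
    unfolding B_plus_def SUP_le_iff .
  then have "ereal (\<bar>ln (ext_power_norm i (cocycle X T M (int n) x))
      - of_int (int n) * (\<Sum>j=1..i. lam j)\<bar> - of_int (int n) * \<epsilon>) \<le> ereal C"
    using assms(2) by (elim ballE[of _ _ i] ballE[of _ _ "int n"]) auto
  then show ?thesis
    by simp
qed

lemma sum_reflect:
  fixes f :: "nat \<Rightarrow> 'a::comm_monoid_add"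
  assumes "i \<le> d"
  shows "(\<Sum>j=1..i. f (Suc d - j)) = (\<Sum>j=d - i + 1..d. f j)"
  using assms by (intro sum.reindex_bij_witness[of _ "\<lambda>j. Suc d - j" "\<lambda>j. Suc d - j"]) auto

text \<open>At time - n, the multiple of the sum of the \<open>i\<close> smallest exponents equals n
  times the sum of the first \<open>i\<close> exponents of the negated and reversed list.\<close>

lemma B_fun_bwd:
  fixes M :: "'a \<Rightarrow> real^'n^'n"
  assumes "B_fun X T M lam \<epsilon> x \<le> ereal C" "i \<in> {1..CARD('n)}"
  shows "\<bar>ln (ext_power_norm i (cocycle X T M (- int n) x))
      - real n * (\<Sum>j=1..i. - lam (Suc CARD('n) - j))\<bar> \<le> C + real n * \<epsilon>"
proof -
  have "B_minus X T M lam \<epsilon> x \<le> ereal C"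
    using assms(1) by (simp add: B_fun_def)
  then have "\<forall>i\<in>{1..CARD('n)}. \<forall>n\<in>{..0::int}.
      ereal (\<bar>ln (ext_power_norm i (cocycle X T M n x))
        - of_int n * (\<Sum>j=CARD('n) - i + 1..CARD('n). lam j)\<bar> - of_int \<bar>n\<bar> * \<epsilon>) \<le> ereal C"
    unfolding B_minus_def SUP_le_iff .
  then have "ereal (\<bar>ln (ext_power_norm i (cocycle X T M (- int n) x))
      - of_int (- int n) * (\<Sum>j=CARD('n) - i + 1..CARD('n). lam j)\<bar>
      - of_int \<bar>- int n\<bar> * \<epsilon>) \<le> ereal C"
    using assms(2) by (elim ballE[of _ _ i] ballE[of _ _ "- int n"]) auto
  moreover have "(\<Sum>j=1..i. - lam (Suc CARD('n) - j)) = - (\<Sum>j=CARD('n) - i + 1..CARD('n). lam j)"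
    using sum_reflect[of i "CARD('n)" lam] assms(2) by (simp add: sum_negf)
  ultimately show ?thesis
    by simp
qed

text \<open>The first index of a block of equal exponents. It is needed because the separation
  hypothesis compares elements of \<open>exp_indices\<close>, and \<open>p - 1\<close> need not be
  one.\<close>

lemma exp_indices_representative:
  assumes mono: "\<And>i j. 1 \<le> i \<Longrightarrow> i \<le> j \<Longrightarrow> j \<le> d \<Longrightarrow> lam j \<le> lam i"
    and j: "j \<in> {1..d}"
  obtains l where "l \<in> exp_indices d lam" "lam l = lam j"
proof -
  define l where "l = (LEAST l. 1 \<le> l \<and> lam l = lam j)"
  have l: "1 \<le> l" "lam l = lam j" "l \<le> j"
    using LeastI[of "\<lambda>l. 1 \<le> l \<and> lam l = lam j" j] Least_le[of "\<lambda>l. 1 \<le> l \<and> lam l = lam j" j] j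
    by (auto simp: l_def)
  have "l = 1 \<or> lam l < lam (l - 1)"
  proof (rule ccontr)
    assume *: "\<not> (l = 1 \<or> lam l < lam (l - 1))"
    then have "1 \<le> l - 1" "l - 1 < l"
      using l by auto
    moreover have "lam l \<le> lam (l - 1)"
      using * l j by (intro mono) auto
    ultimately have "1 \<le> l - 1 \<and> lam (l - 1) = lam j"
      using * l by auto
    then show False
      using not_less_Least[of "l - 1" "\<lambda>l. 1 \<le> l \<and> lam l = lam j"] \<open>l - 1 < l\<close>
      by (simp add: l_def)
  qed
  then show ?thesis
    using that[of l] l j by (auto simp: exp_indices_def)
qed

lemma singular_frames_exist:
  fixes A :: "nat \<Rightarrow> real^'n^'n"
  assumes "\<And>n. invertible (A n)"
  shows "\<exists>e s. \<forall>n. singular_frame (A n) (e n) (s n)"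
proof -
  have "\<forall>n. \<exists>es. singular_frame (A n) (fst es) (snd es)"
    using singular_frame_exists[OF assms] by (metis fst_conv snd_conv)
  then obtain es where "\<And>n. singular_frame (A n) (fst (es n)) (snd (es n))"
    by metis
  then show ?thesis
    by (intro exI[of _ "\<lambda>n. fst (es n)"] exI[of _ "\<lambda>n. snd (es n)"]) blast
qed

text \<open>The excess exponent in a quotient is 4 d \<epsilon> |n| + 2 \<epsilon> |m|, within the
  allowance 10 d \<epsilon> (|n| + |m|), since d \<ge> 1. Only the ratio of the two constants
  remains.\<close>

lemma pesin_fun_le:
  fixes M :: "'a \<Rightarrow> real^'n^'n"
  assumes G: "0 \<le> G" and \<kappa>: "0 < \<kappa>" and \<epsilon>: "0 \<le> \<epsilon>"
    and upper: "\<And>i v n. i \<in> exp_indices CARD('n) lam \<Longrightarrow> v \<in> E i \<Longrightarrow>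
      norm (cocycle X T M n x *v v)
        \<le> G * exp (of_int n * lam i + 4 * real CARD('n) * \<epsilon> * of_int \<bar>n\<bar>) * norm v"
    and lower: "\<And>i v n. i \<in> exp_indices CARD('n) lam \<Longrightarrow> v \<in> E i \<Longrightarrow>
      \<kappa> * exp (of_int n * lam i - 2 * of_int \<bar>n\<bar> * \<epsilon>) * norm v \<le> norm (cocycle X T M n x *v v)"
  shows "pesin_fun X T M lam E (20 * real CARD('n) * \<epsilon>) x \<le> ereal (G / \<kappa>)"
  unfolding pesin_fun_def
proof (intro SUP_least)
  fix i v and m n :: int
  assume i: "i \<in> exp_indices CARD('n) lam" and v: "v \<in> E i - {0}"
  define h where "h = 10 * real CARD('n) * \<epsilon>"
  define a where "a = of_int n * lam i + 4 * real CARD('n) * \<epsilon> * of_int \<bar>n\<bar>"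
  define b where "b = of_int m * lam i - 2 * of_int \<bar>m\<bar> * \<epsilon>"
  have nv: "0 < norm v"
    using v by simp
  then have pos: "0 < \<kappa> * exp b * norm v"
    using \<kappa> by simp
  have "norm (cocycle X T M n x *v v) / norm (cocycle X T M m x *v v)
      \<le> (G * exp a * norm v) / (\<kappa> * exp b * norm v)"
    unfolding a_def b_def using pos G v upper[OF i] lower[OF i] unfolding b_def
    by (intro frac_le) auto
  also have "\<dots> = G / \<kappa> * exp (a - b)"
    using nv by (simp add: exp_diff)
  also have "\<dots> \<le> G / \<kappa> * exp (of_int (n - m) * lam i + of_int (\<bar>n\<bar> + \<bar>m\<bar>) * h)"
  proof -
    have "1 \<le> real CARD('n)"
      by (simp add: Suc_le_eq)
    then have d: "2 \<le> 10 * real CARD('n)"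
      by linarith
    have "\<epsilon> * 4 * real CARD('n) * of_int \<bar>n\<bar> \<le> \<epsilon> * 10 * real CARD('n) * of_int \<bar>n\<bar>"
      using \<epsilon> by (intro mult_right_mono mult_left_mono) auto
    moreover have "of_int \<bar>m\<bar> * \<epsilon> * 2 \<le> of_int \<bar>m\<bar> * \<epsilon> * (10 * real CARD('n))"
      using \<epsilon> by (intro mult_left_mono d) auto
    ultimately have "a - b \<le> of_int (n - m) * lam i + of_int (\<bar>n\<bar> + \<bar>m\<bar>) * h"
      unfolding a_def b_def h_def of_int_add of_int_diff by (simp only: algebra_simps)
    then show ?thesis
      using G \<kappa> by (intro mult_left_mono) auto
  qed
  finally have le: "norm (cocycle X T M n x *v v) / norm (cocycle X T M m x *v v)
      \<le> G / \<kappa> * exp (of_int (n - m) * lam i + of_int (\<bar>n\<bar> + \<bar>m\<bar>) * h)" .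
  have "norm (cocycle X T M n x *v v) / norm (cocycle X T M m x *v v)
      * exp (- (of_int (n - m) * lam i + of_int (\<bar>n\<bar> + \<bar>m\<bar>) * h)) \<le> G / \<kappa>"
    using mult_right_mono[OF le, of "exp (- (of_int (n - m) * lam i + of_int (\<bar>n\<bar> + \<bar>m\<bar>) * h))"]
    by (simp only: mult.assoc exp_add[symmetric]) simp
  moreover have "exp (- (of_int (n - m) * lam i + of_int (\<bar>n\<bar> + \<bar>m\<bar>) * h))
      = exp (- of_int (n - m) * lam i) * exp (- of_int (\<bar>n\<bar> + \<bar>m\<bar>) * (20 * real CARD('n) * \<epsilon>) / 2)"
    unfolding exp_add[symmetric] h_def by (simp add: field_simps)
  ultimately show "ereal (norm (cocycle X T M n x *v v) / norm (cocycle X T M m x *v v)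
      * exp (- of_int (n - m) * lam i) * exp (- of_int (\<bar>n\<bar> + \<bar>m\<bar>) * (20 * real CARD('n) * \<epsilon>) / 2))
      \<le> ereal (G / \<kappa>)"
    by (simp only: ereal_less_eq mult.assoc)
qed

theorem theorem5p1:
  fixes \<mu> :: "'a measure" and T :: "'a \<Rightarrow> 'a" and M :: "'a \<Rightarrow> real^'n^'n"
    and lam :: "nat \<Rightarrow> real" and \<epsilon> \<rho> C :: real
    and X :: "'a set" and d :: nat and I :: "nat set"
  defines "X \<equiv> space \<mu>" and "d \<equiv> CARD('n)" and "I \<equiv> exp_indices CARD('n) lam"
  assumes T: "ergodic_automorphism \<mu> T"
    and M: "log_integrable_cocycle \<mu> M"
    and lyap: "lyapunov_exponents \<mu> T M lam"
    and bdd: "\<exists>K. \<forall>x\<in>X. mnorm (M x) \<le> K \<and> mnorm (matrix_inv (M x)) \<le> K"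
    and eps: "0 < \<epsilon>" "\<forall>i\<in>I. \<forall>j\<in>I. i \<noteq> j \<longrightarrow> \<epsilon> < \<bar>lam i - lam j\<bar> / (20 * real d)"
    and rho: "0 < \<rho>" and C: "0 < C"
  shows "\<exists>m0::nat. \<exists>D::real. 0 < m0 \<and> 0 < D \<and>
    (\<forall>x\<in>X. B_fun X T M lam \<epsilon> x \<le> ereal C \<longrightarrow>
      (\<forall>i\<in>I. \<forall>n\<ge>m0.
         contracted_well_defined (cocycle X T M (int n) x) (d - i + 1) \<and>
         contracted_well_defined (cocycle X T M (- int n) x) (i + exp_mult d lam i - 1)) \<and>
      (\<exists>Fge_inf Fle_inf :: nat \<Rightarrow> (real^'n) set.
         (\<forall>i\<in>I.
            grassmannian_tendsto (d - i + 1) (\<lambda>n. F_ge X T M (int n) i x) (Fge_inf i) \<and>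
            grassmannian_tendsto (i + exp_mult d lam i - 1)
              (\<lambda>n. F_le X T M lam (- int n) i x) (Fle_inf i)) \<and>
         ((\<forall>i\<in>I. \<exists>m\<ge>m0.
              ereal \<rho> \<le> subspace_angle (F_ge X T M (int m) i x) (F_lt X T M (- int m) i x)) \<longrightarrow>
            (\<forall>i\<in>I. subspace (Fge_inf i \<inter> Fle_inf i) \<and>
                    dim (Fge_inf i \<inter> Fle_inf i) = exp_mult d lam i) \<and>
            pesin_fun X T M lam (\<lambda>i. Fge_inf i \<inter> Fle_inf i) (20 * real d * \<epsilon>) x \<le> ereal D)))"
proof -
  let ?d = "CARD('n)"
  define lam' where "lam' = (\<lambda>k. - lam (Suc ?d - k))"
  obtain K0 where K0: "\<And>x. x \<in> X \<Longrightarrow> mnorm (M x) \<le> K0 \<and> mnorm (matrix_inv (M x)) \<le> K0"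
    using bdd by blast
  define K where "K = max K0 0"
  have K: "mnorm (M x) \<le> K \<and> mnorm (matrix_inv (M x)) \<le> K" if "x \<in> X" for x
    using K0[OF that] by (auto simp: K_def)
  have K_nonneg: "0 \<le> K"
    by (simp add: K_def)
  have Minv: "invertible (M x)" if "x \<in> X" for x
    using M that by (simp add: log_integrable_cocycle_def X_def)
  have bij: "bij_betw T X X"
    using T by (simp add: ergodic_automorphism_def X_def)
  then have TX: "T ` X \<subseteq> X"
    by (simp add: bij_betw_def)
  have TX': "inv_into X T ` X \<subseteq> X"
    using bij_betw_inv_into[OF bij] by (simp add: bij_betw_def)
  have mono: "lam j \<le> lam i" if "1 \<le> i" "i \<le> j" "j \<le> ?d" for i j
    using lyap that by (simp add: lyapunov_exponents_def)
  have mono': "lam' j \<le> lam' i" if "1 \<le> i" "i \<le> j" "j \<le> ?d" for i j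
    using that unfolding lam'_def by (intro le_imp_neg_le mono) auto
  define R where "R = (\<Sum>j\<in>{1..?d}. \<bar>lam j\<bar>)"
  have R: "\<bar>lam i\<bar> \<le> R" if "i \<in> {1..?d}" for i
    unfolding R_def using that by (intro member_le_sum) auto
  have R': "\<bar>lam' i\<bar> \<le> R" if "i \<in> {1..?d}" for i
  proof -
    have "Suc ?d - i \<in> {1..?d}"
      using that by auto
    then show ?thesis
      using R by (simp add: lam'_def)
  qed
  have gap: "20 * \<epsilon> < lam (p - 1) - lam p" if p: "p \<in> {2..?d}" "lam p < lam (p - 1)" for p
  proof -
    have "p - 1 \<in> {1..?d}"
      using p by auto
    \<comment> \<open>\<open>p\<close> begins a block, so it lies in \<open>I\<close>;
      \<open>p - 1\<close> is replaced by the first index of its own block to apply the separation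
      hypothesis.\<close>
    then obtain l where l: "l \<in> exp_indices ?d lam" "lam l = lam (p - 1)"
      using exp_indices_representative[of ?d lam "p - 1"] mono by blast
    have "p \<in> I" "l \<in> I" "p \<noteq> l"
      using p l by (auto simp: I_def exp_indices_def)
    then have "\<epsilon> < \<bar>lam p - lam l\<bar> / (20 * real d)"
      using eps(2) by blast
    then have "20 * \<epsilon> * real d < lam (p - 1) - lam p"
      using p l by (simp add: d_def field_simps)
    moreover have "20 * \<epsilon> * 1 \<le> 20 * \<epsilon> * real d"
      using eps(1) by (intro mult_left_mono) (auto simp: d_def Suc_le_eq)
    ultimately show ?thesis by linarith
  qed
  have gap': "20 * \<epsilon> < lam' (p - 1) - lam' p" if p: "p \<in> {2..?d}" "lam' p < lam' (p - 1)" for p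
  proof -
    have "Suc ?d - (p - 1) \<in> {2..?d}" "Suc ?d - (p - 1) - 1 = Suc ?d - p"
      using p by auto
    then show ?thesis
      using gap[of "Suc ?d - (p - 1)"] p(2) by (simp add: lam'_def)
  qed
  define q where "q = exp (- 16 * \<epsilon>)"
  define rate where "rate = rate_const K C \<epsilon> R"
  have "0 \<le> rate"
    using K_nonneg eps(1) by (simp add: rate_def rate_const_def)
  define G where "G = growth_const ?d C rate ?d"
  have G: "0 < G"
    unfolding G_def growth_const_def using \<open>0 \<le> rate\<close>
    by (intro mult_pos_pos zero_less_power add_pos_nonneg) auto
  \<comment> \<open>Chosen so that the angle condition reads: cosine at most 1 - 4
    \<open>\<kappa>\<close>. The minimum with pi / 2 ensures 4 \<open>\<kappa>\<close> \<le>
    1.\<close>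
  define \<kappa> where "\<kappa> = (1 - cos (min \<rho> (pi / 2))) / 4"
  have "0 < min \<rho> (pi / 2)" "min \<rho> (pi / 2) \<le> pi / 2"
    using rho by auto
  then have "cos (min \<rho> (pi / 2)) < cos 0" "0 \<le> cos (min \<rho> (pi / 2))"
    using pi_gt_zero by (intro cos_monotone_0_pi cos_ge_zero; linarith)+
  then have \<kappa>: "0 < \<kappa>" "4 * \<kappa> \<le> 1" and cos_eq: "cos (min \<rho> (pi / 2)) = 1 - 4 * \<kappa>"
    unfolding \<kappa>_def by (auto simp: field_simps)
  have "(\<lambda>n. 2 * real ?d * rate * q ^ n) \<longlonglongrightarrow> 0"
    using eps(1) unfolding q_def by (auto intro!: tendsto_eq_intros LIMSEQ_power_zero)
  then have "\<forall>\<^sub>F n in sequentially. 2 * real ?d * rate * q ^ n < \<kappa>"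
    using \<kappa>(1) by (rule order_tendstoD(2))
  then obtain N where N: "\<And>n. N \<le> n \<Longrightarrow> 2 * real ?d * rate * q ^ n < \<kappa>"
    unfolding eventually_sequentially by blast
  obtain N' where N': "C / (4 * \<epsilon>) < real N'"
    using reals_Archimedean2 by blast
  \<comment> \<open>\<open>N\<close> makes the tails \<open>\<kappa>\<close>-close to their limits,
    \<open>N'\<close> opens the gaps between singular values, and 1 makes \<open>m0\<close>
    positive.\<close>
  define m0 where "m0 = max N (max N' 1)"
  have close: "2 * real ?d * rate * q ^ n \<le> \<kappa>" if "m0 \<le> n" for n
    using N[of n] that by (simp add: m0_def)
  have large: "C < 4 * \<epsilon> * real n" if "m0 \<le> n" for n
  proof -
    have "real N' \<le> real n"
      using that by (simp add: m0_def)
    with N' have "C / (4 * \<epsilon>) < real n"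
      by linarith
    then show ?thesis
      using eps(1) by (simp add: field_simps)
  qed
  define \<kappa>' where "\<kappa>' = \<kappa> * exp (- 2 * C - 2 * real m0 * R)"
  have \<kappa>': "0 < \<kappa>'"
    using \<kappa> by (simp add: \<kappa>'_def)
  show ?thesis
    unfolding d_def I_def
  proof (intro exI[of _ m0] exI[of _ "G / \<kappa>'"] conjI ballI allI impI)
    show "0 < m0"
      by (simp add: m0_def)
    show "0 < G / \<kappa>'"
      using G \<kappa>' by simp
  next
    fix x assume x: "x \<in> X" and B: "B_fun X T M lam \<epsilon> x \<le> ereal C"
    define A where "A = (\<lambda>n. cocycle X T M (int n) x)"
    define A' where "A' = (\<lambda>n. cocycle X T M (- int n) x)"
    have A_eq: "A n = cocycle X T M (int n) x" and A'_eq: "A' n = cocycle X T M (- int n) x" for n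
      by (simp_all add: A_def A'_def)
    have "invertible (A n)" for n
      unfolding A_def by (rule cocycle_fwd_step(1)[OF _ _ TX x]) (use Minv K in auto)
    then obtain e s where frame: "\<And>n. singular_frame (A n) (e n) (s n)"
      using singular_frames_exist[of A] by blast
    have "invertible (A' n)" for n
      unfolding A'_def by (rule cocycle_bwd_step(1)[OF _ _ TX' x]) (use Minv K in auto)
    then obtain e' s' where frame': "\<And>n. singular_frame (A' n) (e' n) (s' n)"
      using singular_frames_exist[of A'] by blast
    interpret fwd: pesin_sequence A lam K C \<epsilon> R e s
    proof
      show "norm (A (Suc n) *v v) \<le> K * norm (A n *v v)" for n v
        unfolding A_def by (rule cocycle_fwd_step(2)[OF _ _ TX x]) (use Minv K in auto)
      show "norm (A n *v v) \<le> K * norm (A (Suc n) *v v)" for n v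
        unfolding A_def by (rule cocycle_fwd_step(3)[OF _ _ TX x]) (use Minv K in auto)
      show "\<bar>ln (ext_power_norm i (A n)) - real n * (\<Sum>j=1..i. lam j)\<bar> \<le> C + real n * \<epsilon>"
        if "i \<in> {1..?d}" for i n
        unfolding A_def by (rule B_fun_fwd[OF B that])
    qed (use frame K_nonneg C eps(1) mono R gap in auto)
    interpret bwd: pesin_sequence A' lam' K C \<epsilon> R e' s'
    proof
      show "norm (A' (Suc n) *v v) \<le> K * norm (A' n *v v)" for n v
        unfolding A'_def by (rule cocycle_bwd_step(2)[OF _ _ TX' x]) (use Minv K in auto)
      show "norm (A' n *v v) \<le> K * norm (A' (Suc n) *v v)" for n v
        unfolding A'_def by (rule cocycle_bwd_step(3)[OF _ _ TX' x]) (use Minv K in auto)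
      show "\<bar>ln (ext_power_norm i (A' n)) - real n * (\<Sum>j=1..i. lam' j)\<bar> \<le> C + real n * \<epsilon>"
        if "i \<in> {1..?d}" for i n
        unfolding A'_def lam'_def by (rule B_fun_bwd[OF B that])
    qed (use frame' K_nonneg C eps(1) mono' R' gap' in auto)
    define U where "U = fwd.limit_space"
    define W where "W = (\<lambda>i. bwd.limit_space (Suc (Suc ?d) - i))"
    have regular: "regular_index ?d lam i" if "i \<in> exp_indices ?d lam" for i
      using that by (auto simp: exp_indices_def regular_index_def)
    have regular': "regular_index ?d lam' (Suc (Suc ?d) - i)" if "regular_index ?d lam i" for i
      using that regular_index_reflect[of i ?d lam] unfolding lam'_def by (auto simp: regular_index_def)
    have fwd_dim: "?d - i + 1 = Suc ?d - i" if "i \<in> exp_indices ?d lam" for i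
      using that by (auto simp: exp_indices_def)
    have bwd_dim: "Suc ?d - (Suc (Suc ?d) - i) = i - 1" if "regular_index ?d lam i" for i
      using that by (auto simp: regular_index_def)
    have next_regular: "regular_index ?d lam (i + exp_mult ?d lam i)" if "i \<in> exp_indices ?d lam" for i
      by (rule exp_mult_next_index(4)[OF _ that]) (rule mono)
    show "\<exists>Fge_inf Fle_inf :: nat \<Rightarrow> (real^'n) set.
         (\<forall>i\<in>exp_indices ?d lam.
            grassmannian_tendsto (?d - i + 1) (\<lambda>n. F_ge X T M (int n) i x) (Fge_inf i) \<and>
            grassmannian_tendsto (i + exp_mult ?d lam i - 1)
              (\<lambda>n. F_le X T M lam (- int n) i x) (Fle_inf i)) \<and>
         ((\<forall>i\<in>exp_indices ?d lam. \<exists>m\<ge>m0.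
              ereal \<rho> \<le> subspace_angle (F_ge X T M (int m) i x) (F_lt X T M (- int m) i x)) \<longrightarrow>
            (\<forall>i\<in>exp_indices ?d lam. subspace (Fge_inf i \<inter> Fle_inf i) \<and>
                    dim (Fge_inf i \<inter> Fle_inf i) = exp_mult ?d lam i) \<and>
            pesin_fun X T M lam (\<lambda>i. Fge_inf i \<inter> Fle_inf i) (20 * real ?d * \<epsilon>) x \<le> ereal (G / \<kappa>'))"
    proof (rule exI[of _ U], rule exI[of _ "\<lambda>i. W (i + exp_mult ?d lam i)"], intro conjI ballI impI)
      fix i assume i: "i \<in> exp_indices ?d lam"
      show "grassmannian_tendsto (?d - i + 1) (\<lambda>n. F_ge X T M (int n) i x) (U i)"
        unfolding F_ge_def fwd_dim[OF i] U_def A_eq[symmetric]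
        by (rule fwd.grassmannian_tendsto_limit_space[OF regular[OF i]]) (rule large)
      have reg: "regular_index ?d lam (i + exp_mult ?d lam i)"
        using i by (rule next_regular)
      let ?p = "Suc (Suc ?d) - (i + exp_mult ?d lam i)"
      have "grassmannian_tendsto (Suc ?d - ?p) (\<lambda>n. contracted_subspace (A' n) (Suc ?d - ?p))
          (bwd.limit_space ?p)"
        by (rule bwd.grassmannian_tendsto_limit_space[OF regular'[OF reg]]) (rule large)
      then show "grassmannian_tendsto (i + exp_mult ?d lam i - 1)
          (\<lambda>n. F_le X T M lam (- int n) i x) (W (i + exp_mult ?d lam i))"
        unfolding bwd_dim[OF reg] F_le_def W_def A'_eq .
    next
      assume angle: "\<forall>i\<in>exp_indices ?d lam. \<exists>m\<ge>m0.
        ereal \<rho> \<le> subspace_angle (F_ge X T M (int m) i x) (F_lt X T M (- int m) i x)"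
      \<comment> \<open>The limit spaces were fixed without the angle condition, from the two
        sequences alone. Only here, once the condition is assumed, are they related to each
        other.\<close>
      interpret pair: pesin_pair A A' lam K C \<epsilon> R e e' s s' \<kappa> m0
      proof (intro pesin_pair.intro pesin_pair_axioms.intro)
        show "pesin_sequence A lam K C \<epsilon> R e s" ..
        show "pesin_sequence A' (\<lambda>k. - lam (Suc ?d - k)) K C \<epsilon> R e' s'"
          using bwd.pesin_sequence_axioms unfolding lam'_def .
        fix i assume i: "i \<in> exp_indices ?d lam"
        then obtain m where m: "m0 \<le> m"
          "ereal \<rho> \<le> subspace_angle (F_ge X T M (int m) i x) (F_lt X T M (- int m) i x)"
          using angle by blast
        have "F_ge X T M (int m) i x = fwd.F i m"
          using fwd.contracted(2)[OF regular[OF i] large[OF m(1)]]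
          unfolding F_ge_def fwd_dim[OF i] A_def .
        moreover have "F_lt X T M (- int m) i x = bwd.F (Suc (Suc ?d) - i) m"
          using bwd.contracted(2)[OF regular'[OF regular[OF i]] large[OF m(1)]]
          unfolding bwd_dim[OF regular[OF i]] F_lt_def A'_def .
        ultimately have "\<bar>u \<bullet> w\<bar> \<le> (1 - 4 * \<kappa>) * (norm u * norm w)"
          if "u \<in> fwd.F i m" "w \<in> bwd.F (Suc (Suc ?d) - i) m" for u w
          using subspace_angle_inner_le[OF m(2) rho _ _ , of u w] that
          by (simp add: subspace_tail_space cos_eq)
        then show "\<exists>m\<ge>m0. \<forall>u\<in>fwd.F i m. \<forall>w\<in>bwd.F (Suc (Suc ?d) - i) m.
            \<bar>u \<bullet> w\<bar> \<le> (1 - 4 * \<kappa>) * (norm u * norm w)"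
          using m(1) by blast
      qed (use \<kappa> close in \<open>auto simp: rate_def q_def\<close>)
      {
        fix i assume i: "i \<in> exp_indices ?d lam"
        show "subspace (U i \<inter> W (i + exp_mult ?d lam i))"
          using pair.subspace_U[OF regular[OF i]] pair.subspace_W[OF next_regular[OF i]]
          by (simp add: U_def W_def subspace_inter)
        show "dim (U i \<inter> W (i + exp_mult ?d lam i)) = exp_mult ?d lam i"
          using pair.dim_E[OF i] by (simp add: U_def W_def)
      }
      show "pesin_fun X T M lam (\<lambda>i. U i \<inter> W (i + exp_mult ?d lam i)) (20 * real ?d * \<epsilon>) x
          \<le> ereal (G / \<kappa>')"
      proof (rule pesin_fun_le)
        fix i v and n :: int
        assume i: "i \<in> exp_indices ?d lam" and "v \<in> U i \<inter> W (i + exp_mult ?d lam i)"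
        then have v: "v \<in> fwd.limit_space i \<inter>
            bwd.limit_space (Suc (Suc ?d) - (i + exp_mult ?d lam i))"
          by (simp add: U_def W_def)
        show "norm (cocycle X T M n x *v v)
            \<le> G * exp (of_int n * lam i + 4 * real ?d * \<epsilon> * of_int \<bar>n\<bar>) * norm v"
        proof (cases n rule: int_cases2)
          case (nonneg k)
          then show ?thesis
            using pair.fwd_bounds(1)[OF i v, of k] by (simp add: A_def G_def rate_def)
        next
          case (nonpos k)
          then show ?thesis
            using pair.bwd_bounds(1)[OF i v, of k] by (simp add: A'_def G_def rate_def)
        qed
        show "\<kappa>' * exp (of_int n * lam i - 2 * of_int \<bar>n\<bar> * \<epsilon>) * norm v
            \<le> norm (cocycle X T M n x *v v)"
        proof (cases n rule: int_cases2)
          case (nonneg k)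
          then show ?thesis
            using pair.fwd_bounds(2)[OF i v, of k] by (simp add: A_def \<kappa>'_def)
        next
          case (nonpos k)
          then show ?thesis
            using pair.bwd_bounds(2)[OF i v, of k] by (simp add: A'_def \<kappa>'_def)
        qed
      qed (use G \<kappa>' eps(1) in auto)
    qed
    fix i n assume i: "i \<in> exp_indices ?d lam" and n: "m0 \<le> n"
    show "contracted_well_defined (cocycle X T M (int n) x) (?d - i + 1)"
      using fwd.contracted(1)[OF regular[OF i] large[OF n]] unfolding A_def fwd_dim[OF i] .
    have reg: "regular_index ?d lam (i + exp_mult ?d lam i)"
      using i by (rule next_regular)
    show "contracted_well_defined (cocycle X T M (- int n) x) (i + exp_mult ?d lam i - 1)"
      using bwd.contracted(1)[OF regular'[OF reg] large[OF n]] unfolding bwd_dim[OF reg] A'_def .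
  qed
qed

end
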